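(* Let $\pi:V\to X$ be a finite-dimensional diffeological vector pseudo-bundle that is locally trivial and admits a pseudo-metric $g$. Then there is a natural induced pseudo-metric $g^*$ on its dual pseudo-bundle $\pi^*:V^*\to X$.
   Context: A diffeological space is a set with a collection of maps (plots) from open subsets of the $\mathbb{R}^n$'s, containing all constant maps, closed under precomposition with usual smooth maps, and satisfying the sheaf condition. A map is smooth if it carries plots to plots. Subsets and products carry the subset and product diffeologies. A subset of a diffeological space is D-open if its preimage under every plot is open. A diffeological vector pseudo-bundle is a smooth surjection $\pi:V\to X$ with real vector space structures on fibres such that fibrewise addition $V\times_XV\to V$, scalar multiplication $\mathbb{R}\times V\to V$ and the zero section are smooth; it is finite-dimensional if its fibres are. It is locally trivial if every $x\in X$ has a (D-open) neighbourhood $X'$ with $\pi^{-1}(X')\cong X'\times\pi^{-1}(x)$ as diffeological vector pseudo-bundles over $X'$. Dual pseudo-bundle $\pi^*:V^*\to X$: $V^*=\bigcup_x(\pi^{-1}(x))^*$, with $(\pi^{-1}(x))^*$ the space of smooth linear maps $\pi^{-1}(x)\to\mathbb{R}$; $p:U\to V^*$ is a plot iff for every plot $q:U'\to V$ the map $(u,u')\mapsto p(u)(q(u'))$ on $\{(u,u')\mid\pi^*(p(u))=\pi(q(u'))\}\subset U\times U'$ is smooth for the subset diffeology. Tensor products of pseudo-bundles are fibrewise, with the smallest pseudo-bundle diffeology making $V\times_XV'\to V\otimes V'$ smooth. Elements of $V^*\otimes V^*$ are regarded as bilinear forms on fibres of $V$. Pseudo-metric on $\pi:V\to X$: a smooth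 section $g:X\to V^*\otimes V^*$ such that each $g(x)$ is symmetric, positive semi-definite, of rank $\dim((\pi^{-1}(x))^* )$. (A pseudo-metric on the dual pseudo-bundle $V^*$ is accordingly a smooth section of $(V^* )^*\otimes(V^* )^*$ with the corresponding properties.)
   Formalization: A plot p of the dual V^* is additionally required to have π^*∘p a plot of X; with the evaluation condition alone, zero functionals over arbitrary maps U→X would be plots, so π^* would not be smooth and V^* would not be a pseudo-bundle. *)

theory Defs
  imports "HOL-Analysis.Analysis" "HOL-Library.Function_Algebras"
begin

section \<open>Smooth maps between open subsets of the spaces \<open>\<real>\<^sup>n\<close>\<close>

text \<open>
  A diffeology involves all dimensions at once, so \<open>\<real>\<^sup>n\<close> is the library space
  \<^term>\<open>Euclidean_space n\<close>: functions \<open>nat \<Rightarrow> real\<close> vanishing at all indices \<open>\<ge> n\<close>.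
  The notions below depend only on the values of the function on the open set \<open>U\<close>.
\<close>

definition partial_deriv :: "nat \<Rightarrow> ((nat \<Rightarrow> real) \<Rightarrow> real) \<Rightarrow> (nat \<Rightarrow> real) \<Rightarrow> real" where
  "partial_deriv i f x = deriv (\<lambda>t. f (x(i := t))) (x i)"

primrec Ck :: "nat \<Rightarrow> nat \<Rightarrow> (nat \<Rightarrow> real) set \<Rightarrow> ((nat \<Rightarrow> real) \<Rightarrow> real) \<Rightarrow> bool" where
  "Ck 0 n U f \<longleftrightarrow> continuous_map (subtopology (Euclidean_space n) U) euclideanreal f"
| "Ck (Suc k) n U f \<longleftrightarrow>
     continuous_map (subtopology (Euclidean_space n) U) euclideanreal f \<and>
     (\<forall>i<n. (\<forall>x\<in>U. (\<lambda>t. f (x(i := t))) differentiable (at (x i))) \<and> Ck k n U (partial_deriv i f))"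

definition smooth_fun :: "nat \<Rightarrow> (nat \<Rightarrow> real) set \<Rightarrow> ((nat \<Rightarrow> real) \<Rightarrow> real) \<Rightarrow> bool" where
  "smooth_fun n U f \<longleftrightarrow> (\<forall>k. Ck k n U f)"

definition smooth_map ::
    "nat \<Rightarrow> (nat \<Rightarrow> real) set \<Rightarrow> nat \<Rightarrow> (nat \<Rightarrow> real) set \<Rightarrow> ((nat \<Rightarrow> real) \<Rightarrow> (nat \<Rightarrow> real)) \<Rightarrow> bool" where
  "smooth_map m W n U f \<longleftrightarrow> f ` W \<subseteq> U \<and> (\<forall>j<n. smooth_fun m W (\<lambda>x. f x j))"


section \<open>Diffeological spaces\<close>

text \<open>
  \<open>plot D n U p\<close> says that the restriction of \<open>p\<close> to the open set \<open>U \<subseteq> \<real>\<^sup>n\<close> is a plot;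
  that values off \<open>U\<close> are irrelevant is part of the sheaf condition as stated here.
\<close>

record 'a diffspace =
  points :: "'a set"
  plot :: "nat \<Rightarrow> (nat \<Rightarrow> real) set \<Rightarrow> ((nat \<Rightarrow> real) \<Rightarrow> 'a) \<Rightarrow> bool"

definition diffeological_space :: "'a diffspace \<Rightarrow> bool" where
  "diffeological_space D \<longleftrightarrow>
     (\<forall>n U p. plot D n U p \<longrightarrow> openin (Euclidean_space n) U \<and> p ` U \<subseteq> points D) \<and>
     (\<forall>n U c. openin (Euclidean_space n) U \<and> c \<in> points D \<longrightarrow> plot D n U (\<lambda>_. c)) \<and>
     (\<forall>n U p m W f. plot D n U p \<and> openin (Euclidean_space m) W \<and> smooth_map m W n U f
        \<longrightarrow> plot D m W (p \<circ> f)) \<and>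
     (\<forall>n U p. openin (Euclidean_space n) U \<and>
        (\<forall>u\<in>U. \<exists>W q. u \<in> W \<and> W \<subseteq> U \<and> plot D n W q \<and> (\<forall>w\<in>W. p w = q w))
        \<longrightarrow> plot D n U p)"

definition dsmooth :: "'a diffspace \<Rightarrow> 'b diffspace \<Rightarrow> ('a \<Rightarrow> 'b) \<Rightarrow> bool" where
  "dsmooth D E f \<longleftrightarrow> f ` points D \<subseteq> points E \<and>
     (\<forall>n U p. plot D n U p \<longrightarrow> plot E n U (f \<circ> p))"

definition subD :: "'a diffspace \<Rightarrow> 'a set \<Rightarrow> 'a diffspace" where
  "subD D A = \<lparr>points = points D \<inter> A, plot = (\<lambda>n U p. plot D n U p \<and> p ` U \<subseteq> A)\<rparr>"

definition prodD :: "'a diffspace \<Rightarrow> 'b diffspace \<Rightarrow> ('a \<times> 'b) diffspace" where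
  "prodD D E = \<lparr>points = points D \<times> points E,
     plot = (\<lambda>n U p. plot D n U (fst \<circ> p) \<and> plot E n U (snd \<circ> p))\<rparr>"

definition euclD :: "nat \<Rightarrow> (nat \<Rightarrow> real) set \<Rightarrow> (nat \<Rightarrow> real) diffspace" where
  "euclD n U = \<lparr>points = U,
     plot = (\<lambda>m W f. openin (Euclidean_space m) W \<and> smooth_map m W n U f)\<rparr>"

definition realD :: "real diffspace" where
  "realD = \<lparr>points = UNIV, plot = (\<lambda>m W f. openin (Euclidean_space m) W \<and> smooth_fun m W f)\<rparr>"

definition D_open :: "'a diffspace \<Rightarrow> 'a set \<Rightarrow> bool" where
  "D_open D A \<longleftrightarrow> A \<subseteq> points D \<and>
     (\<forall>n U p. plot D n U p \<longrightarrow> openin (Euclidean_space n) {u \<in> U. p u \<in> A})"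


section \<open>Diffeological vector pseudo-bundles\<close>

text \<open>\<open>fadd V v w\<close> is meaningful only for \<open>v\<close>, \<open>w\<close> in the same fibre.\<close>

record ('v, 'x) pbundle =
  total_space :: "'v diffspace"
  base_space :: "'x diffspace"
  bproj :: "'v \<Rightarrow> 'x"
  fadd :: "'v \<Rightarrow> 'v \<Rightarrow> 'v"
  fscale :: "real \<Rightarrow> 'v \<Rightarrow> 'v"
  fzero :: "'x \<Rightarrow> 'v"

definition fibre :: "('v, 'x) pbundle \<Rightarrow> 'x \<Rightarrow> 'v set" where
  "fibre V x = {v \<in> points (total_space V). bproj V v = x}"

definition real_vector_space_on ::
    "'v set \<Rightarrow> ('v \<Rightarrow> 'v \<Rightarrow> 'v) \<Rightarrow> (real \<Rightarrow> 'v \<Rightarrow> 'v) \<Rightarrow> 'v \<Rightarrow> bool" where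
  "real_vector_space_on F pl sm z \<longleftrightarrow>
     z \<in> F \<and>
     (\<forall>v\<in>F. \<forall>w\<in>F. pl v w \<in> F) \<and>
     (\<forall>r. \<forall>v\<in>F. sm r v \<in> F) \<and>
     (\<forall>u\<in>F. \<forall>v\<in>F. \<forall>w\<in>F. pl (pl u v) w = pl u (pl v w)) \<and>
     (\<forall>v\<in>F. \<forall>w\<in>F. pl v w = pl w v) \<and>
     (\<forall>v\<in>F. pl z v = v) \<and>
     (\<forall>v\<in>F. \<exists>w\<in>F. pl v w = z) \<and>
     (\<forall>r. \<forall>v\<in>F. \<forall>w\<in>F. sm r (pl v w) = pl (sm r v) (sm r w)) \<and>
     (\<forall>r s. \<forall>v\<in>F. sm (r + s) v = pl (sm r v) (sm s v)) \<and>
     (\<forall>r s. \<forall>v\<in>F. sm (r * s) v = sm r (sm s v)) \<and>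
     (\<forall>v\<in>F. sm 1 v = v)"

definition vector_pseudo_bundle :: "('v, 'x) pbundle \<Rightarrow> bool" where
  "vector_pseudo_bundle V \<longleftrightarrow>
     diffeological_space (total_space V) \<and>
     diffeological_space (base_space V) \<and>
     dsmooth (total_space V) (base_space V) (bproj V) \<and>
     bproj V ` points (total_space V) = points (base_space V) \<and>
     (\<forall>x\<in>points (base_space V). real_vector_space_on (fibre V x) (fadd V) (fscale V) (fzero V x)) \<and>
     dsmooth (subD (prodD (total_space V) (total_space V)) {(v, w). bproj V v = bproj V w})
       (total_space V) (\<lambda>(v, w). fadd V v w) \<and>
     dsmooth (prodD realD (total_space V)) (total_space V) (\<lambda>(r, v). fscale V r v) \<and>
     dsmooth (base_space V) (total_space V) (fzero V)"

definition fibre_span :: "('v, 'x) pbundle \<Rightarrow> 'x \<Rightarrow> 'v set \<Rightarrow> 'v set" where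
  "fibre_span V x B = \<Inter>{S. B \<subseteq> S \<and> S \<subseteq> fibre V x \<and> fzero V x \<in> S \<and>
     (\<forall>v\<in>S. \<forall>w\<in>S. fadd V v w \<in> S) \<and> (\<forall>r. \<forall>v\<in>S. fscale V r v \<in> S)}"

definition finite_dim_pseudo_bundle :: "('v, 'x) pbundle \<Rightarrow> bool" where
  "finite_dim_pseudo_bundle V \<longleftrightarrow> vector_pseudo_bundle V \<and>
     (\<forall>x\<in>points (base_space V). \<exists>B. finite B \<and> B \<subseteq> fibre V x \<and> fibre_span V x B = fibre V x)"

definition restrict_bundle :: "('v, 'x) pbundle \<Rightarrow> 'x set \<Rightarrow> ('v, 'x) pbundle" where
  "restrict_bundle V A = V\<lparr>total_space := subD (total_space V) {v. bproj V v \<in> A},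
     base_space := subD (base_space V) A\<rparr>"

text \<open>The product pseudo-bundle \<open>A \<times> \<pi>\<^sup>-\<^sup>1(x) \<rightarrow> A\<close>:\<close>

definition product_bundle :: "('v, 'x) pbundle \<Rightarrow> 'x set \<Rightarrow> 'x \<Rightarrow> ('x \<times> 'v, 'x) pbundle" where
  "product_bundle V A x =
     \<lparr>total_space = prodD (subD (base_space V) A) (subD (total_space V) (fibre V x)),
      base_space = subD (base_space V) A,
      bproj = fst,
      fadd = (\<lambda>(a, v) (b, w). (a, fadd V v w)),
      fscale = (\<lambda>r (a, v). (a, fscale V r v)),
      fzero = (\<lambda>a. (a, fzero V x))\<rparr>"

definition bundle_iso :: "('v, 'x) pbundle \<Rightarrow> ('w, 'x) pbundle \<Rightarrow> ('v \<Rightarrow> 'w) \<Rightarrow> bool" where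
  "bundle_iso V W h \<longleftrightarrow>
     base_space V = base_space W \<and>
     bij_betw h (points (total_space V)) (points (total_space W)) \<and>
     dsmooth (total_space V) (total_space W) h \<and>
     dsmooth (total_space W) (total_space V) (inv_into (points (total_space V)) h) \<and>
     (\<forall>v\<in>points (total_space V). bproj W (h v) = bproj V v) \<and>
     (\<forall>x\<in>points (base_space V). \<forall>v\<in>fibre V x. \<forall>w\<in>fibre V x. h (fadd V v w) = fadd W (h v) (h w)) \<and>
     (\<forall>r. \<forall>v\<in>points (total_space V). h (fscale V r v) = fscale W r (h v))"

definition locally_trivial :: "('v, 'x) pbundle \<Rightarrow> bool" where
  "locally_trivial V \<longleftrightarrow> (\<forall>x\<in>points (base_space V). \<exists>A. x \<in> A \<and> D_open (base_space V) A \<and>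
     (\<exists>h. bundle_iso (restrict_bundle V A) (product_bundle V A x) h))"


section \<open>The dual pseudo-bundle\<close>

text \<open>A functional on a fibre is represented by its extension by zero to the whole type.\<close>

definition smooth_dual :: "('v, 'x) pbundle \<Rightarrow> 'x \<Rightarrow> ('v \<Rightarrow> real) set" where
  "smooth_dual V x = {\<phi>.
     (\<forall>v\<in>fibre V x. \<forall>w\<in>fibre V x. \<phi> (fadd V v w) = \<phi> v + \<phi> w) \<and>
     (\<forall>r. \<forall>v\<in>fibre V x. \<phi> (fscale V r v) = r * \<phi> v) \<and>
     dsmooth (subD (total_space V) (fibre V x)) realD \<phi> \<and>
     (\<forall>v. v \<notin> fibre V x \<longrightarrow> \<phi> v = 0)}"

text \<open>
  The disjoint union of the dual fibres consists of pairs \<open>(x, \<phi>)\<close>.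
  Besides smoothness of the evaluations, a plot \<open>p\<close> of the dual is required to have
  \<open>\<pi>\<^sup>* \<circ> p\<close> a plot of the base. This does not follow from the evaluation condition
  (which is vacuous for zero functionals over an arbitrary map into the base), and
  without it \<open>\<pi>\<^sup>*\<close> would not be smooth.
\<close>

definition dual_plot ::
    "('v, 'x) pbundle \<Rightarrow> nat \<Rightarrow> (nat \<Rightarrow> real) set \<Rightarrow> ((nat \<Rightarrow> real) \<Rightarrow> 'x \<times> ('v \<Rightarrow> real)) \<Rightarrow> bool" where
  "dual_plot V n U p \<longleftrightarrow>
     openin (Euclidean_space n) U \<and>
     (\<forall>u\<in>U. snd (p u) \<in> smooth_dual V (fst (p u))) \<and>
     plot (base_space V) n U (fst \<circ> p) \<and>
     (\<forall>m W q. plot (total_space V) m W q \<longrightarrow>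
        dsmooth (subD (prodD (euclD n U) (euclD m W)) {(u, w). fst (p u) = bproj V (q w)}) realD
          (\<lambda>(u, w). snd (p u) (q w)))"

definition dual_bundle :: "('v, 'x) pbundle \<Rightarrow> ('x \<times> ('v \<Rightarrow> real), 'x) pbundle" where
  "dual_bundle V =
     \<lparr>total_space = \<lparr>points = (SIGMA x:points (base_space V). smooth_dual V x), plot = dual_plot V\<rparr>,
      base_space = base_space V,
      bproj = fst,
      fadd = (\<lambda>(x, \<phi>) (y, \<psi>). (x, \<lambda>v. \<phi> v + \<psi> v)),
      fscale = (\<lambda>r (x, \<phi>). (x, \<lambda>v. r * \<phi> v)),
      fzero = (\<lambda>x. (x, \<lambda>v. 0))\<rparr>"


section \<open>The tensor square of the dual pseudo-bundle\<close>

text \<open>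
  The tensor product of two spaces of real functions embeds canonically into functions of
  two variables, \<open>\<phi> \<otimes> \<psi>\<close> being \<open>(v, w) \<mapsto> \<phi> v \<cdot> \<psi> w\<close>; this is how elements of
  \<open>V\<^sup>* \<otimes> V\<^sup>*\<close> are regarded as bilinear forms on the fibres of \<open>V\<close>.
\<close>

definition tensor_form :: "('v \<Rightarrow> real) \<Rightarrow> ('v \<Rightarrow> real) \<Rightarrow> 'v \<Rightarrow> 'v \<Rightarrow> real" where
  "tensor_form \<phi> \<psi> = (\<lambda>v w. \<phi> v * \<psi> w)"

definition dual_tensor_fibre :: "('v, 'x) pbundle \<Rightarrow> 'x \<Rightarrow> ('v \<Rightarrow> 'v \<Rightarrow> real) set" where
  "dual_tensor_fibre V x = {b. \<exists>(n::nat) \<phi> \<psi>.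
     (\<forall>i<n. \<phi> i \<in> smooth_dual V x \<and> \<psi> i \<in> smooth_dual V x) \<and>
     b = (\<lambda>v w. \<Sum>i<n. tensor_form (\<phi> i) (\<psi> i) v w)}"

type_synonym 'a plots = "nat \<Rightarrow> (nat \<Rightarrow> real) set \<Rightarrow> ((nat \<Rightarrow> real) \<Rightarrow> 'a) \<Rightarrow> bool"

text \<open>\<open>V\<^sup>* \<otimes> V\<^sup>*\<close> with a given collection of plots on its total space:\<close>

definition dual_tensor_with ::
    "('v, 'x) pbundle \<Rightarrow> ('x \<times> ('v \<Rightarrow> 'v \<Rightarrow> real)) plots \<Rightarrow> ('x \<times> ('v \<Rightarrow> 'v \<Rightarrow> real), 'x) pbundle" where
  "dual_tensor_with V P =
     \<lparr>total_space = \<lparr>points = (SIGMA x:points (base_space V). dual_tensor_fibre V x), plot = P\<rparr>,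
      base_space = base_space V,
      bproj = fst,
      fadd = (\<lambda>(x, a) (y, b). (x, \<lambda>v w. a v w + b v w)),
      fscale = (\<lambda>r (x, a). (x, \<lambda>v w. r * a v w)),
      fzero = (\<lambda>x. (x, \<lambda>v w. 0))\<rparr>"

definition tensor_admissible :: "('v, 'x) pbundle \<Rightarrow> ('x \<times> ('v \<Rightarrow> 'v \<Rightarrow> real)) plots \<Rightarrow> bool" where
  "tensor_admissible V P \<longleftrightarrow>
     vector_pseudo_bundle (dual_tensor_with V P) \<and>
     dsmooth (subD (prodD (total_space (dual_bundle V)) (total_space (dual_bundle V))) {(a, b). fst a = fst b})
       (total_space (dual_tensor_with V P))
       (\<lambda>((x, \<phi>), (y, \<psi>)). (x, tensor_form \<phi> \<psi>))"

text \<open>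
  The smallest pseudo-bundle diffeology making \<open>V\<^sup>* \<times>\<^sub>X V\<^sup>* \<rightarrow> V\<^sup>* \<otimes> V\<^sup>*\<close> smooth
  is the intersection of all of them.
\<close>

definition dual_tensor_bundle :: "('v, 'x) pbundle \<Rightarrow> ('x \<times> ('v \<Rightarrow> 'v \<Rightarrow> real), 'x) pbundle" where
  "dual_tensor_bundle V =
     dual_tensor_with V (\<lambda>n U p. \<forall>P. tensor_admissible V P \<longrightarrow> P n U p)"


section \<open>Pseudo-metrics\<close>

definition fun_dim :: "('a \<Rightarrow> real) set \<Rightarrow> nat" where
  "fun_dim = vector_space.dim (\<lambda>(c::real) (f::'a \<Rightarrow> real) a. c * f a)"

text \<open>The rank of a bilinear form \<open>b\<close> is that of the linear map \<open>v \<mapsto> b(v, \<cdot>)\<close>.\<close>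

definition bilin_rank :: "('v, 'x) pbundle \<Rightarrow> 'x \<Rightarrow> ('v \<Rightarrow> 'v \<Rightarrow> real) \<Rightarrow> nat" where
  "bilin_rank V x b = fun_dim (b ` fibre V x)"

text \<open>A section \<open>x \<mapsto> (x, g x)\<close> is given by its second component \<open>g\<close>.\<close>

definition pseudo_metric :: "('v, 'x) pbundle \<Rightarrow> ('x \<Rightarrow> 'v \<Rightarrow> 'v \<Rightarrow> real) \<Rightarrow> bool" where
  "pseudo_metric V g \<longleftrightarrow>
     finite_dim_pseudo_bundle V \<and>
     dsmooth (base_space V) (total_space (dual_tensor_bundle V)) (\<lambda>x. (x, g x)) \<and>
     (\<forall>x\<in>points (base_space V).
        (\<forall>v\<in>fibre V x. \<forall>w\<in>fibre V x. g x v w = g x w v) \<and>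
        (\<forall>v\<in>fibre V x. 0 \<le> g x v v) \<and>
        bilin_rank V x (g x) = fun_dim (smooth_dual V x))"

text \<open>The pairing map \<open>V \<rightarrow> V\<^sup>*\<close>, \<open>v \<mapsto> g(\<pi>(v))(v, \<cdot>)\<close>:\<close>

definition pairing :: "('v, 'x) pbundle \<Rightarrow> ('x \<Rightarrow> 'v \<Rightarrow> 'v \<Rightarrow> real) \<Rightarrow> 'v \<Rightarrow> 'x \<times> ('v \<Rightarrow> real)" where
  "pairing V g v = (bproj V v, g (bproj V v) v)"

text \<open>
  The natural induced form on the dual is the one that corresponds to \<open>g\<close> under the
  pairing map: \<open>g\<^sup>*(x)(g(x)(v, \<cdot>), g(x)(w, \<cdot>)) = g(x)(v, w)\<close>.
\<close>

definition induced_by :: "('v, 'x) pbundle \<Rightarrow> ('x \<Rightarrow> 'v \<Rightarrow> 'v \<Rightarrow> real) \<Rightarrow>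
    ('x \<Rightarrow> 'x \<times> ('v \<Rightarrow> real) \<Rightarrow> 'x \<times> ('v \<Rightarrow> real) \<Rightarrow> real) \<Rightarrow> bool" where
  "induced_by V g gs \<longleftrightarrow>
     (\<forall>x\<in>points (base_space V). \<forall>v\<in>fibre V x. \<forall>w\<in>fibre V x.
        gs x (pairing V g v) (pairing V g w) = g x v w)"

end

theory Submission
  imports Defs
begin

text \<open>
  Why the theorem holds.  A pseudo-metric \<open>g\<close> turns every vector \<open>v\<close> of a fibre into the
  functional \<open>g(x)(v, \<cdot>)\<close>.  The rank condition makes this map onto the smooth dual of the
  fibre (\<open>pseudo_metric_onto_smooth_dual\<close>), and by Cauchy-Schwarz its kernel is exactly the
  null space of \<open>g(x)\<close>.  So \<open>g(x)\<close> descends to the smooth dual, and the condition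
  \<open>g\<^sup>*(g(v, \<cdot>), g(w, \<cdot>)) = g(v, w)\<close> determines \<open>g\<^sup>*\<close> completely; symmetry and
  positivity are inherited from \<open>g\<close>.

  What needs work is that \<open>g\<^sup>*\<close> is a smooth section, and this is where local triviality
  enters.  In a fibre choose a family of vectors of minimal size that separates the smooth
  functionals; minimality makes it independent modulo the common kernel of these functionals.
  A local trivialization spreads the family along any plot of the base and keeps both
  properties, because it also identifies the smooth duals of the fibres
  (\<open>local_separating_sections\<close>).  Gram-Schmidt orthogonalization with respect to \<open>g\<close> is
  then possible at all points of the domain at once and consists of smooth operations.  It
  gives plots \<open>e\<^sub>i\<close> and \<open>f\<^sub>i = e\<^sub>i / g(e\<^sub>i, e\<^sub>i)\<close> of \<open>V\<close> with
  \<open>\<phi> = \<Sum>\<^sub>i \<phi>(e\<^sub>i) g(f\<^sub>i, \<cdot>)\<close> for every smooth functional \<open>\<phi>\<close> (\<open>local_dual_frame\<close>).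
  In terms of them \<open>g\<^sup>* = \<Sum>\<^sub>i ev(f\<^sub>i) \<otimes> ev(e\<^sub>i)\<close>, where \<open>ev(v)\<close> is evaluation at \<open>v\<close>
  (\<open>dual_form_frame\<close>).  Evaluation at a plot of \<open>V\<close> is a plot of the bidual, so this finite
  sum of tensors is a plot for every admissible diffeology on the tensor square, hence for
  their intersection, the smallest one.  The same formula shows that \<open>g\<^sup>*\<close> maps the dual fibre onto its own
  smooth dual, which is the rank condition.

  Two facts about diffeologies support this.  The function \<open>u \<mapsto> g(p(u))(a(u), b(u))\<close> is
  smooth for plots \<open>a\<close>, \<open>b\<close> of \<open>V\<close> over \<open>p\<close>: the collection of all maps for which such
  evaluations are smooth is itself an admissible diffeology, so it contains the smallest one
  (\<open>smooth_section_evaluation\<close>).  And duals are again pseudo-bundles.  Both are instances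
  of one construction, a pseudo-bundle of functions whose plots are tested by evaluation
  (locale \<open>evaluation_bundle\<close>).  Underneath lies the calculus of \<open>C\<^sup>k\<close> functions
  given by iterated partial derivatives, whose main point is the chain rule.
\<close>

section \<open>Open sets of \<open>\<real>\<^sup>n\<close> and functions of class \<open>C\<^sup>k\<close>\<close>

lemma openin_Euclidean_space_eq:
  assumes "openin (Euclidean_space n) U"
  obtains T where "open T" "U = T \<inter> {x. \<forall>i\<ge>n. x i = 0}"
  using assms unfolding Euclidean_space_def openin_subtopology euclidean_product_topology
  by auto

lemma openin_Euclidean_space_vanishing:
  assumes "openin (Euclidean_space n) U" "x \<in> U" "n \<le> i"
  shows "x i = 0"
  using openin_subset[OF assms(1)] assms(2,3) by (auto simp: topspace_Euclidean_space)

lemma continuous_map_subtopology_Euclidean_space_iff: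
  assumes "openin (Euclidean_space n) U"
  shows "continuous_map (subtopology (Euclidean_space n) U) euclideanreal f \<longleftrightarrow> continuous_on U f"
proof -
  have "subtopology (Euclidean_space n) U = top_of_set U"
    unfolding Euclidean_space_def euclidean_product_topology subtopology_subtopology
    using openin_subset[OF assms] by (metis Int_absorb1 topspace_Euclidean_space)
  then show ?thesis by simp
qed

text \<open>
  A neighbourhood in the product topology restricts only finitely many coordinates, so it
  contains a cube in the first \<open>n\<close> of them.
\<close>

lemma Euclidean_space_open_box:
  assumes "openin (Euclidean_space n) U" "x \<in> U"
  shows "\<exists>d>0. \<forall>y. (\<forall>j<n. \<bar>y j - x j\<bar> < d) \<and> (\<forall>j\<ge>n. y j = 0) \<longrightarrow> y \<in> U"
proof -
  obtain T where T: "open T" "U = T \<inter> {x. \<forall>i\<ge>n. x i = 0}"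
    using openin_Euclidean_space_eq[OF assms(1)] .
  have "\<exists>X. x \<in> (\<Pi>\<^sub>E i\<in>UNIV. X i) \<and> (\<forall>i. open (X i)) \<and> finite {i. X i \<noteq> UNIV} \<and> (\<Pi>\<^sub>E i\<in>UNIV. X i) \<subseteq> T"
    using product_topology_open_contains_basis[of "\<lambda>_. euclidean" UNIV T x] T assms(2)
    by (auto simp: open_fun_def)
  then obtain X where X: "\<And>i. x i \<in> X i" "\<And>i. open (X i)" "(\<Pi>\<^sub>E i\<in>UNIV. X i) \<subseteq> T"
    by (auto simp: PiE_iff)
  have "\<forall>i. \<exists>d>0. \<forall>s. \<bar>s - x i\<bar> < d \<longrightarrow> s \<in> X i"
    using X(1,2) by (auto simp: open_dist dist_real_def)
  then obtain d where d: "\<And>i. d i > 0" "\<And>i s. \<bar>s - x i\<bar> < d i \<Longrightarrow> s \<in> X i"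
    by metis
  define e where "e = Min (insert 1 (d ` {..<n}))"
  have e: "e > 0" "\<And>i. i < n \<Longrightarrow> e \<le> d i"
    using d(1) by (auto simp: e_def)
  show ?thesis
  proof (intro exI conjI allI impI)
    show "e > 0" by fact
    fix y assume "(\<forall>j<n. \<bar>y j - x j\<bar> < e) \<and> (\<forall>j\<ge>n. y j = 0)"
    then have y: "\<And>j. j < n \<Longrightarrow> \<bar>y j - x j\<bar> < e" "\<And>j. n \<le> j \<Longrightarrow> y j = 0" by auto
    have "y i \<in> X i" for i
    proof (cases "i < n")
      case True then show ?thesis using d(2) y(1) e(2) by (meson less_le_trans)
    next
      case False
      then have "y i = x i" using y(2) openin_Euclidean_space_vanishing[OF assms] by simp
      then show ?thesis using X(1) by simp
    qed
    then show "y \<in> U" using X(3) y(2) T(2) by (auto simp: PiE_iff)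
  qed
qed

lemma eventually_update_in_open:
  assumes "openin (Euclidean_space n) U" "x \<in> U" "i < n"
  shows "eventually (\<lambda>t. x(i := t) \<in> U) (nhds (x i))"
proof -
  obtain d where d: "d > 0"
    "\<And>y. (\<forall>j<n. \<bar>y j - x j\<bar> < d) \<and> (\<forall>j\<ge>n. y j = 0) \<Longrightarrow> y \<in> U"
    using Euclidean_space_open_box[OF assms(1,2)] by blast
  have "x(i := t) \<in> U" if "dist t (x i) < d" for t
  proof (rule d(2), intro conjI allI impI)
    show "\<bar>(x(i := t)) j - x j\<bar> < d" if "j < n" for j
      using \<open>dist t (x i) < d\<close> d(1) by (cases "j = i") (simp_all add: dist_real_def)
    show "(x(i := t)) j = 0" if "n \<le> j" for j
      using that assms(3) openin_Euclidean_space_vanishing[OF assms(1,2) that] by simp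
  qed
  then show ?thesis using d(1) unfolding eventually_nhds_metric by blast
qed

lemma Ck_continuous_on:
  assumes "Ck k n U f" "openin (Euclidean_space n) U"
  shows "continuous_on U f"
  using assms by (cases k) (auto simp: continuous_map_subtopology_Euclidean_space_iff)

lemma Ck_Suc_has_partial:
  assumes "Ck (Suc k) n U f" "x \<in> U" "i < n"
  shows "((\<lambda>t. f (x(i := t))) has_real_derivative partial_deriv i f x) (at (x i))"
  using assms unfolding partial_deriv_def
  by (auto simp: real_differentiable_def DERIV_imp_deriv dest!: spec[of _ i])

text \<open>
  Partial derivatives at points of an open set see only values in that set, so the class
  \<open>C\<^sup>k\<close> on \<open>U\<close> is insensitive to values outside, where \<^const>\<open>partial_deriv\<close> is junk.
\<close>

lemma Ck_cong:
  assumes "openin (Euclidean_space n) U" "\<And>x. x \<in> U \<Longrightarrow> f x = g x" "Ck k n U f"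
  shows "Ck k n U g"
  using assms(2,3)
proof (induction k arbitrary: f g)
  case 0
  then have "continuous_on U g"
    using Ck_continuous_on[OF 0(2) assms(1)] by (metis continuous_on_cong)
  then show ?case by (simp add: continuous_map_subtopology_Euclidean_space_iff assms(1))
next
  case (Suc k)
  have "continuous_on U g"
    using Ck_continuous_on[OF Suc.prems(2) assms(1)] Suc.prems(1) by (metis continuous_on_cong)
  moreover have "(\<lambda>t. g (x(i := t))) differentiable at (x i) \<and> partial_deriv i f x = partial_deriv i g x"
    if "i < n" "x \<in> U" for i x
  proof -
    have ev: "\<forall>\<^sub>F t in nhds (x i). f (x(i := t)) = g (x(i := t))"
      using eventually_update_in_open[OF assms(1) that(2,1)] by eventually_elim (rule Suc.prems(1))
    have "((\<lambda>t. g (x(i := t))) has_real_derivative partial_deriv i f x) (at (x i))"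
      by (rule iffD1[OF DERIV_cong_ev[OF refl ev refl] Ck_Suc_has_partial[OF Suc.prems(2) that(2,1)]])
    then show ?thesis
      by (auto simp: real_differentiable_def partial_deriv_def DERIV_imp_deriv)
  qed
  moreover have "Ck k n U (partial_deriv i g)" if "i < n" for i
    using Suc.IH[of "partial_deriv i f" "partial_deriv i g"] Suc.prems(2) calculation(2) that by simp
  ultimately show ?case
    by (simp add: continuous_map_subtopology_Euclidean_space_iff assms(1))
qed

text \<open>
  Candidates \<open>f' i\<close> for the partial derivatives suffice, since they agree on \<open>U\<close> with the
  actual ones; this lets formulas from the differentiation rules be used directly.
\<close>

lemma Ck_SucI:
  assumes "openin (Euclidean_space n) U" "continuous_on U f"
    and "\<And>i. i < n \<Longrightarrow> Ck k n U (f' i)"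
    and "\<And>i x. i < n \<Longrightarrow> x \<in> U \<Longrightarrow> ((\<lambda>t. f (x(i := t))) has_real_derivative f' i x) (at (x i))"
  shows "Ck (Suc k) n U f"
proof -
  have "partial_deriv i f x = f' i x" if "i < n" "x \<in> U" for i x
    using assms(4)[OF that] by (simp add: partial_deriv_def DERIV_imp_deriv)
  then have "Ck k n U (partial_deriv i f)" if "i < n" for i
    using Ck_cong[OF assms(1) _ assms(3)[OF that]] that by metis
  moreover have "\<forall>x\<in>U. (\<lambda>t. f (x(i := t))) differentiable at (x i)" if "i < n" for i
    using assms(4)[OF that] by (auto simp: real_differentiable_def)
  ultimately show ?thesis
    using assms(1,2) by (simp add: continuous_map_subtopology_Euclidean_space_iff)
qed

lemma Ck_Suc_imp_Ck: "Ck (Suc k) n U f \<Longrightarrow> Ck k n U f"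
  by (induction k arbitrary: f) auto

lemma Ck_const:
  assumes "openin (Euclidean_space n) U"
  shows "Ck k n U (\<lambda>_. c)"
proof (induction k arbitrary: c)
  case 0 show ?case by (simp add: assms continuous_map_subtopology_Euclidean_space_iff)
next
  case (Suc k) show ?case
    by (rule Ck_SucI[where f' = "\<lambda>_ _. 0"]) (use Suc assms in auto)
qed

lemma Ck_coordinate:
  assumes "openin (Euclidean_space n) U"
  shows "Ck k n U (\<lambda>x. x j)"
proof -
  have c: "continuous_on U (\<lambda>x. x j)"
    by (rule continuous_on_product_then_coordinatewise[OF continuous_on_id])
  show ?thesis
  proof (cases k)
    case 0 then show ?thesis by (simp add: assms c continuous_map_subtopology_Euclidean_space_iff)
  next
    case (Suc l)
    have "Ck (Suc l) n U (\<lambda>x. x j)"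
      by (rule Ck_SucI[where f' = "\<lambda>i _. if i = j then 1 else 0"])
        (use assms c Ck_const[OF assms] in \<open>auto simp: fun_upd_def\<close>)
    then show ?thesis using Suc by simp
  qed
qed

lemma Ck_add:
  assumes "openin (Euclidean_space n) U" "Ck k n U f" "Ck k n U g"
  shows "Ck k n U (\<lambda>x. f x + g x)"
  using assms(2,3)
proof (induction k arbitrary: f g)
  case 0 then show ?case using assms(1)
    by (simp add: continuous_map_subtopology_Euclidean_space_iff continuous_on_add)
next
  case (Suc k)
  show ?case
  proof (rule Ck_SucI[OF assms(1), where f' = "\<lambda>i x. partial_deriv i f x + partial_deriv i g x"])
    show "continuous_on U (\<lambda>x. f x + g x)"
      using Suc.prems Ck_continuous_on[OF _ assms(1)] by (blast intro: continuous_on_add)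
    show "Ck k n U (\<lambda>x. partial_deriv i f x + partial_deriv i g x)" if "i < n" for i
      using Suc that by simp
    show "((\<lambda>t. f (x(i := t)) + g (x(i := t))) has_real_derivative
        partial_deriv i f x + partial_deriv i g x) (at (x i))" if "i < n" "x \<in> U" for i x
      by (rule DERIV_add[OF Ck_Suc_has_partial[OF Suc.prems(1) that(2,1)] Ck_Suc_has_partial[OF Suc.prems(2) that(2,1)]])
  qed
qed

lemma Ck_mult:
  assumes "openin (Euclidean_space n) U" "Ck k n U f" "Ck k n U g"
  shows "Ck k n U (\<lambda>x. f x * g x)"
  using assms(2,3)
proof (induction k arbitrary: f g)
  case 0 then show ?case using assms(1)
    by (simp add: continuous_map_subtopology_Euclidean_space_iff continuous_on_mult)
next
  case (Suc k)
  show ?case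
  proof (rule Ck_SucI[OF assms(1), where f' = "\<lambda>i x. partial_deriv i f x * g x + partial_deriv i g x * f x"])
    show "continuous_on U (\<lambda>x. f x * g x)"
      using Suc.prems Ck_continuous_on[OF _ assms(1)] by (blast intro: continuous_on_mult)
    show "Ck k n U (\<lambda>x. partial_deriv i f x * g x + partial_deriv i g x * f x)" if "i < n" for i
      using Suc.prems Ck_Suc_imp_Ck that by (intro Ck_add assms(1) Suc.IH) auto
    show "((\<lambda>t. f (x(i := t)) * g (x(i := t))) has_real_derivative
        partial_deriv i f x * g x + partial_deriv i g x * f x) (at (x i))" if "i < n" "x \<in> U" for i x
    proof -
      note d = Ck_Suc_has_partial[OF Suc.prems(1) that(2,1)] Ck_Suc_has_partial[OF Suc.prems(2) that(2,1)]
      show ?thesis by (rule DERIV_cong[OF DERIV_mult[OF d]]) simp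
    qed
  qed
qed

lemma Ck_sum:
  assumes "openin (Euclidean_space n) U" "\<And>j. j < (m::nat) \<Longrightarrow> Ck k n U (f j)"
  shows "Ck k n U (\<lambda>x. \<Sum>j<m. f j x)"
  using assms(2) by (induction m) (auto intro: Ck_const Ck_add assms(1))

text \<open>
  The derivative of \<open>1/f\<close> is a polynomial in \<open>1/f\<close> and the derivative of \<open>f\<close>, so one more
  degree of smoothness comes from the previous one.
\<close>

lemma Ck_inverse:
  assumes "openin (Euclidean_space n) U" "Ck k n U f" "\<And>x. x \<in> U \<Longrightarrow> f x \<noteq> 0"
  shows "Ck k n U (\<lambda>x. inverse (f x))"
  using assms(2)
proof (induction k)
  case 0 then show ?case using assms(1,3)
    by (simp add: continuous_map_subtopology_Euclidean_space_iff continuous_on_inverse)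
next
  case (Suc k)
  show ?case
  proof (rule Ck_SucI[OF assms(1), where f' = "\<lambda>i x. - 1 * (partial_deriv i f x * (inverse (f x) * inverse (f x)))"])
    show "continuous_on U (\<lambda>x. inverse (f x))"
      using Suc.prems Ck_continuous_on[OF _ assms(1)] assms(3) by (blast intro: continuous_on_inverse)
    show "Ck k n U (\<lambda>x. - 1 * (partial_deriv i f x * (inverse (f x) * inverse (f x))))" if "i < n" for i
      using Suc Ck_Suc_imp_Ck that by (intro Ck_mult assms(1) Ck_const) auto
    show "((\<lambda>t. inverse (f (x(i := t)))) has_real_derivative
        - 1 * (partial_deriv i f x * (inverse (f x) * inverse (f x)))) (at (x i))" if "i < n" "x \<in> U" for i x
      by (rule DERIV_cong[OF DERIV_inverse_fun[OF Ck_Suc_has_partial[OF Suc.prems that(2,1)]]])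
        (use assms(3)[OF that(2)] in \<open>simp_all add: algebra_simps\<close>)
  qed
qed

lemma Ck_local:
  assumes U: "openin (Euclidean_space n) U"
    and "\<And>u. u \<in> U \<Longrightarrow> \<exists>W. u \<in> W \<and> W \<subseteq> U \<and> openin (Euclidean_space n) W \<and> Ck k n W f"
  shows "Ck k n U f"
  using assms(2)
proof (induction k arbitrary: f)
  case (0 f)
  have "continuous (at u within U) f" if u: "u \<in> U" for u
  proof -
    obtain W where W: "u \<in> W" "W \<subseteq> U" "openin (Euclidean_space n) W" "Ck 0 n W f"
      using 0[OF u] by (elim exE conjE)
    obtain T where T: "open T" "W = T \<inter> {x. \<forall>i\<ge>n. x i = 0}" using openin_Euclidean_space_eq[OF W(3)] .
    have "U \<subseteq> {x. \<forall>i\<ge>n. x i = 0}" using openin_subset[OF U] by (simp only: topspace_Euclidean_space)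
    then have "U \<inter> T - {u} = W \<inter> T - {u}" using W(2) T(2) by blast
    moreover have "u \<in> T" using W(1) T(2) by blast
    ultimately have "at u within U = at u within W" by (intro at_within_nhd[OF _ T(1)])
    moreover have "continuous (at u within W) f"
      using Ck_continuous_on[OF W(4,3)] W(1) by (simp only: continuous_on_eq_continuous_within)
    ultimately show ?thesis by simp
  qed
  then have "continuous_on U f" unfolding continuous_on_eq_continuous_within ..
  then show ?case by (simp add: continuous_map_subtopology_Euclidean_space_iff U)
next
  case (Suc k f)
  have "Ck k n U f"
  proof (rule Suc.IH)
    fix u assume "u \<in> U"
    then obtain W where W: "u \<in> W" "W \<subseteq> U" "openin (Euclidean_space n) W" "Ck (Suc k) n W f"
      using Suc.prems by meson
    then show "\<exists>W. u \<in> W \<and> W \<subseteq> U \<and> openin (Euclidean_space n) W \<and> Ck k n W f"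
      using Ck_Suc_imp_Ck[OF W(4)] by (intro exI[of _ W]) simp
  qed
  then have "continuous_on U f" by (rule Ck_continuous_on[OF _ U])
  moreover have "(\<lambda>t. f (x(i := t))) differentiable at (x i)" if "i < n" "x \<in> U" for i x
    using Suc.prems[OF that(2)] that(1) by (elim exE conjE) simp
  moreover have "Ck k n U (partial_deriv i f)" if "i < n" for i
  proof (rule Suc.IH)
    fix u assume "u \<in> U"
    then obtain W where W: "u \<in> W" "W \<subseteq> U" "openin (Euclidean_space n) W" "Ck (Suc k) n W f"
      using Suc.prems by meson
    then show "\<exists>W. u \<in> W \<and> W \<subseteq> U \<and> openin (Euclidean_space n) W \<and> Ck k n W (partial_deriv i f)"
      using that by (intro exI[of _ W]) simp
  qed
  ultimately show ?case by (simp add: continuous_map_subtopology_Euclidean_space_iff U)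
qed

lemma Ck_subset:
  assumes "openin (Euclidean_space n) U" "openin (Euclidean_space n) W" "W \<subseteq> U" "Ck k n U f"
  shows "Ck k n W f"
  using assms(4)
proof (induction k arbitrary: f)
  case 0
  have "continuous_on W f" using Ck_continuous_on[OF 0 assms(1)] assms(3) by (rule continuous_on_subset)
  then show ?case by (simp add: continuous_map_subtopology_Euclidean_space_iff[OF assms(2)])
next
  case (Suc k)
  have "continuous_on W f" using Ck_continuous_on[OF Suc.prems assms(1)] assms(3) by (rule continuous_on_subset)
  then show ?case using Suc assms(3)
    by (simp add: continuous_map_subtopology_Euclidean_space_iff[OF assms(2)] subset_iff)
qed

section \<open>The chain rule\<close>

lemma DERIV_mean_value_between:
  fixes F F' :: "real \<Rightarrow> real"
  assumes "\<And>s. min a b \<le> s \<Longrightarrow> s \<le> max a b \<Longrightarrow> (F has_real_derivative F' s) (at s)" "a \<noteq> b"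
  obtains s where "min a b \<le> s" "s \<le> max a b" "(F b - F a) / (b - a) = F' s"
proof (cases "a < b")
  case True
  then have "\<exists>z>a. z < b \<and> F b - F a = (b - a) * F' z"
    using assms(1) by (intro MVT2) auto
  then obtain z where "z > a" "z < b" "F b - F a = (b - a) * F' z" by blast
  then show thesis using that[of z] True by simp
next
  case False
  then have ba: "b < a" using assms(2) by simp
  then have "\<exists>z>b. z < a \<and> F a - F b = (a - b) * F' z"
    using assms(1) by (intro MVT2) auto
  then obtain z where z: "z > b" "z < a" "F a - F b = (a - b) * F' z" by blast
  have "(F b - F a) / (b - a) = (F a - F b) / (a - b)"
    using minus_divide_divide[of "F a - F b" "a - b"] by simp
  then show thesis using that[of z] ba z by simp
qed

text \<open>
  The chain rule along a curve, for functions with continuous partial derivatives.  The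
  increment \<open>f (h t) - f (h t0)\<close> is telescoped by changing one coordinate at a time; the mean
  value theorem turns each term into a partial derivative at a nearby point times the
  increment of that coordinate, and continuity of the partial derivatives gives the limit.
\<close>

lemma has_real_derivative_compose_partials:
  assumes U: "openin (Euclidean_space n) U" and f: "Ck (Suc 0) n U f"
    and h0: "h t0 \<in> U"
    and h: "\<And>j. j < n \<Longrightarrow> ((\<lambda>t. h t j) has_real_derivative d j) (at t0)"
    and hU: "\<forall>\<^sub>F t in nhds t0. h t \<in> U"
  shows "((\<lambda>t. f (h t)) has_real_derivative (\<Sum>j<n. partial_deriv j f (h t0) * d j)) (at t0)"
proof -
  define x where "x = h t0"
  have xz: "x j = 0" if "n \<le> j" for j
    using openin_Euclidean_space_vanishing[OF U h0 that] by (simp add: x_def)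
  \<comment> \<open>The telescoping path: it leads from \<open>h t0\<close> to \<open>h t\<close> while \<open>h t\<close> is in \<open>U\<close>, and
    consecutive points differ in one coordinate.\<close>
  define H where "H t i = (\<lambda>j. if j < i then h t j else x j)" for t and i :: nat
  have Hupd: "(H t i)(i := h t i) = H t (Suc i)" "(H t i)(i := x i) = H t i" for t i
    by (auto simp: H_def fun_eq_iff less_Suc_eq)
  \<comment> \<open>Difference quotients of \<open>f\<close> in the \<open>i\<close>-th coordinate, continued by the partial
    derivative where the coordinate does not move.\<close>
  define Q where "Q i t = (if h t i = x i then partial_deriv i f x
      else (f (H t (Suc i)) - f (H t i)) / (h t i - x i))" for i t
  have lim_h: "((\<lambda>t. h t j) \<longlongrightarrow> x j) (at t0)" if "j < n" for j
    using DERIV_isCont[OF h[OF that]] by (simp add: isCont_def x_def)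
  have limQ: "(Q i \<longlongrightarrow> partial_deriv i f x) (at t0)" if i: "i < n" for i
  proof (rule tendstoI)
    fix e :: real assume e: "e > 0"
    have "continuous_on U (partial_deriv i f)"
      using f i U by (simp add: continuous_map_subtopology_Euclidean_space_iff)
    then have "openin (top_of_set U) (U \<inter> partial_deriv i f -` ball (partial_deriv i f x) e)"
      by (rule continuous_openin_preimage_gen) simp
    moreover have "top_of_set U = subtopology (Euclidean_space n) U"
      unfolding Euclidean_space_def euclidean_product_topology subtopology_subtopology
      using openin_subset[OF U] by (metis Int_absorb1 topspace_Euclidean_space)
    ultimately have "openin (Euclidean_space n) (U \<inter> partial_deriv i f -` ball (partial_deriv i f x) e)"
      using U by (simp add: openin_trans_full)
    moreover have "x \<in> U \<inter> partial_deriv i f -` ball (partial_deriv i f x) e"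
      using h0 e by (simp add: x_def)
    ultimately have "\<exists>r>0. \<forall>y. (\<forall>j<n. \<bar>y j - x j\<bar> < r) \<and> (\<forall>j\<ge>n. y j = 0)
        \<longrightarrow> y \<in> U \<inter> partial_deriv i f -` ball (partial_deriv i f x) e"
      by (rule Euclidean_space_open_box)
    then obtain r where r: "r > 0" "\<And>y. (\<forall>j<n. \<bar>y j - x j\<bar> < r) \<and> (\<forall>j\<ge>n. y j = 0)
        \<Longrightarrow> y \<in> U \<inter> partial_deriv i f -` ball (partial_deriv i f x) e"
      by (elim exE conjE) auto
    have "\<forall>\<^sub>F t in at t0. \<forall>j\<in>{..<n}. dist (h t j) (x j) < r"
      using lim_h r(1) by (intro eventually_ball_finite) (auto simp: tendsto_iff)
    then show "\<forall>\<^sub>F t in at t0. dist (Q i t) (partial_deriv i f x) < e"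
    proof eventually_elim
      case (elim t)
      have near: "(H t i)(i := s) \<in> U \<inter> partial_deriv i f -` ball (partial_deriv i f x) e"
        if "min (x i) (h t i) \<le> s" "s \<le> max (x i) (h t i)" for s
      proof (rule r(2), intro conjI allI impI)
        have "\<bar>s - x i\<bar> \<le> \<bar>h t i - x i\<bar>" using that by (auto simp: min_def max_def split: if_splits)
        also have "\<dots> < r" using elim i by (simp add: dist_real_def)
        finally show "\<bar>((H t i)(i := s)) j - x j\<bar> < r" if "j < n" for j
          using that elim r(1) by (auto simp: H_def dist_real_def)
        show "((H t i)(i := s)) j = 0" if "n \<le> j" for j
          using that i xz by (auto simp: H_def)
      qed
      show ?case
      proof (cases "h t i = x i")
        case True then show ?thesis using e by (simp add: Q_def)
      next
        case False
        obtain s where s: "min (x i) (h t i) \<le> s" "s \<le> max (x i) (h t i)"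
          "(f ((H t i)(i := h t i)) - f ((H t i)(i := x i))) / (h t i - x i) = partial_deriv i f ((H t i)(i := s))"
        proof (rule DERIV_mean_value_between[of "x i" "h t i" "\<lambda>s. f ((H t i)(i := s))" "\<lambda>s. partial_deriv i f ((H t i)(i := s))"])
          fix s assume "min (x i) (h t i) \<le> s" "s \<le> max (x i) (h t i)"
          then have "(H t i)(i := s) \<in> U" using near by blast
          from Ck_Suc_has_partial[OF f this i]
          show "((\<lambda>s. f ((H t i)(i := s))) has_real_derivative partial_deriv i f ((H t i)(i := s))) (at s)"
            by simp
        qed (use False in auto)
        then have "Q i t = partial_deriv i f ((H t i)(i := s))"
          using False by (simp add: Q_def Hupd)
        then show ?thesis using near[OF s(1,2)] by (simp add: dist_commute)
      qed
    qed
  qed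
  have "((\<lambda>t. \<Sum>i<n. Q i t * ((h t i - h t0 i) / (t - t0))) \<longlongrightarrow> (\<Sum>i<n. partial_deriv i f x * d i)) (at t0)"
    using limQ h by (intro tendsto_sum tendsto_mult) (auto simp: has_field_derivative_iff)
  moreover have "\<forall>\<^sub>F t in at t0. (\<Sum>i<n. Q i t * ((h t i - h t0 i) / (t - t0))) = (f (h t) - f (h t0)) / (t - t0)"
  proof -
    have "\<forall>\<^sub>F t in at t0. h t \<in> U" using hU by (simp add: eventually_nhds_conv_at)
    then show ?thesis
    proof eventually_elim
      case (elim t)
      have "Q i t * (h t i - x i) = f (H t (Suc i)) - f (H t i)" for i
      proof (cases "h t i = x i")
        case True then show ?thesis using Hupd[of t i] by simp
      qed (simp add: Q_def)
      then have "(\<Sum>i<n. Q i t * (h t i - x i)) = (\<Sum>i<n. f (H t (Suc i)) - f (H t i))" by simp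
      also have "\<dots> = f (H t n) - f (H t 0)" by (rule sum_lessThan_telescope)
      also have "H t n = h t"
        using xz openin_Euclidean_space_vanishing[OF U elim] by (auto simp: H_def fun_eq_iff)
      also have "H t 0 = h t0" by (simp add: H_def x_def)
      finally show ?case by (simp add: x_def flip: sum_divide_distrib)
    qed
  qed
  ultimately have "((\<lambda>t. (f (h t) - f (h t0)) / (t - t0)) \<longlongrightarrow> (\<Sum>i<n. partial_deriv i f x * d i)) (at t0)"
    by (rule Lim_transform_eventually)
  then show ?thesis by (simp add: has_field_derivative_iff x_def)
qed

lemma smooth_map_continuous_on:
  assumes "openin (Euclidean_space m) W" "openin (Euclidean_space n) U" "smooth_map m W n U h"
  shows "continuous_on W h"
proof (rule continuous_on_coordinatewise_then_product)
  fix j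
  show "continuous_on W (\<lambda>x. h x j)"
  proof (cases "j < n")
    case True
    then have "Ck 0 m W (\<lambda>x. h x j)" using assms(3) by (simp only: smooth_map_def smooth_fun_def)
    then show ?thesis by (rule Ck_continuous_on[OF _ assms(1)])
  next
    case False
    then have "h x j = 0" if "x \<in> W" for x
      using assms(3) that openin_Euclidean_space_vanishing[OF assms(2)] by (auto simp: smooth_map_def)
    then show ?thesis by (metis continuous_on_cong continuous_on_const)
  qed
qed

text \<open>
  By the chain rule the partial derivatives of the composite are sums of products of
  composites of class \<open>C\<^sup>k\<close>, so induction on \<open>k\<close> applies.
\<close>

lemma Ck_compose:
  assumes W: "openin (Euclidean_space m) W" and U: "openin (Euclidean_space n) U"
    and h: "smooth_map m W n U h" and f: "Ck k n U f"
  shows "Ck k m W (\<lambda>x. f (h x))"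
  using f
proof (induction k arbitrary: f)
  have cont: "continuous_on W (\<lambda>x. f (h x))" if "continuous_on U f" for f :: "_ \<Rightarrow> real"
    using continuous_on_compose2[OF that smooth_map_continuous_on[OF W U h]] h
    by (auto simp: smooth_map_def)
  {
    case 0 then show ?case
      using cont Ck_continuous_on[OF 0 U] by (simp add: continuous_map_subtopology_Euclidean_space_iff W)
  next
    case (Suc k)
    have hC: "Ck l m W (\<lambda>x. h x j)" if "j < n" for l j
      using h that by (simp add: smooth_map_def smooth_fun_def)
    have f1: "Ck (Suc 0) n U f"
      using Suc.prems Ck_continuous_on[OF _ U] by (auto simp: continuous_map_subtopology_Euclidean_space_iff U)
    show ?case
    proof (rule Ck_SucI[OF W, where f' = "\<lambda>i x. \<Sum>j<n. partial_deriv j f (h x) * partial_deriv i (\<lambda>x. h x j) x"])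
      show "continuous_on W (\<lambda>x. f (h x))" using cont Ck_continuous_on[OF Suc.prems U] .
      show "Ck k m W (\<lambda>x. \<Sum>j<n. partial_deriv j f (h x) * partial_deriv i (\<lambda>x. h x j) x)" if "i < m" for i
        using Suc that hC[of _ "Suc k"] by (intro Ck_sum Ck_mult W) auto
      show "((\<lambda>t. f (h (x(i := t)))) has_real_derivative
           (\<Sum>j<n. partial_deriv j f (h x) * partial_deriv i (\<lambda>x. h x j) x)) (at (x i))"
        if i: "i < m" and x: "x \<in> W" for i x
      proof -
        have "\<forall>\<^sub>F t in nhds (x i). h (x(i := t)) \<in> U"
          using eventually_update_in_open[OF W x i] by eventually_elim (use h in \<open>auto simp: smooth_map_def\<close>)
        moreover have "((\<lambda>t. h (x(i := t)) j) has_real_derivative partial_deriv i (\<lambda>x. h x j) x) (at (x i))"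
          if "j < n" for j
          by (rule Ck_Suc_has_partial[OF hC[OF that] x i])
        moreover have "h (x(i := x i)) \<in> U" using h x by (simp add: smooth_map_def image_subset_iff)
        ultimately have "((\<lambda>t. f (h (x(i := t)))) has_real_derivative
            (\<Sum>j<n. partial_deriv j f (h (x(i := x i))) * partial_deriv i (\<lambda>x. h x j) x)) (at (x i))"
          by (intro has_real_derivative_compose_partials[OF U f1])
        then show ?thesis by simp
      qed
    qed
  }
qed

section \<open>Smooth functions and maps\<close>

lemma smooth_fun_const: "openin (Euclidean_space n) U \<Longrightarrow> smooth_fun n U (\<lambda>_. c)"
  by (simp add: smooth_fun_def Ck_const)

lemma smooth_fun_add:
  "openin (Euclidean_space n) U \<Longrightarrow> smooth_fun n U f \<Longrightarrow> smooth_fun n U g \<Longrightarrow> smooth_fun n U (\<lambda>x. f x + g x)"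
  by (simp add: smooth_fun_def Ck_add)

lemma smooth_fun_mult:
  "openin (Euclidean_space n) U \<Longrightarrow> smooth_fun n U f \<Longrightarrow> smooth_fun n U g \<Longrightarrow> smooth_fun n U (\<lambda>x. f x * g x)"
  by (simp add: smooth_fun_def Ck_mult)

lemma smooth_fun_inverse:
  "openin (Euclidean_space n) U \<Longrightarrow> smooth_fun n U f \<Longrightarrow> (\<And>x. x \<in> U \<Longrightarrow> f x \<noteq> 0)
    \<Longrightarrow> smooth_fun n U (\<lambda>x. inverse (f x))"
  by (simp add: smooth_fun_def Ck_inverse)

lemma smooth_fun_cong:
  assumes "openin (Euclidean_space n) U" "\<And>x. x \<in> U \<Longrightarrow> f x = g x" "smooth_fun n U f"
  shows "smooth_fun n U g"
  using assms(3) Ck_cong[of n U f g, OF assms(1,2)] unfolding smooth_fun_def by simp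

lemma smooth_fun_local:
  assumes "openin (Euclidean_space n) U"
    and "\<And>u. u \<in> U \<Longrightarrow> \<exists>W. u \<in> W \<and> W \<subseteq> U \<and> openin (Euclidean_space n) W \<and> smooth_fun n W f"
  shows "smooth_fun n U f"
  unfolding smooth_fun_def
proof
  fix k
  show "Ck k n U f"
  proof (rule Ck_local[OF assms(1)])
    fix u assume "u \<in> U"
    from assms(2)[OF this] obtain W
      where "u \<in> W" "W \<subseteq> U" "openin (Euclidean_space n) W" "\<forall>k. Ck k n W f"
      unfolding smooth_fun_def by (elim exE conjE) rule
    then show "\<exists>W. u \<in> W \<and> W \<subseteq> U \<and> openin (Euclidean_space n) W \<and> Ck k n W f"
      by (intro exI[of _ W]) simp
  qed
qed

lemma smooth_fun_compose:
  assumes "openin (Euclidean_space m) W" "openin (Euclidean_space n) U"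
    "smooth_map m W n U h" "smooth_fun n U f"
  shows "smooth_fun m W (\<lambda>x. f (h x))"
  unfolding smooth_fun_def
proof
  show "Ck k m W (\<lambda>x. f (h x))" for k
    by (rule Ck_compose[where f = f, OF assms(1-3)]) (use assms(4) in \<open>simp add: smooth_fun_def\<close>)
qed

lemma smooth_map_compose:
  assumes "openin (Euclidean_space l) T" "openin (Euclidean_space m) W" "openin (Euclidean_space n) U"
    "smooth_map l T m W h" "smooth_map m W n U f"
  shows "smooth_map l T n U (f \<circ> h)"
  unfolding smooth_map_def
proof (intro conjI allI impI)
  show "(f \<circ> h) ` T \<subseteq> U" using assms(4,5) by (auto simp: smooth_map_def)
  show "smooth_fun l T (\<lambda>x. (f \<circ> h) x j)" if "j < n" for j
    using smooth_fun_compose[where f = "\<lambda>x. f x j", OF assms(1,2,4)] assms(5) that by (simp add: smooth_map_def)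
qed

lemma smooth_map_inclusion:
  assumes "openin (Euclidean_space n) W" "W \<subseteq> U"
  shows "smooth_map n W n U (\<lambda>x. x)"
  using assms by (auto simp: smooth_map_def smooth_fun_def Ck_coordinate)

lemma smooth_map_preimage_open:
  assumes "openin (Euclidean_space m) W" "openin (Euclidean_space n) U" "smooth_map m W n U h"
    and "openin (Euclidean_space n) U'"
  shows "openin (Euclidean_space m) {w \<in> W. h w \<in> U'}"
proof -
  obtain T where T: "open T" "U' = T \<inter> {x. \<forall>i\<ge>n. x i = 0}" using openin_Euclidean_space_eq[OF assms(4)] .
  obtain S where S: "open S" "W = S \<inter> {x. \<forall>i\<ge>m. x i = 0}" using openin_Euclidean_space_eq[OF assms(1)] .
  have "h w j = 0" if "w \<in> W" "n \<le> j" for w j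
    using assms(3) that openin_Euclidean_space_vanishing[OF assms(2)] by (auto simp: smooth_map_def)
  then have eq: "{w \<in> W. h w \<in> U'} = W \<inter> h -` T" using T(2) by auto
  have "openin (top_of_set W) (W \<inter> h -` T)"
    using smooth_map_continuous_on[OF assms(1-3)] T(1) by (rule continuous_openin_preimage_gen)
  then obtain R where "open R" "W \<inter> h -` T = W \<inter> R" by (auto simp: openin_open)
  then have "{w \<in> W. h w \<in> U'} = (S \<inter> R) \<inter> {x. \<forall>i\<ge>m. x i = 0}" "open (S \<inter> R)"
    using eq S by auto
  then show ?thesis
    unfolding Euclidean_space_def euclidean_product_topology openin_subtopology
    by (intro exI[of _ "S \<inter> R"] conjI) simp_all
qed

section \<open>Plots\<close>

lemma diffeological_spaceD:
  assumes "diffeological_space D"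
  shows "\<And>n U p. plot D n U p \<Longrightarrow> openin (Euclidean_space n) U \<and> p ` U \<subseteq> points D"
    and "\<And>n U c. openin (Euclidean_space n) U \<Longrightarrow> c \<in> points D \<Longrightarrow> plot D n U (\<lambda>_. c)"
    and "\<And>n U p m W f. plot D n U p \<Longrightarrow> openin (Euclidean_space m) W \<Longrightarrow> smooth_map m W n U f \<Longrightarrow> plot D m W (p \<circ> f)"
    and "\<And>n U p. openin (Euclidean_space n) U \<Longrightarrow>
      \<forall>u\<in>U. \<exists>W q. u \<in> W \<and> W \<subseteq> U \<and> plot D n W q \<and> (\<forall>w\<in>W. p w = q w) \<Longrightarrow> plot D n U p"
proof -
  note D = assms[unfolded diffeological_space_def]
  show "plot D n U p \<Longrightarrow> openin (Euclidean_space n) U \<and> p ` U \<subseteq> points D" for n U p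
    using D[THEN conjunct1] by blast
  show "openin (Euclidean_space n) U \<Longrightarrow> c \<in> points D \<Longrightarrow> plot D n U (\<lambda>_. c)" for n U c
    using D[THEN conjunct2, THEN conjunct1, rule_format, OF conjI] .
  show "plot D n U p \<Longrightarrow> openin (Euclidean_space m) W \<Longrightarrow> smooth_map m W n U f \<Longrightarrow> plot D m W (p \<circ> f)"
    for n U p m W f
    using D[THEN conjunct2, THEN conjunct2, THEN conjunct1] by blast
  show "openin (Euclidean_space n) U \<Longrightarrow>
      \<forall>u\<in>U. \<exists>W q. u \<in> W \<and> W \<subseteq> U \<and> plot D n W q \<and> (\<forall>w\<in>W. p w = q w) \<Longrightarrow> plot D n U p" for n U p
    using D[THEN conjunct2, THEN conjunct2, THEN conjunct2, THEN spec, THEN spec, THEN spec, THEN mp, OF conjI] .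
qed

lemma plot_open:
  assumes "diffeological_space D" "plot D n U p"
  shows "openin (Euclidean_space n) U"
  using diffeological_spaceD(1)[OF assms] by (rule conjunct1)

lemma plot_points:
  assumes "diffeological_space D" "plot D n U p" "u \<in> U"
  shows "p u \<in> points D"
  using diffeological_spaceD(1)[OF assms(1,2)] assms(3) by blast

lemmas plot_const = diffeological_spaceD(2)

lemma plot_compose:
  assumes "diffeological_space D" "plot D n U p" "openin (Euclidean_space m) W" "smooth_map m W n U f"
  shows "plot D m W (\<lambda>w. p (f w))"
  using diffeological_spaceD(3)[OF assms] by (simp only: comp_def)

lemma plot_local:
  assumes "diffeological_space D" "openin (Euclidean_space n) U"
    and "\<And>u. u \<in> U \<Longrightarrow> \<exists>W q. u \<in> W \<and> W \<subseteq> U \<and> plot D n W q \<and> (\<forall>w\<in>W. p w = q w)"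
  shows "plot D n U p"
  by (rule diffeological_spaceD(4)[OF assms(1,2)]) (rule ballI, rule assms(3))

lemma plot_cong:
  assumes "diffeological_space D" "plot D n U q" "\<And>u. u \<in> U \<Longrightarrow> p u = q u"
  shows "plot D n U p"
proof (rule plot_local[OF assms(1) plot_open[OF assms(1,2)]])
  fix u assume "u \<in> U"
  then show "\<exists>W q. u \<in> W \<and> W \<subseteq> U \<and> plot D n W q \<and> (\<forall>w\<in>W. p w = q w)"
    using assms(2,3) by (intro exI[of _ U] exI[of _ q]) simp
qed

lemma plot_subset:
  assumes "diffeological_space D" "plot D n U p" "openin (Euclidean_space n) W" "W \<subseteq> U"
  shows "plot D n W p"
  using plot_compose[OF assms(1-3) smooth_map_inclusion[OF assms(3,4)]] .

lemma diffeological_space_prodD: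
  assumes D: "diffeological_space D" and E: "diffeological_space E"
  shows "diffeological_space (prodD D E)"
  unfolding diffeological_space_def
proof (intro conjI allI impI; (elim conjE)?)
  fix n U p assume p: "plot (prodD D E) n U p"
  then show "openin (Euclidean_space n) U" using plot_open[OF D, of n U "fst \<circ> p"] by (simp add: prodD_def)
  show "p ` U \<subseteq> points (prodD D E)"
    using p plot_points[OF D, of n U "fst \<circ> p"] plot_points[OF E, of n U "snd \<circ> p"]
    by (simp add: prodD_def mem_Times_iff image_subset_iff)
next
  fix n U and c :: "'a \<times> 'b" assume "openin (Euclidean_space n) U" "c \<in> points (prodD D E)"
  then show "plot (prodD D E) n U (\<lambda>_. c)"
    using plot_const[OF D] plot_const[OF E] by (auto simp: prodD_def comp_def)
next
  fix n U p m W f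
  assume "plot (prodD D E) n U p" "openin (Euclidean_space m) W" "smooth_map m W n U f"
  then show "plot (prodD D E) m W (p \<circ> f)"
    using plot_compose[OF D, of n U "fst \<circ> p" m W f] plot_compose[OF E, of n U "snd \<circ> p" m W f]
    by (simp add: prodD_def comp_def)
next
  fix n U and p :: "(nat \<Rightarrow> real) \<Rightarrow> 'a \<times> 'b"
  assume U: "openin (Euclidean_space n) U"
    and loc: "\<forall>u\<in>U. \<exists>W q. u \<in> W \<and> W \<subseteq> U \<and> plot (prodD D E) n W q \<and> (\<forall>w\<in>W. p w = q w)"
  have "plot D n U (fst \<circ> p)"
  proof (rule plot_local[OF D U])
    fix u assume "u \<in> U"
    then obtain W q where "u \<in> W" "W \<subseteq> U" "plot (prodD D E) n W q" "\<forall>w\<in>W. p w = q w" using loc by blast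
    then show "\<exists>W q. u \<in> W \<and> W \<subseteq> U \<and> plot D n W q \<and> (\<forall>w\<in>W. (fst \<circ> p) w = q w)"
      by (intro exI[of _ W] exI[of _ "fst \<circ> q"]) (simp add: prodD_def)
  qed
  moreover have "plot E n U (snd \<circ> p)"
  proof (rule plot_local[OF E U])
    fix u assume "u \<in> U"
    then obtain W q where "u \<in> W" "W \<subseteq> U" "plot (prodD D E) n W q" "\<forall>w\<in>W. p w = q w" using loc by blast
    then show "\<exists>W q. u \<in> W \<and> W \<subseteq> U \<and> plot E n W q \<and> (\<forall>w\<in>W. (snd \<circ> p) w = q w)"
      by (intro exI[of _ W] exI[of _ "snd \<circ> q"]) (simp add: prodD_def)
  qed
  ultimately show "plot (prodD D E) n U p" by (simp add: prodD_def)
qed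

lemma diffeological_space_subD:
  assumes D: "diffeological_space D"
  shows "diffeological_space (subD D A)"
  unfolding diffeological_space_def
proof (intro conjI allI impI; (elim conjE)?)
  fix n U p assume p: "plot (subD D A) n U p"
  then show "openin (Euclidean_space n) U" using plot_open[OF D, of n U p] by (simp add: subD_def)
  show "p ` U \<subseteq> points (subD D A)"
    using p plot_points[OF D, of n U p] by (auto simp: subD_def)
next
  fix n U c assume "openin (Euclidean_space n) U" "c \<in> points (subD D A)"
  then show "plot (subD D A) n U (\<lambda>_. c)"
    using plot_const[OF D] by (auto simp: subD_def)
next
  fix n U p m W f
  assume "plot (subD D A) n U p" "openin (Euclidean_space m) W" "smooth_map m W n U f"
  then show "plot (subD D A) m W (p \<circ> f)"
    using plot_compose[OF D, of n U p m W f]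
    by (auto simp: subD_def comp_def smooth_map_def)
next
  fix n U p
  assume U: "openin (Euclidean_space n) U"
    and loc: "\<forall>u\<in>U. \<exists>W q. u \<in> W \<and> W \<subseteq> U \<and> plot (subD D A) n W q \<and> (\<forall>w\<in>W. p w = q w)"
  have "plot D n U p"
  proof (rule plot_local[OF D U])
    fix u assume "u \<in> U"
    then obtain W q where "u \<in> W" "W \<subseteq> U" "plot (subD D A) n W q" "\<forall>w\<in>W. p w = q w" using loc by blast
    then show "\<exists>W q. u \<in> W \<and> W \<subseteq> U \<and> plot D n W q \<and> (\<forall>w\<in>W. p w = q w)"
      by (intro exI[of _ W] exI[of _ q]) (simp add: subD_def)
  qed
  moreover have "p u \<in> A" if u: "u \<in> U" for u
  proof -
    obtain W q where "u \<in> W" "plot (subD D A) n W q" "\<forall>w\<in>W. p w = q w" using loc u by blast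
    then show ?thesis by (auto simp: subD_def)
  qed
  ultimately show "plot (subD D A) n U p" by (auto simp: subD_def)
qed

lemma vector_pseudo_bundle_plots:
  assumes "vector_pseudo_bundle V"
  shows "diffeological_space (total_space V)" "diffeological_space (base_space V)"
    and "plot (total_space V) n U a \<Longrightarrow> plot (base_space V) n U (\<lambda>u. bproj V (a u))"
    and "plot (total_space V) n U a \<Longrightarrow> plot (total_space V) n U b \<Longrightarrow>
      (\<And>u. u \<in> U \<Longrightarrow> bproj V (a u) = bproj V (b u)) \<Longrightarrow> plot (total_space V) n U (\<lambda>u. fadd V (a u) (b u))"
    and "smooth_fun n U c \<Longrightarrow> plot (total_space V) n U a \<Longrightarrow> plot (total_space V) n U (\<lambda>u. fscale V (c u) (a u))"
    and "plot (base_space V) n U p \<Longrightarrow> plot (total_space V) n U (\<lambda>u. fzero V (p u))"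
proof -
  note V = assms[unfolded vector_pseudo_bundle_def]
  show T: "diffeological_space (total_space V)" and "diffeological_space (base_space V)" using V by blast+
  show "plot (base_space V) n U (\<lambda>u. bproj V (a u))" if "plot (total_space V) n U a"
    using V that unfolding dsmooth_def by (simp add: comp_def)
  show "plot (total_space V) n U (\<lambda>u. fadd V (a u) (b u))"
    if "plot (total_space V) n U a" "plot (total_space V) n U b" "\<And>u. u \<in> U \<Longrightarrow> bproj V (a u) = bproj V (b u)"
  proof -
    have "plot (subD (prodD (total_space V) (total_space V)) {(v, w). bproj V v = bproj V w}) n U (\<lambda>u. (a u, b u))"
      using that by (auto simp: subD_def prodD_def comp_def)
    moreover have "dsmooth (subD (prodD (total_space V) (total_space V)) {(v, w). bproj V v = bproj V w})
       (total_space V) (\<lambda>(v, w). fadd V v w)" using V by blast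
    ultimately have "plot (total_space V) n U ((\<lambda>(v, w). fadd V v w) \<circ> (\<lambda>u. (a u, b u)))"
      unfolding dsmooth_def by blast
    then show ?thesis by (simp add: comp_def)
  qed
  show "plot (total_space V) n U (\<lambda>u. fscale V (c u) (a u))"
    if "smooth_fun n U c" "plot (total_space V) n U a"
  proof -
    have "plot (prodD realD (total_space V)) n U (\<lambda>u. (c u, a u))"
      using that plot_open[OF T] by (auto simp: prodD_def comp_def realD_def)
    moreover have "dsmooth (prodD realD (total_space V)) (total_space V) (\<lambda>(r, v). fscale V r v)" using V by blast
    ultimately have "plot (total_space V) n U ((\<lambda>(r, v). fscale V r v) \<circ> (\<lambda>u. (c u, a u)))"
      unfolding dsmooth_def by blast
    then show ?thesis by (simp add: comp_def)
  qed
  show "plot (total_space V) n U (\<lambda>u. fzero V (p u))" if "plot (base_space V) n U p"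
    using V that unfolding dsmooth_def by (simp add: comp_def)
qed

section \<open>Pseudo-bundles of functions tested by evaluation\<close>

text \<open>
  The common pattern behind the dual pseudo-bundle and bilinear forms: \<open>S x\<close> is a space of
  functions to be evaluated on those test objects \<open>t\<close> with \<open>\<pi> t = x\<close>.  The test along all
  smooth \<open>f\<close> and all test plots over \<open>fst \<circ> p \<circ> f\<close> expresses smoothness on the fibre product of
  \<open>U\<close> and \<open>T\<close>, and makes closure under precomposition immediate.
\<close>

definition evaluation_plot ::
  "'x diffspace \<Rightarrow> 't diffspace \<Rightarrow> ('t \<Rightarrow> 'x) \<Rightarrow> ('x \<Rightarrow> 'f set) \<Rightarrow> ('f \<Rightarrow> 't \<Rightarrow> real) \<Rightarrow> ('x \<times> 'f) plots" where
  "evaluation_plot X T \<pi> S ev n U p \<longleftrightarrow>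
     openin (Euclidean_space n) U \<and> (\<forall>u\<in>U. snd (p u) \<in> S (fst (p u))) \<and> plot X n U (fst \<circ> p) \<and>
     (\<forall>m W f a. openin (Euclidean_space m) W \<longrightarrow> smooth_map m W n U f \<longrightarrow> plot T m W a \<longrightarrow>
        (\<forall>w\<in>W. \<pi> (a w) = fst (p (f w))) \<longrightarrow> smooth_fun m W (\<lambda>w. ev (snd (p (f w))) (a w)))"

lemma evaluation_plotI:
  assumes "openin (Euclidean_space n) U" "\<And>u. u \<in> U \<Longrightarrow> snd (p u) \<in> S (fst (p u))"
    and "plot X n U (\<lambda>u. fst (p u))"
    and "\<And>m W f a. openin (Euclidean_space m) W \<Longrightarrow> smooth_map m W n U f \<Longrightarrow> plot T m W a \<Longrightarrow>
        (\<And>w. w \<in> W \<Longrightarrow> \<pi> (a w) = fst (p (f w))) \<Longrightarrow> smooth_fun m W (\<lambda>w. ev (snd (p (f w))) (a w))"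
  shows "evaluation_plot X T \<pi> S ev n U p"
  unfolding evaluation_plot_def using assms by (auto simp: comp_def)

lemma evaluation_plotD:
  assumes "evaluation_plot X T \<pi> S ev n U p"
  shows "openin (Euclidean_space n) U" "\<And>u. u \<in> U \<Longrightarrow> snd (p u) \<in> S (fst (p u))"
    and "plot X n U (\<lambda>u. fst (p u))"
    and "\<And>m W f a. openin (Euclidean_space m) W \<Longrightarrow> smooth_map m W n U f \<Longrightarrow> plot T m W a \<Longrightarrow>
        (\<And>w. w \<in> W \<Longrightarrow> \<pi> (a w) = fst (p (f w))) \<Longrightarrow> smooth_fun m W (\<lambda>w. ev (snd (p (f w))) (a w))"
  using assms unfolding evaluation_plot_def comp_def by (blast, blast, blast, simp)

text \<open>
  Since a function is determined by its evaluations (\<open>separated\<close>), the vector space laws of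
  the fibres follow from those of the real numbers.
\<close>

locale evaluation_bundle =
  fixes X :: "'x diffspace" and T :: "'t diffspace" and \<pi> :: "'t \<Rightarrow> 'x"
    and S :: "'x \<Rightarrow> 'f set" and ev :: "'f \<Rightarrow> 't \<Rightarrow> real"
    and pl :: "'f \<Rightarrow> 'f \<Rightarrow> 'f" and sm :: "real \<Rightarrow> 'f \<Rightarrow> 'f" and z :: 'f
  assumes X: "diffeological_space X" and T: "diffeological_space T"
    and separated: "\<And>\<phi> \<psi>. (\<And>t. ev \<phi> t = ev \<psi> t) \<Longrightarrow> \<phi> = \<psi>"
    and ev: "\<And>\<phi> \<psi> t. ev (pl \<phi> \<psi>) t = ev \<phi> t + ev \<psi> t" "\<And>r \<phi> t. ev (sm r \<phi>) t = r * ev \<phi> t"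
      "\<And>t. ev z t = 0"
    and S: "\<And>x \<phi> \<psi>. x \<in> points X \<Longrightarrow> \<phi> \<in> S x \<Longrightarrow> \<psi> \<in> S x \<Longrightarrow> pl \<phi> \<psi> \<in> S x"
      "\<And>x \<phi> r. x \<in> points X \<Longrightarrow> \<phi> \<in> S x \<Longrightarrow> sm r \<phi> \<in> S x" "\<And>x. x \<in> points X \<Longrightarrow> z \<in> S x"
    and S_smooth: "\<And>x \<phi> m W a. x \<in> points X \<Longrightarrow> \<phi> \<in> S x \<Longrightarrow> plot T m W a \<Longrightarrow>
      (\<And>w. w \<in> W \<Longrightarrow> \<pi> (a w) = x) \<Longrightarrow> smooth_fun m W (\<lambda>w. ev \<phi> (a w))"
begin

abbreviation eplot :: "('x \<times> 'f) plots" where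
  "eplot \<equiv> evaluation_plot X T \<pi> S ev"

definition etotal :: "('x \<times> 'f) diffspace" where
  "etotal = \<lparr>points = (SIGMA x:points X. S x), plot = eplot\<rparr>"

definition ebundle :: "('x \<times> 'f, 'x) pbundle" where
  "ebundle = \<lparr>total_space = etotal, base_space = X, bproj = fst,
     fadd = (\<lambda>(x, \<phi>) (y, \<psi>). (x, pl \<phi> \<psi>)), fscale = (\<lambda>r (x, \<phi>). (x, sm r \<phi>)), fzero = (\<lambda>x. (x, z))\<rparr>"

text \<open>
  The sheaf condition is the only laborious part: near each point the evaluation along \<open>f\<close> and
  \<open>a\<close> agrees with one for a given local plot, after \<open>f\<close> and \<open>a\<close> are restricted to
  the open preimage of the domain of that plot, and smoothness is local.
\<close>

lemma diffeological_space_etotal: "diffeological_space etotal"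
  unfolding diffeological_space_def
proof (intro conjI allI impI; (elim conjE)?)
  fix n U p assume "plot etotal n U p"
  then have p: "eplot n U p" by (simp add: etotal_def)
  show "openin (Euclidean_space n) U" by (rule evaluation_plotD(1)[OF p])
  have "p u \<in> points etotal" if u: "u \<in> U" for u
  proof -
    have "fst (p u) \<in> points X" by (rule plot_points[OF X evaluation_plotD(3)[OF p] u])
    then show ?thesis using evaluation_plotD(2)[OF p u] by (cases "p u") (simp add: etotal_def)
  qed
  then show "p ` U \<subseteq> points etotal" by blast
next
  fix n U c assume U: "openin (Euclidean_space n) U" and "c \<in> points etotal"
  then have c: "fst c \<in> points X" "snd c \<in> S (fst c)" by (auto simp: etotal_def)
  have "eplot n U (\<lambda>_. c)"
    by (rule evaluation_plotI) (use U c plot_const[OF X U c(1)] S_smooth[OF c] in auto)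
  then show "plot etotal n U (\<lambda>_. c)" by (simp add: etotal_def)
next
  fix n U p m W f
  assume "plot etotal n U p" and W: "openin (Euclidean_space m) W" and f: "smooth_map m W n U f"
  then have p: "eplot n U p" by (simp add: etotal_def)
  note U = evaluation_plotD(1)[OF p]
  have "eplot m W (p \<circ> f)"
  proof (rule evaluation_plotI[OF W])
    show "snd ((p \<circ> f) w) \<in> S (fst ((p \<circ> f) w))" if "w \<in> W" for w
      using evaluation_plotD(2)[OF p, of "f w"] f that by (auto simp: smooth_map_def)
    show "plot X m W (\<lambda>w. fst ((p \<circ> f) w))"
      using plot_compose[OF X evaluation_plotD(3)[OF p] W f] by simp
    fix l W' h a
    assume W': "openin (Euclidean_space l) W'" and h: "smooth_map l W' m W h" and a: "plot T l W' a"
      and \<pi>a: "\<And>w. w \<in> W' \<Longrightarrow> \<pi> (a w) = fst ((p \<circ> f) (h w))"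
    show "smooth_fun l W' (\<lambda>w. ev (snd ((p \<circ> f) (h w))) (a w))"
      using evaluation_plotD(4)[OF p W' smooth_map_compose[OF W' W U h f] a] \<pi>a by simp
  qed
  then show "plot etotal m W (p \<circ> f)" by (simp add: etotal_def)
next
  fix n U and p :: "(nat \<Rightarrow> real) \<Rightarrow> 'x \<times> 'f"
  assume U: "openin (Euclidean_space n) U"
    and loc: "\<forall>u\<in>U. \<exists>W q. u \<in> W \<and> W \<subseteq> U \<and> plot etotal n W q \<and> (\<forall>w\<in>W. p w = q w)"
  have locE: "\<exists>W q. u \<in> W \<and> W \<subseteq> U \<and> eplot n W q \<and> (\<forall>w\<in>W. p w = q w)" if "u \<in> U" for u
    using loc that by (simp add: etotal_def)
  have "eplot n U p"
  proof (rule evaluation_plotI[OF U])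
    show "snd (p u) \<in> S (fst (p u))" if u: "u \<in> U" for u
    proof -
      obtain W q where "u \<in> W" "eplot n W q" "p u = q u" using locE[OF u] by auto
      then show ?thesis using evaluation_plotD(2) by metis
    qed
    show "plot X n U (\<lambda>u. fst (p u))"
    proof (rule plot_local[OF X U])
      fix u assume "u \<in> U"
      from locE[OF this] obtain W q where "u \<in> W" "W \<subseteq> U" "eplot n W q" "\<forall>w\<in>W. p w = q w" by blast
      then show "\<exists>W q. u \<in> W \<and> W \<subseteq> U \<and> plot X n W q \<and> (\<forall>w\<in>W. fst (p w) = q w)"
        using evaluation_plotD(3) by (intro exI[of _ W] exI[of _ "\<lambda>w. fst (q w)"]) simp
    qed
    fix m W f a
    assume W: "openin (Euclidean_space m) W" and f: "smooth_map m W n U f" and a: "plot T m W a"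
      and \<pi>a: "\<And>w. w \<in> W \<Longrightarrow> \<pi> (a w) = fst (p (f w))"
    show "smooth_fun m W (\<lambda>w. ev (snd (p (f w))) (a w))"
    proof (rule smooth_fun_local[OF W])
      fix w assume w: "w \<in> W"
      then have "f w \<in> U" using f by (auto simp: smooth_map_def)
      from locE[OF this] obtain U' q where U': "f w \<in> U'" "U' \<subseteq> U" "eplot n U' q" "\<forall>w\<in>U'. p w = q w" by blast
      define W' where "W' = {w \<in> W. f w \<in> U'}"
      have W': "openin (Euclidean_space m) W'"
        unfolding W'_def by (rule smooth_map_preimage_open[OF W U f evaluation_plotD(1)[OF U'(3)]])
      have sub: "W' \<subseteq> W" by (auto simp: W'_def)
      have f': "smooth_map m W' n U' f"
        unfolding smooth_map_def
      proof (intro conjI allI impI)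
        show "f ` W' \<subseteq> U'" by (auto simp: W'_def)
        show "smooth_fun m W' (\<lambda>x. f x j)" if "j < n" for j
          using f that Ck_subset[OF W W' sub] by (simp add: smooth_map_def smooth_fun_def)
      qed
      have "smooth_fun m W' (\<lambda>w. ev (snd (q (f w))) (a w))"
        by (rule evaluation_plotD(4)[OF U'(3) W' f' plot_subset[OF T a W' sub]])
          (use \<pi>a U'(4) in \<open>simp add: W'_def\<close>)
      then have "smooth_fun m W' (\<lambda>w. ev (snd (p (f w))) (a w))"
        by (rule smooth_fun_cong[OF W', rotated]) (use U'(4) in \<open>simp add: W'_def\<close>)
      moreover have "w \<in> W'" using w U'(1) by (simp add: W'_def)
      ultimately show "\<exists>W'. w \<in> W' \<and> W' \<subseteq> W \<and> openin (Euclidean_space m) W' \<and>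
          smooth_fun m W' (\<lambda>w. ev (snd (p (f w))) (a w))"
        using W' sub by blast
    qed
  qed
  then show "plot etotal n U p" by (simp add: etotal_def)
qed

lemma eplot_add:
  assumes p: "eplot n U p" and q: "eplot n U q" and eq: "\<And>u. u \<in> U \<Longrightarrow> fst (p u) = fst (q u)"
  shows "eplot n U (\<lambda>u. (fst (p u), pl (snd (p u)) (snd (q u))))"
proof (rule evaluation_plotI[OF evaluation_plotD(1)[OF p]]; (simp only: fst_conv snd_conv)?)
  show "pl (snd (p u)) (snd (q u)) \<in> S (fst (p u))" if u: "u \<in> U" for u
    using evaluation_plotD(2)[OF p u] evaluation_plotD(2)[OF q u] eq[OF u]
      plot_points[OF X evaluation_plotD(3)[OF p] u] S(1) by simp
  show "plot X n U (\<lambda>u. fst (p u))" by (rule evaluation_plotD(3)[OF p])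
  fix m W f a
  assume W: "openin (Euclidean_space m) W" and f: "smooth_map m W n U f" and a: "plot T m W a"
    and \<pi>a: "\<And>w. w \<in> W \<Longrightarrow> \<pi> (a w) = fst (p (f w))"
  have "smooth_fun m W (\<lambda>w. ev (snd (p (f w))) (a w))"
    by (rule evaluation_plotD(4)[OF p W f a \<pi>a])
  moreover have "fst (p (f w)) = fst (q (f w))" if "w \<in> W" for w
    using f that by (intro eq) (auto simp: smooth_map_def)
  then have "smooth_fun m W (\<lambda>w. ev (snd (q (f w))) (a w))"
    using \<pi>a by (intro evaluation_plotD(4)[OF q W f a]) simp
  ultimately show "smooth_fun m W (\<lambda>w. ev (pl (snd (p (f w))) (snd (q (f w)))) (a w))"
    unfolding ev by (rule smooth_fun_add[OF W])
qed

lemma eplot_scale: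
  assumes c: "smooth_fun n U c" and p: "eplot n U p"
  shows "eplot n U (\<lambda>u. (fst (p u), sm (c u) (snd (p u))))"
proof (rule evaluation_plotI[OF evaluation_plotD(1)[OF p]]; (simp only: fst_conv snd_conv)?)
  show "sm (c u) (snd (p u)) \<in> S (fst (p u))" if u: "u \<in> U" for u
    using evaluation_plotD(2)[OF p u] plot_points[OF X evaluation_plotD(3)[OF p] u] S(2) by simp
  show "plot X n U (\<lambda>u. fst (p u))" by (rule evaluation_plotD(3)[OF p])
  fix m W f a
  assume W: "openin (Euclidean_space m) W" and f: "smooth_map m W n U f" and a: "plot T m W a"
    and \<pi>a: "\<And>w. w \<in> W \<Longrightarrow> \<pi> (a w) = fst (p (f w))"
  have "smooth_fun m W (\<lambda>w. ev (snd (p (f w))) (a w))"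
    by (rule evaluation_plotD(4)[OF p W f a \<pi>a])
  then show "smooth_fun m W (\<lambda>w. ev (sm (c (f w)) (snd (p (f w)))) (a w))"
    unfolding ev
    by (rule smooth_fun_mult[OF W smooth_fun_compose[where f = c, OF W evaluation_plotD(1)[OF p] f c]])
qed

lemma eplot_zero:
  assumes p: "plot X n U p"
  shows "eplot n U (\<lambda>u. (p u, z))"
proof (rule evaluation_plotI[OF plot_open[OF X p]]; (simp only: fst_conv snd_conv)?)
  show "z \<in> S (p u)" if u: "u \<in> U" for u using plot_points[OF X p u] S(3) by simp
  show "plot X n U p" by fact
  fix m W f a
  assume W: "openin (Euclidean_space m) W"
  show "smooth_fun m W (\<lambda>w. ev z (a w))" unfolding ev by (rule smooth_fun_const[OF W])
qed

lemma total_space_ebundle: "total_space ebundle = etotal"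
  by (simp add: ebundle_def etotal_def)

lemma fibre_ebundle: "x \<in> points X \<Longrightarrow> fibre ebundle x = Pair x ` S x"
  by (auto simp: fibre_def ebundle_def etotal_def)

lemma real_vector_space_on_fibre:
  assumes x: "x \<in> points X"
  shows "real_vector_space_on (fibre ebundle x) (fadd ebundle) (fscale ebundle) (fzero ebundle x)"
proof -
  have alg: "pl (pl \<phi> \<psi>) \<theta> = pl \<phi> (pl \<psi> \<theta>)" "pl \<phi> \<psi> = pl \<psi> \<phi>" "pl z \<phi> = \<phi>" "pl \<phi> (sm (- 1) \<phi>) = z"
    "sm r (pl \<phi> \<psi>) = pl (sm r \<phi>) (sm r \<psi>)" "sm (r + s) \<phi> = pl (sm r \<phi>) (sm s \<phi>)"
    "sm (r * s) \<phi> = sm r (sm s \<phi>)" "sm 1 \<phi> = \<phi>" for \<phi> \<psi> \<theta> r s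
    by (rule separated, simp add: ev algebra_simps)+
  have ops: "fadd ebundle (x, \<phi>) (x, \<psi>) = (x, pl \<phi> \<psi>)" "fscale ebundle r (x, \<phi>) = (x, sm r \<phi>)"
    "fzero ebundle x = (x, z)" for \<phi> \<psi> r
    by (simp_all add: ebundle_def)
  have inv: "\<exists>\<psi>\<in>S x. pl \<phi> \<psi> = z" if "\<phi> \<in> S x" for \<phi>
    using S(2)[OF x that, of "- 1"] alg(4) by blast
  show ?thesis
    unfolding real_vector_space_on_def fibre_ebundle[OF x]
    by (simp add: ops ball_simps image_iff Bex_def S[OF x] alg(1,5-8) inv[unfolded Bex_def])
      (use alg(2,3) S[OF x] inv in blast)
qed

lemma vector_pseudo_bundle_ebundle: "vector_pseudo_bundle ebundle"
  unfolding vector_pseudo_bundle_def total_space_ebundle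
proof (intro conjI ballI)
  have sel: "base_space ebundle = X" "bproj ebundle = fst" "plot etotal = eplot"
    "points etotal = (SIGMA x:points X. S x)"
    "fadd ebundle = (\<lambda>(x, \<phi>) (y, \<psi>). (x, pl \<phi> \<psi>))" "fscale ebundle = (\<lambda>r (x, \<phi>). (x, sm r \<phi>))"
    "fzero ebundle = (\<lambda>x. (x, z))"
    by (simp_all add: ebundle_def etotal_def)
  show "diffeological_space etotal" by (rule diffeological_space_etotal)
  show "diffeological_space (base_space ebundle)" unfolding sel by (rule X)
  show "dsmooth etotal (base_space ebundle) (bproj ebundle)"
    unfolding dsmooth_def sel by (auto simp: comp_def dest: evaluation_plotD(3))
  show "bproj ebundle ` points etotal = points (base_space ebundle)"
    unfolding sel using S(3) by force
  show "real_vector_space_on (fibre ebundle x) (fadd ebundle) (fscale ebundle) (fzero ebundle x)"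
    if "x \<in> points (base_space ebundle)" for x
    using real_vector_space_on_fibre that by (simp add: sel)
  show "dsmooth (subD (prodD etotal etotal) {(v, w). bproj ebundle v = bproj ebundle w}) etotal (\<lambda>(v, w). fadd ebundle v w)"
    unfolding dsmooth_def
  proof (intro conjI allI impI)
    show "(\<lambda>(v, w). fadd ebundle v w) ` points (subD (prodD etotal etotal) {(v, w). bproj ebundle v = bproj ebundle w})
        \<subseteq> points etotal"
      using S(1) by (auto simp: sel subD_def prodD_def)
    fix n U r assume "plot (subD (prodD etotal etotal) {(v, w). bproj ebundle v = bproj ebundle w}) n U r"
    then have r: "eplot n U (fst \<circ> r)" "eplot n U (snd \<circ> r)" "\<And>u. u \<in> U \<Longrightarrow> fst (fst (r u)) = fst (snd (r u))"
      by (auto simp: sel subD_def prodD_def)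
    have "eplot n U (\<lambda>u. (fst (fst (r u)), pl (snd (fst (r u))) (snd (snd (r u)))))"
      using eplot_add[OF r(1,2)] r(3) by simp
    also have "(\<lambda>u. (fst (fst (r u)), pl (snd (fst (r u))) (snd (snd (r u))))) = (\<lambda>(v, w). fadd ebundle v w) \<circ> r"
      by (simp add: sel fun_eq_iff split_beta)
    finally show "plot etotal n U ((\<lambda>(v, w). fadd ebundle v w) \<circ> r)" by (simp only: sel(3))
  qed
  show "dsmooth (prodD realD etotal) etotal (\<lambda>(r, v). fscale ebundle r v)"
    unfolding dsmooth_def
  proof (intro conjI allI impI)
    show "(\<lambda>(r, v). fscale ebundle r v) ` points (prodD realD etotal) \<subseteq> points etotal"
      using S(2) by (auto simp: sel prodD_def)
    fix n U r assume "plot (prodD realD etotal) n U r"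
    then have r: "smooth_fun n U (fst \<circ> r)" "eplot n U (snd \<circ> r)"
      by (auto simp: sel prodD_def realD_def)
    have "eplot n U (\<lambda>u. (fst (snd (r u)), sm (fst (r u)) (snd (snd (r u)))))"
      using eplot_scale[OF r] by simp
    also have "(\<lambda>u. (fst (snd (r u)), sm (fst (r u)) (snd (snd (r u))))) = (\<lambda>(r, v). fscale ebundle r v) \<circ> r"
      by (simp add: sel fun_eq_iff split_beta)
    finally show "plot etotal n U ((\<lambda>(r, v). fscale ebundle r v) \<circ> r)" by (simp only: sel(3))
  qed
  show "dsmooth (base_space ebundle) etotal (fzero ebundle)"
    unfolding dsmooth_def sel using S(3) eplot_zero by (auto simp: comp_def)
qed

end

section \<open>The dual pseudo-bundle\<close>

text \<open>
  A plot of the fibre product of \<open>U\<close> and \<open>W\<close> is a pair of smooth maps; composing the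
  given plot of \<open>V\<close> with the second one gives an arbitrary test plot, and conversely a test
  \<open>(f, a)\<close> is recovered from the plot \<open>w \<mapsto> (f w, w)\<close>.
\<close>

lemma dual_plot_eq_evaluation_plot:
  assumes D: "diffeological_space (total_space V)"
  shows "dual_plot V = evaluation_plot (base_space V) (total_space V) (bproj V) (smooth_dual V) (\<lambda>\<phi>. \<phi>)"
proof (intro ext iffI)
  fix n U p assume p: "dual_plot V n U p"
  show "evaluation_plot (base_space V) (total_space V) (bproj V) (smooth_dual V) (\<lambda>\<phi>. \<phi>) n U p"
  proof (rule evaluation_plotI)
    show "openin (Euclidean_space n) U" using p by (simp add: dual_plot_def)
    show "snd (p u) \<in> smooth_dual V (fst (p u))" if "u \<in> U" for u using p that by (simp add: dual_plot_def)
    show "plot (base_space V) n U (\<lambda>u. fst (p u))" using p by (simp add: dual_plot_def comp_def)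
    fix m W f a
    assume W: "openin (Euclidean_space m) W" and f: "smooth_map m W n U f" and a: "plot (total_space V) m W a"
      and \<pi>a: "\<And>w. w \<in> W \<Longrightarrow> bproj V (a w) = fst (p (f w))"
    let ?S = "subD (prodD (euclD n U) (euclD m W)) {(u, w). fst (p u) = bproj V (a w)}"
    have "dsmooth ?S realD (\<lambda>(u, w). snd (p u) (a w))" using p a by (simp add: dual_plot_def)
    moreover have "plot ?S m W (\<lambda>w. (f w, w))"
      using W f \<pi>a smooth_map_inclusion[OF W subset_refl]
      by (simp add: subD_def prodD_def euclD_def comp_def image_subset_iff)
    ultimately have "plot realD m W ((\<lambda>(u, w). snd (p u) (a w)) \<circ> (\<lambda>w. (f w, w)))"
      unfolding dsmooth_def by blast
    then show "smooth_fun m W (\<lambda>w. snd (p (f w)) (a w))" by (simp add: realD_def comp_def)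
  qed
next
  fix n U p
  assume p: "evaluation_plot (base_space V) (total_space V) (bproj V) (smooth_dual V) (\<lambda>\<phi>. \<phi>) n U p"
  show "dual_plot V n U p"
    unfolding dual_plot_def
  proof (intro conjI allI impI ballI)
    show "openin (Euclidean_space n) U" by (rule evaluation_plotD(1)[OF p])
    show "snd (p u) \<in> smooth_dual V (fst (p u))" if "u \<in> U" for u by (rule evaluation_plotD(2)[OF p that])
    show "plot (base_space V) n U (fst \<circ> p)" using evaluation_plotD(3)[OF p] by (simp add: comp_def)
    fix m W a assume a: "plot (total_space V) m W a"
    show "dsmooth (subD (prodD (euclD n U) (euclD m W)) {(u, w). fst (p u) = bproj V (a w)}) realD
        (\<lambda>(u, w). snd (p u) (a w))"
      unfolding dsmooth_def
    proof (intro conjI allI impI)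
      fix l T r assume "plot (subD (prodD (euclD n U) (euclD m W)) {(u, w). fst (p u) = bproj V (a w)}) l T r"
      then have T: "openin (Euclidean_space l) T" and r: "smooth_map l T n U (\<lambda>t. fst (r t))"
        "smooth_map l T m W (\<lambda>t. snd (r t))" and eq: "\<And>t. t \<in> T \<Longrightarrow> bproj V (a (snd (r t))) = fst (p (fst (r t)))"
        by (auto simp: subD_def prodD_def euclD_def comp_def image_subset_iff split_beta)
      have "smooth_fun l T (\<lambda>t. snd (p (fst (r t))) (a (snd (r t))))"
        by (rule evaluation_plotD(4)[OF p T r(1) plot_compose[OF D a T r(2)] eq])
      then show "plot realD l T ((\<lambda>(u, w). snd (p u) (a w)) \<circ> r)"
        using T by (simp add: realD_def comp_def split_beta)
    qed (simp add: realD_def)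
  qed
qed

lemma smooth_dualD:
  assumes "\<phi> \<in> smooth_dual V x"
  shows "\<And>v w. v \<in> fibre V x \<Longrightarrow> w \<in> fibre V x \<Longrightarrow> \<phi> (fadd V v w) = \<phi> v + \<phi> w"
    and "\<And>r v. v \<in> fibre V x \<Longrightarrow> \<phi> (fscale V r v) = r * \<phi> v"
    and "\<And>v. v \<notin> fibre V x \<Longrightarrow> \<phi> v = 0"
    and "\<And>m W a. plot (total_space V) m W a \<Longrightarrow> (\<And>w. w \<in> W \<Longrightarrow> a w \<in> fibre V x) \<Longrightarrow> smooth_fun m W (\<lambda>w. \<phi> (a w))"
proof -
  show "smooth_fun m W (\<lambda>w. \<phi> (a w))"
    if "plot (total_space V) m W a" "\<And>w. w \<in> W \<Longrightarrow> a w \<in> fibre V x" for m W a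
  proof -
    have "plot (subD (total_space V) (fibre V x)) m W a" using that by (auto simp: subD_def)
    moreover have "dsmooth (subD (total_space V) (fibre V x)) realD \<phi>" using assms by (simp add: smooth_dual_def)
    ultimately have "plot realD m W (\<phi> \<circ> a)" unfolding dsmooth_def by blast
    then show ?thesis by (simp add: realD_def comp_def)
  qed
qed (use assms in \<open>simp_all add: smooth_dual_def\<close>)

lemma smooth_dualI:
  assumes D: "diffeological_space (total_space V)"
    and "\<And>v w. v \<in> fibre V x \<Longrightarrow> w \<in> fibre V x \<Longrightarrow> \<phi> (fadd V v w) = \<phi> v + \<phi> w"
    and "\<And>r v. v \<in> fibre V x \<Longrightarrow> \<phi> (fscale V r v) = r * \<phi> v"
    and "\<And>v. v \<notin> fibre V x \<Longrightarrow> \<phi> v = 0"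
    and "\<And>m W a. plot (total_space V) m W a \<Longrightarrow> (\<And>w. w \<in> W \<Longrightarrow> a w \<in> fibre V x) \<Longrightarrow> smooth_fun m W (\<lambda>w. \<phi> (a w))"
  shows "\<phi> \<in> smooth_dual V x"
proof -
  have "dsmooth (subD (total_space V) (fibre V x)) realD \<phi>"
    unfolding dsmooth_def
  proof (intro conjI allI impI)
    fix m W a assume "plot (subD (total_space V) (fibre V x)) m W a"
    then have a: "plot (total_space V) m W a" "\<And>w. w \<in> W \<Longrightarrow> a w \<in> fibre V x" by (auto simp: subD_def)
    show "plot realD m W (\<phi> \<circ> a)"
      using plot_open[OF D a(1)] assms(5)[OF a] by (simp add: realD_def comp_def)
  qed (simp add: realD_def)
  then show ?thesis using assms(2-4) by (simp add: smooth_dual_def)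
qed

lemma smooth_dual_subspace:
  assumes D: "diffeological_space (total_space V)"
  shows "\<phi> \<in> smooth_dual V x \<Longrightarrow> \<psi> \<in> smooth_dual V x \<Longrightarrow> (\<lambda>v. \<phi> v + \<psi> v) \<in> smooth_dual V x"
    and "\<phi> \<in> smooth_dual V x \<Longrightarrow> (\<lambda>v. r * \<phi> v) \<in> smooth_dual V x"
    and "(\<lambda>v. 0) \<in> smooth_dual V x"
proof -
  show "(\<lambda>v. \<phi> v + \<psi> v) \<in> smooth_dual V x" if \<phi>: "\<phi> \<in> smooth_dual V x" and \<psi>: "\<psi> \<in> smooth_dual V x"
  proof (rule smooth_dualI[OF D])
    fix m W a assume a: "plot (total_space V) m W a" "\<And>w. w \<in> W \<Longrightarrow> a w \<in> fibre V x"
    show "smooth_fun m W (\<lambda>w. \<phi> (a w) + \<psi> (a w))"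
      by (rule smooth_fun_add[OF plot_open[OF D a(1)] smooth_dualD(4)[OF \<phi> a] smooth_dualD(4)[OF \<psi> a]])
  qed (simp_all add: smooth_dualD(1-3)[OF \<phi>] smooth_dualD(1-3)[OF \<psi>] algebra_simps)
  show "(\<lambda>v. r * \<phi> v) \<in> smooth_dual V x" if \<phi>: "\<phi> \<in> smooth_dual V x"
  proof (rule smooth_dualI[OF D])
    fix m W a assume a: "plot (total_space V) m W a" "\<And>w. w \<in> W \<Longrightarrow> a w \<in> fibre V x"
    show "smooth_fun m W (\<lambda>w. r * \<phi> (a w))"
      by (rule smooth_fun_mult[OF plot_open[OF D a(1)] smooth_fun_const[OF plot_open[OF D a(1)]] smooth_dualD(4)[OF \<phi> a]])
  qed (simp_all add: smooth_dualD(1-3)[OF \<phi>] algebra_simps)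
  show "(\<lambda>v. 0) \<in> smooth_dual V x"
    by (rule smooth_dualI[OF D]) (simp_all add: smooth_fun_const plot_open[OF D])
qed

lemma smooth_dual_sum:
  assumes D: "diffeological_space (total_space V)" and "\<And>i. i < (n::nat) \<Longrightarrow> \<phi> i \<in> smooth_dual V x"
  shows "(\<lambda>v. \<Sum>i<n. r i * \<phi> i v) \<in> smooth_dual V x"
  using assms(2) by (induction n) (auto intro!: smooth_dual_subspace[OF D])

lemma evaluation_bundle_dual:
  assumes "vector_pseudo_bundle V"
  shows "evaluation_bundle (base_space V) (total_space V) (bproj V) (smooth_dual V) (\<lambda>\<phi>. \<phi>)
    (\<lambda>\<phi> \<psi> v. \<phi> v + \<psi> v) (\<lambda>r \<phi> v. r * \<phi> v) (\<lambda>v. 0)"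
proof -
  note D = vector_pseudo_bundle_plots(1,2)[OF assms]
  show ?thesis
  proof
    show "smooth_fun m W (\<lambda>w. \<phi> (a w))"
      if "\<phi> \<in> smooth_dual V x" "plot (total_space V) m W a" "\<And>w. w \<in> W \<Longrightarrow> bproj V (a w) = x" for x \<phi> m W a
      using that plot_points[OF D(1) that(2)] by (intro smooth_dualD(4)[OF that(1,2)]) (simp add: fibre_def)
  qed (auto simp: D intro: smooth_dual_subspace[OF D(1)])
qed

lemma vector_pseudo_bundle_dual:
  assumes "vector_pseudo_bundle V"
  shows "vector_pseudo_bundle (dual_bundle V)"
proof -
  interpret evaluation_bundle "base_space V" "total_space V" "bproj V" "smooth_dual V" "\<lambda>\<phi>. \<phi>"
    "\<lambda>\<phi> \<psi> v. \<phi> v + \<psi> v" "\<lambda>r \<phi> v. r * \<phi> v" "\<lambda>v. 0"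
    by (rule evaluation_bundle_dual[OF assms])
  have "ebundle = dual_bundle V"
    by (simp add: ebundle_def etotal_def dual_bundle_def
        dual_plot_eq_evaluation_plot[OF vector_pseudo_bundle_plots(1)[OF assms]])
  then show ?thesis using vector_pseudo_bundle_ebundle by simp
qed

lemma dual_plot_compose:
  assumes "vector_pseudo_bundle V" "dual_plot V n U p" "smooth_map m W n U f" "plot (total_space V) m W a"
    "\<And>w. w \<in> W \<Longrightarrow> bproj V (a w) = fst (p (f w))"
  shows "smooth_fun m W (\<lambda>w. snd (p (f w)) (a w))"
  using evaluation_plotD(4)[OF assms(2)[unfolded dual_plot_eq_evaluation_plot[OF vector_pseudo_bundle_plots(1)[OF assms(1)]]]
      plot_open[OF vector_pseudo_bundle_plots(1)[OF assms(1)] assms(4)] assms(3-5)] .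

section \<open>The tensor square of the dual\<close>

text \<open>
  A tensor is a finite sum of products, so fixing one argument leaves a combination of
  smooth functionals in the other.  This holds for arguments outside the fibre as well,
  where the functionals vanish.
\<close>

lemma dual_tensor_fibre_slice:
  assumes D: "diffeological_space (total_space V)" and b: "b \<in> dual_tensor_fibre V x"
  shows "b v \<in> smooth_dual V x" "(\<lambda>v. b v w) \<in> smooth_dual V x"
proof -
  obtain n :: nat and \<phi> \<psi> where *: "\<And>i. i < n \<Longrightarrow> \<phi> i \<in> smooth_dual V x" "\<And>i. i < n \<Longrightarrow> \<psi> i \<in> smooth_dual V x"
    "b = (\<lambda>v w. \<Sum>i<n. tensor_form (\<phi> i) (\<psi> i) v w)"
    using b unfolding dual_tensor_fibre_def by blast
  show "b v \<in> smooth_dual V x"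
    unfolding *(3) tensor_form_def by (rule smooth_dual_sum[OF D *(2)])
  have "(\<lambda>v. \<Sum>i<n. \<psi> i w * \<phi> i v) \<in> smooth_dual V x" by (rule smooth_dual_sum[OF D *(1)])
  then show "(\<lambda>v. b v w) \<in> smooth_dual V x"
    unfolding *(3) tensor_form_def by (simp only: mult.commute)
qed

lemma dual_tensor_fibreI:
  assumes "\<And>i. i < (n::nat) \<Longrightarrow> \<phi> i \<in> smooth_dual V x" "\<And>i. i < n \<Longrightarrow> \<psi> i \<in> smooth_dual V x"
  shows "(\<lambda>v w. \<Sum>i<n. \<phi> i v * \<psi> i w) \<in> dual_tensor_fibre V x"
  unfolding dual_tensor_fibre_def tensor_form_def using assms by blast

lemma dual_tensor_fibreD:
  assumes "b \<in> dual_tensor_fibre V x"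
  shows "\<exists>(n::nat) \<phi> \<psi>. (\<forall>i<n. \<phi> i \<in> smooth_dual V x) \<and> (\<forall>i<n. \<psi> i \<in> smooth_dual V x) \<and>
    b = (\<lambda>v w. \<Sum>i<n. \<phi> i v * \<psi> i w)"
  using assms unfolding dual_tensor_fibre_def tensor_form_def by blast

lemma dual_tensor_fibre_subspace:
  assumes D: "diffeological_space (total_space V)"
  shows "b \<in> dual_tensor_fibre V x \<Longrightarrow> c \<in> dual_tensor_fibre V x \<Longrightarrow> (\<lambda>v w. b v w + c v w) \<in> dual_tensor_fibre V x"
    and "b \<in> dual_tensor_fibre V x \<Longrightarrow> (\<lambda>v w. r * b v w) \<in> dual_tensor_fibre V x"
    and "(\<lambda>v w. 0) \<in> dual_tensor_fibre V x"
proof -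
  show "(\<lambda>v w. b v w + c v w) \<in> dual_tensor_fibre V x"
    if b: "b \<in> dual_tensor_fibre V x" and c: "c \<in> dual_tensor_fibre V x"
  proof -
    obtain n :: nat and \<phi> \<psi> where 1: "\<And>i. i < n \<Longrightarrow> \<phi> i \<in> smooth_dual V x" "\<And>i. i < n \<Longrightarrow> \<psi> i \<in> smooth_dual V x"
      "b = (\<lambda>v w. \<Sum>i<n. \<phi> i v * \<psi> i w)" using dual_tensor_fibreD[OF b] by blast
    obtain m :: nat and \<phi>' \<psi>' where 2: "\<And>i. i < m \<Longrightarrow> \<phi>' i \<in> smooth_dual V x" "\<And>i. i < m \<Longrightarrow> \<psi>' i \<in> smooth_dual V x"
      "c = (\<lambda>v w. \<Sum>i<m. \<phi>' i v * \<psi>' i w)" using dual_tensor_fibreD[OF c] by blast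
    have "(\<lambda>v w. \<Sum>i<n+m. (if i < n then \<phi> i else \<phi>' (i - n)) v * (if i < n then \<psi> i else \<psi>' (i - n)) w)
        \<in> dual_tensor_fibre V x"
      by (rule dual_tensor_fibreI) (use 1 2 in auto)
    moreover have "(\<Sum>i<n+m. F i) = (\<Sum>i<n. F i) + (\<Sum>i<m. F (n + i))" for F :: "nat \<Rightarrow> real"
      by (induction m) simp_all
    then have "(\<Sum>i<n+m. (if i < n then \<phi> i else \<phi>' (i - n)) v * (if i < n then \<psi> i else \<psi>' (i - n)) w)
        = b v w + c v w" for v w
      by (simp add: 1(3) 2(3))
    ultimately show ?thesis by simp
  qed
  show "(\<lambda>v w. r * b v w) \<in> dual_tensor_fibre V x" if b: "b \<in> dual_tensor_fibre V x"
  proof -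
    obtain n :: nat and \<phi> \<psi> where 1: "\<And>i. i < n \<Longrightarrow> \<phi> i \<in> smooth_dual V x" "\<And>i. i < n \<Longrightarrow> \<psi> i \<in> smooth_dual V x"
      "b = (\<lambda>v w. \<Sum>i<n. \<phi> i v * \<psi> i w)" using dual_tensor_fibreD[OF b] by blast
    have "(\<lambda>v w. \<Sum>i<n. (\<lambda>v. r * \<phi> i v) v * \<psi> i w) \<in> dual_tensor_fibre V x"
      by (rule dual_tensor_fibreI) (use 1 smooth_dual_subspace(2)[OF D] in auto)
    then show ?thesis unfolding 1(3) by (simp add: sum_distrib_left mult.assoc)
  qed
  show "(\<lambda>v w. 0) \<in> dual_tensor_fibre V x"
    using dual_tensor_fibreI[of 0] by simp
qed

abbreviation fibre_pairs :: "('v, 'x) pbundle \<Rightarrow> ('v \<times> 'v) diffspace" where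
  "fibre_pairs V \<equiv> subD (prodD (total_space V) (total_space V)) {(v, w). bproj V v = bproj V w}"

lemma evaluation_bundle_dual_tensor:
  assumes "vector_pseudo_bundle V"
  shows "evaluation_bundle (base_space V) (fibre_pairs V) (\<lambda>t. bproj V (fst t)) (dual_tensor_fibre V)
    (\<lambda>b t. b (fst t) (snd t)) (\<lambda>b c v w. b v w + c v w) (\<lambda>r b v w. r * b v w) (\<lambda>v w. 0)"
proof -
  note D = vector_pseudo_bundle_plots(1,2)[OF assms]
  show ?thesis
  proof
    show "diffeological_space (fibre_pairs V)"
      by (intro diffeological_space_subD diffeological_space_prodD D)
    show "b = c" if "\<And>t. b (fst t) (snd t) = c (fst t) (snd t)" for b c :: "'a \<Rightarrow> 'a \<Rightarrow> real"
      using that[of "(v, w)" for v w] by (simp add: fun_eq_iff)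
    show "smooth_fun m W (\<lambda>w. b (fst (a w)) (snd (a w)))"
      if b: "b \<in> dual_tensor_fibre V x" and a: "plot (fibre_pairs V) m W a"
        and \<pi>a: "\<And>w. w \<in> W \<Longrightarrow> bproj V (fst (a w)) = x" for x b m W a
    proof -
      have a': "plot (total_space V) m W (\<lambda>w. fst (a w))" "plot (total_space V) m W (\<lambda>w. snd (a w))"
        "\<And>w. w \<in> W \<Longrightarrow> bproj V (fst (a w)) = bproj V (snd (a w))"
        using a by (auto simp: subD_def prodD_def comp_def)
      have fib: "fst (a w) \<in> fibre V x" "snd (a w) \<in> fibre V x" if "w \<in> W" for w
        using plot_points[OF D(1) a'(1) that] plot_points[OF D(1) a'(2) that] a'(3)[OF that] \<pi>a[OF that]
        by (simp_all add: fibre_def)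
      note W = plot_open[OF D(1) a'(1)]
      obtain n :: nat and \<phi> \<psi> where 1: "\<And>i. i < n \<Longrightarrow> \<phi> i \<in> smooth_dual V x" "\<And>i. i < n \<Longrightarrow> \<psi> i \<in> smooth_dual V x"
        "b = (\<lambda>v w. \<Sum>i<n. \<phi> i v * \<psi> i w)" using dual_tensor_fibreD[OF b] by blast
      have "smooth_fun m W (\<lambda>w. \<phi> i (fst (a w)) * \<psi> i (snd (a w)))" if "i < n" for i
        by (intro smooth_fun_mult[OF W] smooth_dualD(4)[OF 1(1)[OF that] a'(1)]
            smooth_dualD(4)[OF 1(2)[OF that] a'(2)] fib)
      then show ?thesis unfolding 1(3) smooth_fun_def using Ck_sum[OF W] by simp
    qed
  qed (auto simp: D intro: dual_tensor_fibre_subspace[OF D(1)])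
qed

abbreviation bilinear_plot :: "('v, 'x) pbundle \<Rightarrow> ('x \<times> ('v \<Rightarrow> 'v \<Rightarrow> real)) plots" where
  "bilinear_plot V \<equiv> evaluation_plot (base_space V) (fibre_pairs V) (\<lambda>t. bproj V (fst t)) (dual_tensor_fibre V)
    (\<lambda>b t. b (fst t) (snd t))"

text \<open>
  The maps into the space of bilinear forms that are smooth under evaluation at pairs of plots
  form an admissible diffeology.  It need not be the smallest one, but it bounds the smallest
  one from above, which is how smoothness of a section is exploited below.
\<close>

lemma tensor_admissible_bilinear_plot:
  assumes V: "vector_pseudo_bundle V"
  shows "tensor_admissible V (bilinear_plot V)"
proof -
  interpret evaluation_bundle "base_space V" "fibre_pairs V" "\<lambda>t. bproj V (fst t)" "dual_tensor_fibre V"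
    "\<lambda>b t. b (fst t) (snd t)" "\<lambda>b c v w. b v w + c v w" "\<lambda>r b v w. r * b v w" "\<lambda>v w. 0"
    by (rule evaluation_bundle_dual_tensor[OF V])
  have eb: "ebundle = dual_tensor_with V (bilinear_plot V)"
    by (simp add: ebundle_def etotal_def dual_tensor_with_def)
  have sel: "points (total_space (dual_tensor_with V P)) = (SIGMA x:points (base_space V). dual_tensor_fibre V x)"
    "plot (total_space (dual_tensor_with V P)) = P"
    "points (total_space (dual_bundle V)) = (SIGMA x:points (base_space V). smooth_dual V x)"
    "plot (total_space (dual_bundle V)) = dual_plot V" for P
    by (simp_all add: dual_tensor_with_def dual_bundle_def)
  have tensor: "tensor_form \<phi> \<psi> \<in> dual_tensor_fibre V x" if "\<phi> \<in> smooth_dual V x" "\<psi> \<in> smooth_dual V x" for \<phi> \<psi> x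
    using dual_tensor_fibreI[of 1 "\<lambda>_. \<phi>" V x "\<lambda>_. \<psi>"] that by (simp add: tensor_form_def)
  show ?thesis
    unfolding tensor_admissible_def
  proof
    show "vector_pseudo_bundle (dual_tensor_with V (bilinear_plot V))"
      using vector_pseudo_bundle_ebundle by (simp only: eb)
    show "dsmooth (subD (prodD (total_space (dual_bundle V)) (total_space (dual_bundle V))) {(a, b). fst a = fst b})
       (total_space (dual_tensor_with V (bilinear_plot V))) (\<lambda>((x, \<phi>), (y, \<psi>)). (x, tensor_form \<phi> \<psi>))"
      unfolding dsmooth_def
    proof (intro conjI allI impI)
      show "(\<lambda>((x, \<phi>), y, \<psi>). (x, tensor_form \<phi> \<psi>)) ` points (subD (prodD (total_space (dual_bundle V))
          (total_space (dual_bundle V))) {(a, b). fst a = fst b}) \<subseteq> points (total_space (dual_tensor_with V (bilinear_plot V)))"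
        using tensor by (auto simp: subD_def prodD_def sel)
      fix n U r
      assume "plot (subD (prodD (total_space (dual_bundle V)) (total_space (dual_bundle V))) {(a, b). fst a = fst b}) n U r"
      then have r: "dual_plot V n U (\<lambda>u. fst (r u))" "dual_plot V n U (\<lambda>u. snd (r u))"
        "\<And>u. u \<in> U \<Longrightarrow> fst (fst (r u)) = fst (snd (r u))"
        by (auto simp: subD_def prodD_def sel comp_def)
      note r1 = r(1)[unfolded dual_plot_def] and r2 = r(2)[unfolded dual_plot_def]
      have "bilinear_plot V n U (\<lambda>u. (fst (fst (r u)), tensor_form (snd (fst (r u))) (snd (snd (r u)))))"
      proof (rule evaluation_plotI; (simp only: fst_conv snd_conv)?)
        show "openin (Euclidean_space n) U" using r1 by blast
        show "tensor_form (snd (fst (r u))) (snd (snd (r u))) \<in> dual_tensor_fibre V (fst (fst (r u)))"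
          if "u \<in> U" for u
          using r1 r2 r(3)[OF that] that by (intro tensor) auto
        show "plot (base_space V) n U (\<lambda>u. fst (fst (r u)))" using r1 by (simp add: comp_def)
        fix m W f a
        assume W: "openin (Euclidean_space m) W" and f: "smooth_map m W n U f" and a: "plot (fibre_pairs V) m W a"
          and \<pi>a: "\<And>w. w \<in> W \<Longrightarrow> bproj V (fst (a w)) = fst (fst (r (f w)))"
        have a': "plot (total_space V) m W (\<lambda>w. fst (a w))" "plot (total_space V) m W (\<lambda>w. snd (a w))"
          "\<And>w. w \<in> W \<Longrightarrow> bproj V (fst (a w)) = bproj V (snd (a w))"
          using a by (auto simp: subD_def prodD_def comp_def)
        have "bproj V (snd (a w)) = fst (snd (r (f w)))" if "w \<in> W" for w
          using a'(3)[OF that] \<pi>a[OF that] r(3)[of "f w"] f that by (auto simp: smooth_map_def)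
        then show "smooth_fun m W (\<lambda>w. tensor_form (snd (fst (r (f w)))) (snd (snd (r (f w)))) (fst (a w)) (snd (a w)))"
          unfolding tensor_form_def
          by (intro smooth_fun_mult[OF W] dual_plot_compose[OF V r(1) f a'(1)] dual_plot_compose[OF V r(2) f a'(2)] \<pi>a)
      qed
      then show "plot (total_space (dual_tensor_with V (bilinear_plot V))) n U
          ((\<lambda>((x, \<phi>), y, \<psi>). (x, tensor_form \<phi> \<psi>)) \<circ> r)"
        unfolding sel by (simp add: comp_def split_beta)
    qed
  qed
qed

text \<open>
  A plot of \<open>V\<^sup>* \<otimes> V\<^sup>*\<close> is a plot for every admissible diffeology, in particular for that
  of the bilinear plots, whose definition is the smoothness claimed here.
\<close>

lemma smooth_section_evaluation:
  assumes V: "vector_pseudo_bundle V"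
    and g: "dsmooth (base_space V) (total_space (dual_tensor_bundle V)) (\<lambda>x. (x, g x))"
    and a: "plot (total_space V) n U a" and b: "plot (total_space V) n U b"
    and ab: "\<And>u. u \<in> U \<Longrightarrow> bproj V (a u) = p u" "\<And>u. u \<in> U \<Longrightarrow> bproj V (b u) = p u"
  shows "smooth_fun n U (\<lambda>u. g (p u) (a u) (b u))"
proof -
  note D = vector_pseudo_bundle_plots(1,2)[OF V]
  note U = plot_open[OF D(1) a]
  have p: "plot (base_space V) n U p"
    by (rule plot_cong[OF D(2) vector_pseudo_bundle_plots(3)[OF V a]]) (simp add: ab)
  have "plot (total_space (dual_tensor_bundle V)) n U (\<lambda>u. (p u, g (p u)))"
    using g p unfolding dsmooth_def comp_def by blast
  then have "\<forall>P. tensor_admissible V P \<longrightarrow> P n U (\<lambda>u. (p u, g (p u)))"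
    by (simp add: dual_tensor_bundle_def dual_tensor_with_def)
  then have "bilinear_plot V n U (\<lambda>u. (p u, g (p u)))"
    by (rule allE) (erule mp, rule tensor_admissible_bilinear_plot[OF V])
  moreover have "plot (fibre_pairs V) n U (\<lambda>u. (a u, b u))"
    using a b ab by (auto simp: subD_def prodD_def comp_def)
  ultimately show ?thesis
    using evaluation_plotD(4)[of "base_space V" "fibre_pairs V" "\<lambda>t. bproj V (fst t)" "dual_tensor_fibre V"
       "\<lambda>b t. b (fst t) (snd t)" n U "\<lambda>u. (p u, g (p u))" n U "\<lambda>u. u" "\<lambda>u. (a u, b u)"]
      U smooth_map_inclusion[OF U subset_refl] ab by simp
qed

text \<open>
  A finite sum of tensor products of plots is a plot in every admissible diffeology, because
  addition and the tensor map are smooth for it.  This is how sections of the tensor square are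
  shown to be smooth.
\<close>

lemma tensor_sum_plot:
  assumes V: "vector_pseudo_bundle V" and P: "tensor_admissible V P"
    and p: "plot (base_space V) n U p"
    and "\<And>i. i < (m::nat) \<Longrightarrow> dual_plot V n U (\<lambda>u. (p u, \<phi> i u))" "\<And>i. i < m \<Longrightarrow> dual_plot V n U (\<lambda>u. (p u, \<psi> i u))"
  shows "P n U (\<lambda>u. (p u, \<lambda>v w. \<Sum>i<m. \<phi> i u v * \<psi> i u w))"
  using assms(4,5)
proof (induction m)
  have W: "vector_pseudo_bundle (dual_tensor_with V P)"
    using P by (simp add: tensor_admissible_def)
  have sel: "total_space (dual_tensor_with V P) = \<lparr>points = (SIGMA x:points (base_space V). dual_tensor_fibre V x), plot = P\<rparr>"
    "base_space (dual_tensor_with V P) = base_space V" "bproj (dual_tensor_with V P) = fst"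
    "fadd (dual_tensor_with V P) (x, a) (y, b) = (x, \<lambda>v w. a v w + b v w)"
    "fzero (dual_tensor_with V P) x = (x, \<lambda>v w. 0)" for x y a b
    by (simp_all add: dual_tensor_with_def)
  {
    case 0
    show ?case using vector_pseudo_bundle_plots(6)[OF W, unfolded sel, OF p] by simp
  next
    case (Suc m)
    let ?T = "(\<lambda>((x, \<phi>), (y, \<psi>)). (x, tensor_form \<phi> \<psi>)) \<circ> (\<lambda>u. ((p u, \<phi> m u), (p u, \<psi> m u)))"
    have "plot (subD (prodD (total_space (dual_bundle V)) (total_space (dual_bundle V))) {(a, b). fst a = fst b}) n U
        (\<lambda>u. ((p u, \<phi> m u), (p u, \<psi> m u)))"
      using Suc.prems by (auto simp: subD_def prodD_def comp_def dual_bundle_def)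
    then have "plot (total_space (dual_tensor_with V P)) n U ?T"
      using P unfolding tensor_admissible_def dsmooth_def by blast
    then have "P n U (\<lambda>u. (p u, \<lambda>v w. \<phi> m u v * \<psi> m u w))"
      by (simp add: sel comp_def tensor_form_def)
    moreover have "P n U (\<lambda>u. (p u, \<lambda>v w. \<Sum>i<m. \<phi> i u v * \<psi> i u w))" using Suc by simp
    ultimately show ?case
      using vector_pseudo_bundle_plots(4)[OF W, of n U "\<lambda>u. (p u, \<lambda>v w. \<Sum>i<m. \<phi> i u v * \<psi> i u w)"
        "\<lambda>u. (p u, \<lambda>v w. \<phi> m u v * \<psi> m u w)"] by (simp add: sel)
  }
qed

section \<open>Finite-dimensional spaces of functions\<close>

interpretation fun_space: vector_space "\<lambda>(c::real) (f::'a \<Rightarrow> real) a. c * f a"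
  by unfold_locales (auto simp: fun_eq_iff algebra_simps)

interpretation fun_space_pair: vector_space_pair "\<lambda>(c::real) (f::'a \<Rightarrow> real) a. c * f a"
  "\<lambda>(c::real) (f::'b \<Rightarrow> real) a. c * f a" ..

lemma sum_fun_apply: "(\<Sum>b\<in>B. f b) a = (\<Sum>b\<in>B. f b a)"
  for f :: "'b \<Rightarrow> 'a \<Rightarrow> 'c::comm_monoid_add"
  by (induction B rule: infinite_finite_induct) simp_all

text \<open>
  Restriction to the finite set \<open>B\<close> is linear, injective on \<open>S\<close>, and lands in the span of
  finitely many indicator functions.
\<close>

lemma finite_independent_separated:
  fixes S I :: "('a \<Rightarrow> real) set"
  assumes S: "fun_space.subspace S" and B: "finite B"
    and sep: "\<And>\<phi>. \<phi> \<in> S \<Longrightarrow> (\<And>b. b \<in> B \<Longrightarrow> \<phi> b = 0) \<Longrightarrow> \<phi> = 0"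
    and I: "I \<subseteq> S" "fun_space.independent I"
  shows "finite I"
proof -
  define R :: "('a \<Rightarrow> real) \<Rightarrow> 'a \<Rightarrow> real" where "R \<phi> = (\<lambda>a. if a \<in> B then \<phi> a else 0)" for \<phi>
  have lin: "Vector_Spaces.linear (\<lambda>c f a. c * f a) (\<lambda>c f a. c * f a) R"
    by unfold_locales (auto simp: R_def fun_eq_iff)
  have span: "fun_space.span I \<subseteq> S" using I(1) S by (rule fun_space.span_minimal)
  have inj: "inj_on R S"
  proof (rule inj_onI)
    fix \<phi> \<psi> assume "\<phi> \<in> S" "\<psi> \<in> S" "R \<phi> = R \<psi>"
    have "(\<phi> - \<psi>) b = 0" if "b \<in> B" for b
      using fun_cong[OF \<open>R \<phi> = R \<psi>\<close>, of b] that by (simp add: R_def)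
    moreover have "\<phi> - \<psi> \<in> S" using S \<open>\<phi> \<in> S\<close> \<open>\<psi> \<in> S\<close> by (rule fun_space.subspace_diff)
    ultimately have "\<phi> - \<psi> = 0" using sep by blast
    then show "\<phi> = \<psi>" by simp
  qed
  define e :: "'a \<Rightarrow> 'a \<Rightarrow> real" where "e b = (\<lambda>a. if a = b then 1 else 0)" for b
  have "R \<phi> \<in> fun_space.span (e ` B)" for \<phi>
  proof -
    have "R \<phi> = (\<Sum>b\<in>B. (\<lambda>a. \<phi> b * e b a))"
      using B by (simp add: R_def e_def fun_eq_iff sum_fun_apply if_distrib cong: if_cong)
    also have "\<dots> \<in> fun_space.span (e ` B)"
      by (intro fun_space.span_sum fun_space.span_scale fun_space.span_base imageI)
    finally show ?thesis .
  qed
  moreover have "fun_space.independent (R ` I)"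
    by (rule fun_space_pair.linear_independent_injective_image[OF lin I(2)])
      (rule inj_on_subset[OF inj span])
  ultimately have "finite (R ` I)"
    using fun_space.independent_span_bound[of "e ` B" "R ` I"] B by blast
  then show ?thesis using inj I(1) by (meson finite_imageD inj_on_subset)
qed

text \<open>
  The ambient space of functions may be infinite-dimensional; the finite separating set \<open>B\<close>
  is what makes the dimensions of \<open>S\<close> and \<open>T\<close> genuine rather than the default
  cardinality \<open>0\<close> of an infinite basis.
\<close>

lemma subspace_eq_of_fun_dim_eq:
  fixes S T :: "('a \<Rightarrow> real) set"
  assumes S: "fun_space.subspace S" and T: "fun_space.subspace T" and TS: "T \<subseteq> S"
    and B: "finite B" "\<And>\<phi>. \<phi> \<in> S \<Longrightarrow> (\<And>b. b \<in> B \<Longrightarrow> \<phi> b = 0) \<Longrightarrow> \<phi> = 0"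
    and dim: "fun_dim T = fun_dim S"
  shows "T = S"
proof (rule ccontr)
  assume "T \<noteq> S"
  then obtain v where v: "v \<in> S" "v \<notin> T" using TS by blast
  obtain BT where BT: "BT \<subseteq> T" "fun_space.independent BT" "T \<subseteq> fun_space.span BT" "card BT = fun_space.dim T"
    using fun_space.basis_exists by blast
  obtain BS where BS: "BS \<subseteq> S" "fun_space.independent BS" "S \<subseteq> fun_space.span BS" "card BS = fun_space.dim S"
    using fun_space.basis_exists by blast
  have fin: "finite BT" "finite BS"
    using finite_independent_separated[OF S B] BT(1,2) BS(1,2) TS by blast+
  have v': "v \<notin> fun_space.span BT" using v(2) fun_space.span_minimal[OF BT(1) T] by blast
  then have "fun_space.independent (insert v BT)" by (rule fun_space.independent_insertI[OF _ BT(2)])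
  then have "card (insert v BT) \<le> card BS"
    using fun_space.independent_span_bound[OF fin(2)] v(1) BT(1) TS BS(3) by blast
  moreover have "v \<notin> BT" using v' fun_space.span_base by blast
  ultimately show False using fin(1) BT(4) BS(4) dim by (simp add: fun_dim_def)
qed

section \<open>Linear algebra of a pseudo-metric on a fibre\<close>

lemma fibre_closed:
  assumes "vector_pseudo_bundle V" "x \<in> points (base_space V)"
  shows "fzero V x \<in> fibre V x"
    and "v \<in> fibre V x \<Longrightarrow> w \<in> fibre V x \<Longrightarrow> fadd V v w \<in> fibre V x"
    and "v \<in> fibre V x \<Longrightarrow> fscale V r v \<in> fibre V x"
    and "v \<in> fibre V x \<Longrightarrow> fadd V (fzero V x) v = v"
proof -
  have "real_vector_space_on (fibre V x) (fadd V) (fscale V) (fzero V x)"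
    using assms by (simp add: vector_pseudo_bundle_def)
  note * = this[unfolded real_vector_space_on_def]
  show "fzero V x \<in> fibre V x" using * by blast
  show "v \<in> fibre V x \<Longrightarrow> w \<in> fibre V x \<Longrightarrow> fadd V v w \<in> fibre V x" using * by simp
  show "v \<in> fibre V x \<Longrightarrow> fscale V r v \<in> fibre V x" using * by simp
  show "v \<in> fibre V x \<Longrightarrow> fadd V (fzero V x) v = v" using * by blast
qed

lemma fibre_base: "vector_pseudo_bundle V \<Longrightarrow> v \<in> fibre V x \<Longrightarrow> x \<in> points (base_space V)"
  unfolding vector_pseudo_bundle_def fibre_def by blast

lemma smooth_dual_zero:
  assumes "vector_pseudo_bundle V" "x \<in> points (base_space V)" "\<phi> \<in> smooth_dual V x"
  shows "\<phi> (fzero V x) = 0"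
  using smooth_dualD(1)[OF assms(3), of "fzero V x" "fzero V x"] fibre_closed[OF assms(1,2)] by simp

text \<open>
  The zero set of a functional is a subspace containing \<open>B\<close>, hence contains the span of \<open>B\<close>.
\<close>

lemma smooth_dual_separated_by_span:
  assumes V: "vector_pseudo_bundle V" and x: "x \<in> points (base_space V)"
    and B: "B \<subseteq> fibre V x" "fibre_span V x B = fibre V x"
    and \<phi>: "\<phi> \<in> smooth_dual V x" "\<And>b. b \<in> B \<Longrightarrow> \<phi> b = 0"
  shows "\<phi> = (\<lambda>v. 0)"
proof -
  let ?S = "{v \<in> fibre V x. \<phi> v = 0}"
  have "fibre_span V x B \<subseteq> ?S"
    unfolding fibre_span_def
    by (rule Inter_lower)
      (use B \<phi> fibre_closed[OF V x] smooth_dual_zero[OF V x \<phi>(1)] smooth_dualD(1,2)[OF \<phi>(1)] in auto)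
  then show ?thesis using B(2) smooth_dualD(3)[OF \<phi>(1)] by (auto simp: fun_eq_iff)
qed

lemma pseudo_metricD:
  assumes "pseudo_metric V g"
  shows "vector_pseudo_bundle V"
    and "dsmooth (base_space V) (total_space (dual_tensor_bundle V)) (\<lambda>x. (x, g x))"
    and "x \<in> points (base_space V) \<Longrightarrow> g x \<in> dual_tensor_fibre V x"
    and "x \<in> points (base_space V) \<Longrightarrow> v \<in> fibre V x \<Longrightarrow> w \<in> fibre V x \<Longrightarrow> g x v w = g x w v"
    and "x \<in> points (base_space V) \<Longrightarrow> v \<in> fibre V x \<Longrightarrow> 0 \<le> g x v v"
    and "x \<in> points (base_space V) \<Longrightarrow> bilin_rank V x (g x) = fun_dim (smooth_dual V x)"
proof -
  show D: "dsmooth (base_space V) (total_space (dual_tensor_bundle V)) (\<lambda>x. (x, g x))"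
    using assms by (simp add: pseudo_metric_def)
  show "g x \<in> dual_tensor_fibre V x" if "x \<in> points (base_space V)"
    using D that unfolding dsmooth_def by (auto simp: dual_tensor_bundle_def dual_tensor_with_def)
qed (use assms in \<open>simp_all add: pseudo_metric_def finite_dim_pseudo_bundle_def\<close>)

lemma pseudo_metric_linear:
  assumes g: "pseudo_metric V g" and x: "x \<in> points (base_space V)"
  shows "g x v \<in> smooth_dual V x"
    and "v \<in> fibre V x \<Longrightarrow> w \<in> fibre V x \<Longrightarrow> g x (fadd V v w) = (\<lambda>a. g x v a + g x w a)"
    and "v \<in> fibre V x \<Longrightarrow> g x (fscale V r v) = (\<lambda>a. r * g x v a)"
    and "g x (fzero V x) = (\<lambda>a. 0)"
    and "v \<in> fibre V x \<Longrightarrow> w \<in> fibre V x \<Longrightarrow> g x a (fadd V v w) = g x a v + g x a w"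
    and "v \<in> fibre V x \<Longrightarrow> g x a (fscale V r v) = r * g x a v"
proof -
  note V = pseudo_metricD(1)[OF g]
  note slice = dual_tensor_fibre_slice[OF vector_pseudo_bundle_plots(1)[OF V] pseudo_metricD(3)[OF g x]]
  show "g x v \<in> smooth_dual V x" by (rule slice(1))
  show "v \<in> fibre V x \<Longrightarrow> w \<in> fibre V x \<Longrightarrow> g x (fadd V v w) = (\<lambda>a. g x v a + g x w a)"
    using smooth_dualD(1)[OF slice(2)] by (simp add: fun_eq_iff)
  show "v \<in> fibre V x \<Longrightarrow> g x (fscale V r v) = (\<lambda>a. r * g x v a)"
    using smooth_dualD(2)[OF slice(2)] by (simp add: fun_eq_iff)
  show "g x (fzero V x) = (\<lambda>a. 0)"
    using smooth_dual_zero[OF V x slice(2)] by (simp add: fun_eq_iff)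
  show "v \<in> fibre V x \<Longrightarrow> w \<in> fibre V x \<Longrightarrow> g x a (fadd V v w) = g x a v + g x a w"
    by (rule smooth_dualD(1)[OF slice(1)])
  show "v \<in> fibre V x \<Longrightarrow> g x a (fscale V r v) = r * g x a v"
    by (rule smooth_dualD(2)[OF slice(1)])
qed

text \<open>
  The image of the pairing is a subspace of the smooth dual, and the rank condition says that
  both have the same finite dimension.
\<close>

lemma pseudo_metric_onto_smooth_dual:
  assumes g: "pseudo_metric V g" and x: "x \<in> points (base_space V)"
  shows "g x ` fibre V x = smooth_dual V x"
proof -
  note V = pseudo_metricD(1)[OF g]
  note D = vector_pseudo_bundle_plots(1)[OF V]
  note lin = pseudo_metric_linear[OF g x]
  obtain B where B: "finite B" "B \<subseteq> fibre V x" "fibre_span V x B = fibre V x"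
    using g x unfolding pseudo_metric_def finite_dim_pseudo_bundle_def by blast
  show ?thesis
  proof (rule subspace_eq_of_fun_dim_eq[OF _ _ _ B(1)])
    show "fun_space.subspace (smooth_dual V x)"
      by (simp add: fun_space.subspace_def plus_fun_def zero_fun_def smooth_dual_subspace[OF D])
    show "fun_space.subspace (g x ` fibre V x)"
      unfolding fun_space.subspace_def
    proof (intro conjI ballI allI)
      show "0 \<in> g x ` fibre V x"
        using lin(4) fibre_closed(1)[OF V x] by (intro image_eqI[of _ _ "fzero V x"]) (simp_all add: zero_fun_def)
      show "\<phi> + \<psi> \<in> g x ` fibre V x" if \<phi>: "\<phi> \<in> g x ` fibre V x" and \<psi>: "\<psi> \<in> g x ` fibre V x" for \<phi> \<psi>
      proof -
        obtain v w where "v \<in> fibre V x" "w \<in> fibre V x" "\<phi> = g x v" "\<psi> = g x w" using \<phi> \<psi> by blast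
        then show ?thesis using lin(2) fibre_closed(2)[OF V x]
          by (intro image_eqI[of _ _ "fadd V v w"]) (simp_all add: plus_fun_def)
      qed
      show "(\<lambda>a. r * \<phi> a) \<in> g x ` fibre V x" if \<phi>: "\<phi> \<in> g x ` fibre V x" for r \<phi>
      proof -
        obtain v where "v \<in> fibre V x" "\<phi> = g x v" using \<phi> by blast
        then show ?thesis using lin(3) fibre_closed(3)[OF V x]
          by (intro image_eqI[of _ _ "fscale V r v"]) simp_all
      qed
    qed
    show "g x ` fibre V x \<subseteq> smooth_dual V x" using lin(1) by blast
    show "\<phi> = 0" if "\<phi> \<in> smooth_dual V x" "\<And>b. b \<in> B \<Longrightarrow> \<phi> b = 0" for \<phi>
      using smooth_dual_separated_by_span[OF V x B(2,3) that] by (simp add: zero_fun_def)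
    show "fun_dim (g x ` fibre V x) = fun_dim (smooth_dual V x)"
      using pseudo_metricD(6)[OF g x] by (simp add: bilin_rank_def)
  qed
qed

text \<open>
  The Cauchy-Schwarz argument: \<open>g(w + t v, w + t v) = g(w, w) + 2 t g(v, w)\<close> would become
  negative for a suitable \<open>t\<close> if \<open>g(v, w)\<close> were not zero.
\<close>

lemma pseudo_metric_null:
  assumes g: "pseudo_metric V g" and x: "x \<in> points (base_space V)"
    and v: "v \<in> fibre V x" and w: "w \<in> fibre V x" and null: "g x v v = 0"
  shows "g x v w = 0"
proof (rule ccontr)
  assume nz: "g x v w \<noteq> 0"
  note V = pseudo_metricD(1)[OF g]
  note lin = pseudo_metric_linear[OF g x]
  \<comment> \<open>chosen so that the square of \<open>w + t v\<close> is \<open>- 1\<close>\<close>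
  define t where "t = - (g x w w + 1) / (2 * g x v w)"
  have tv: "fscale V t v \<in> fibre V x" by (rule fibre_closed(3)[OF V x v])
  have "0 \<le> g x (fadd V w (fscale V t v)) (fadd V w (fscale V t v))"
    by (intro pseudo_metricD(5)[OF g x] fibre_closed(2)[OF V x] w tv)
  also have "\<dots> = g x w w + 2 * t * g x v w"
    using pseudo_metricD(4)[OF g x v w] null v w tv
    by (simp add: lin(2,3,5,6) algebra_simps)
  also have "\<dots> = - 1" using nz by (simp add: t_def field_simps)
  finally show False by simp
qed

section \<open>Local sections separating the smooth functionals\<close>

text \<open>
  Take a separating family of least length.  If functionals killing the members before the
  \<open>k\<close>-th one always killed the \<open>k\<close>-th one as well, it could be dropped.
\<close>

lemma separating_independent_family:
  assumes V: "finite_dim_pseudo_bundle V" and x: "x \<in> points (base_space V)"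
  obtains m :: nat and c where "\<And>i. i < m \<Longrightarrow> c i \<in> fibre V x"
    and "\<And>\<phi>. \<phi> \<in> smooth_dual V x \<Longrightarrow> (\<And>i. i < m \<Longrightarrow> \<phi> (c i) = 0) \<Longrightarrow> \<phi> = (\<lambda>v. 0)"
    and "\<And>k. k < m \<Longrightarrow> \<exists>\<phi>\<in>smooth_dual V x. (\<forall>i<k. \<phi> (c i) = 0) \<and> \<phi> (c k) \<noteq> 0"
proof -
  define Q where "Q m c \<longleftrightarrow> (\<forall>i<m. c i \<in> fibre V x) \<and>
    (\<forall>\<phi>\<in>smooth_dual V x. (\<forall>i<m. \<phi> (c i) = 0) \<longrightarrow> \<phi> = (\<lambda>v. 0))" for m :: nat and c
  have V': "vector_pseudo_bundle V" using V by (simp add: finite_dim_pseudo_bundle_def)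
  obtain B where B: "finite B" "B \<subseteq> fibre V x" "fibre_span V x B = fibre V x"
    using V x unfolding finite_dim_pseudo_bundle_def by blast
  obtain bs where bs: "set bs = B" using finite_list[OF B(1)] by blast
  have "Q (length bs) (\<lambda>i. bs ! i)"
    unfolding Q_def
  proof (intro conjI allI impI ballI)
    show "bs ! i \<in> fibre V x" if "i < length bs" for i using that bs B(2) nth_mem by blast
    fix \<phi> assume \<phi>: "\<phi> \<in> smooth_dual V x" "\<forall>i<length bs. \<phi> (bs ! i) = 0"
    show "\<phi> = (\<lambda>v. 0)"
      by (rule smooth_dual_separated_by_span[OF V' x B(2,3) \<phi>(1)])
        (use \<phi>(2) bs in \<open>auto simp: in_set_conv_nth\<close>)
  qed
  then have ex: "\<exists>m c. Q m c" by blast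
  define m where "m = (LEAST m. \<exists>c. Q m c)"
  obtain c where c: "Q m c" using LeastI_ex[OF ex] by (auto simp: m_def)
  have least: "m \<le> m'" if "Q m' c'" for m' c' unfolding m_def by (rule Least_le) (use that in blast)
  show thesis
  proof
    show "c i \<in> fibre V x" if "i < m" for i using c that by (simp add: Q_def)
    show "\<phi> = (\<lambda>v. 0)" if "\<phi> \<in> smooth_dual V x" "\<And>i. i < m \<Longrightarrow> \<phi> (c i) = 0" for \<phi>
      using c that by (simp add: Q_def)
    fix k assume k: "k < m"
    show "\<exists>\<phi>\<in>smooth_dual V x. (\<forall>i<k. \<phi> (c i) = 0) \<and> \<phi> (c k) \<noteq> 0"
    proof (rule ccontr)
      assume "\<not> ?thesis"
      then have dep: "\<phi> (c k) = 0" if "\<phi> \<in> smooth_dual V x" "\<forall>i<k. \<phi> (c i) = 0" for \<phi> using that by blast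
      \<comment> \<open>the family without its \<open>k\<close>-th member\<close>
      define c' where "c' i = (if i < k then c i else c (Suc i))" for i
      have "Q (m - 1) c'"
        unfolding Q_def
      proof (intro conjI allI impI ballI)
        show "c' i \<in> fibre V x" if "i < m - 1" for i using c that by (auto simp: Q_def c'_def)
        fix \<phi> assume \<phi>: "\<phi> \<in> smooth_dual V x" "\<forall>i<m - 1. \<phi> (c' i) = 0"
        have lt: "\<forall>i<k. \<phi> (c i) = 0"
        proof (intro allI impI)
          fix i assume "i < k"
          then show "\<phi> (c i) = 0" using \<phi>(2)[rule_format, of i] k by (simp add: c'_def)
        qed
        have "\<phi> (c i) = 0" if i: "i < m" for i
        proof -
          consider "i < k" | "i = k" | "k < i" by linarith
          then show ?thesis
          proof cases
            case 3
            then obtain j where "i = Suc j" "k \<le> j" by (metis less_imp_Suc_add le_add1)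
            then show ?thesis using \<phi>(2)[rule_format, of j] i by (simp add: c'_def)
          qed (use lt dep[OF \<phi>(1) lt] in simp_all)
        qed
        then show "\<phi> = (\<lambda>v. 0)" using c \<phi>(1) by (simp add: Q_def)
      qed
      then show False using least k by fastforce
    qed
  qed
qed

text \<open>
  A local trivialization in fibrewise form: \<open>k y\<close> carries the model fibre at \<open>x\<close> to the
  fibre at \<open>y\<close>, and \<open>l\<close> carries every fibre over \<open>A\<close> back to the model fibre.
\<close>

definition trivialization :: "('v, 'x) pbundle \<Rightarrow> 'x set \<Rightarrow> 'x \<Rightarrow> ('x \<Rightarrow> 'v \<Rightarrow> 'v) \<Rightarrow> ('v \<Rightarrow> 'v) \<Rightarrow> bool" where
  "trivialization V A x k l \<longleftrightarrow>
     (\<forall>y\<in>A. \<forall>w\<in>fibre V x. k y w \<in> fibre V y \<and> l (k y w) = w) \<and>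
     (\<forall>y\<in>A. \<forall>v\<in>fibre V y. l v \<in> fibre V x \<and> k y (l v) = v) \<and>
     (\<forall>y\<in>A. \<forall>v\<in>fibre V y. \<forall>w\<in>fibre V y. l (fadd V v w) = fadd V (l v) (l w)) \<and>
     (\<forall>y\<in>A. \<forall>v\<in>fibre V y. \<forall>r. l (fscale V r v) = fscale V r (l v)) \<and>
     (\<forall>n U p a. plot (base_space V) n U p \<longrightarrow> (\<forall>u\<in>U. p u \<in> A) \<longrightarrow> plot (total_space V) n U a \<longrightarrow>
        (\<forall>u\<in>U. a u \<in> fibre V x) \<longrightarrow> plot (total_space V) n U (\<lambda>u. k (p u) (a u))) \<and>
     (\<forall>n U a. plot (total_space V) n U a \<longrightarrow> (\<forall>u\<in>U. bproj V (a u) \<in> A) \<longrightarrow>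
        plot (total_space V) n U (\<lambda>u. l (a u)))"

lemma bundle_iso_product_trivialization:
  assumes V: "vector_pseudo_bundle V" and A: "A \<subseteq> points (base_space V)"
    and h: "bundle_iso (restrict_bundle V A) (product_bundle V A x) h"
  shows "\<exists>k l. trivialization V A x k l"
proof -
  let ?E = "subD (total_space V) {v. bproj V v \<in> A}"
  let ?F = "prodD (subD (base_space V) A) (subD (total_space V) (fibre V x))"
  define k where "k y w = inv_into (points ?E) h (y, w)" for y w
  have pE: "points ?E = {v \<in> points (total_space V). bproj V v \<in> A}" by (auto simp: subD_def)
  have pF: "points ?F = A \<times> fibre V x" using A by (auto simp: subD_def prodD_def fibre_def)
  have fibE: "fibre (restrict_bundle V A) y = fibre V y" if "y \<in> A" for y
    using that by (auto simp: fibre_def restrict_bundle_def subD_def)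
  have selE: "total_space (restrict_bundle V A) = ?E" "fadd (restrict_bundle V A) = fadd V"
    "fscale (restrict_bundle V A) = fscale V" "bproj (restrict_bundle V A) = bproj V"
    "points (base_space (restrict_bundle V A)) = A"
    using A by (auto simp: restrict_bundle_def subD_def)
  have selF: "total_space (product_bundle V A x) = ?F" "bproj (product_bundle V A x) = fst"
    "fadd (product_bundle V A x) = (\<lambda>(a, v) (b, w). (a, fadd V v w))"
    "fscale (product_bundle V A x) = (\<lambda>r (a, v). (a, fscale V r v))"
    by (simp_all add: product_bundle_def)
  note iso = h[unfolded bundle_iso_def selE selF]
  have bij: "bij_betw h (points ?E) (A \<times> fibre V x)" using iso pF by simp
  have h_sm: "dsmooth ?E ?F h" and k_sm: "dsmooth ?F ?E (inv_into (points ?E) h)" using iso by blast+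
  have hE: "h v = (y, snd (h v)) \<and> snd (h v) \<in> fibre V x" if "y \<in> A" "v \<in> fibre V y" for y v
  proof -
    have v: "v \<in> points ?E" "bproj V v = y" using that by (auto simp: pE fibre_def)
    then have "fst (h v) = y" using iso by auto
    moreover have "h v \<in> A \<times> fibre V x" using bij_betwE[OF bij] v(1) by blast
    ultimately show ?thesis by (auto simp: prod_eq_iff mem_Times_iff)
  qed
  have kE: "k y w \<in> points ?E \<and> h (k y w) = (y, w) \<and> k y w \<in> fibre V y" if "y \<in> A" "w \<in> fibre V x" for y w
  proof -
    have yw: "(y, w) \<in> A \<times> fibre V x" using that by simp
    have 1: "k y w \<in> points ?E" unfolding k_def using bij_betwE[OF bij_betw_inv_into[OF bij]] yw by blast
    have 2: "h (k y w) = (y, w)" unfolding k_def by (rule bij_betw_inv_into_right[OF bij yw])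
    have "bproj V (k y w) = y" using iso 1 2 by fastforce
    then show ?thesis using 1 2 by (auto simp: fibre_def pE)
  qed
  have "trivialization V A x k (\<lambda>v. snd (h v))"
    unfolding trivialization_def
  proof (intro conjI ballI allI impI)
    show "k y w \<in> fibre V y" "snd (h (k y w)) = w" if "y \<in> A" "w \<in> fibre V x" for y w
      using kE[OF that] by simp_all
    show "snd (h v) \<in> fibre V x" if "y \<in> A" "v \<in> fibre V y" for y v using hE[OF that] by blast
    show "k y (snd (h v)) = v" if "y \<in> A" "v \<in> fibre V y" for y v
    proof -
      have "v \<in> points ?E" using that by (auto simp: pE fibre_def)
      then have "inv_into (points ?E) h (h v) = v" by (rule bij_betw_inv_into_left[OF bij])
      then show ?thesis unfolding k_def using hE[OF that] by simp
    qed
    show "snd (h (fadd V v w)) = fadd V (snd (h v)) (snd (h w))" if "y \<in> A" "v \<in> fibre V y" "w \<in> fibre V y" for y v w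
    proof -
      have "h (fadd V v w) = (\<lambda>(a, v) (b, w). (a, fadd V v w)) (h v) (h w)"
        using iso that fibE[OF that(1)] by blast
      then show ?thesis by (simp add: split_beta)
    qed
    show "snd (h (fscale V r v)) = fscale V r (snd (h v))" if "y \<in> A" "v \<in> fibre V y" for y v r
    proof -
      have "v \<in> points ?E" using that by (auto simp: pE fibre_def)
      then have "h (fscale V r v) = (\<lambda>(a, v). (a, fscale V r v)) (h v)" using iso by blast
      then show ?thesis by (simp add: split_beta)
    qed
    show "plot (total_space V) n U (\<lambda>u. k (p u) (a u))"
      if "plot (base_space V) n U p" "\<forall>u\<in>U. p u \<in> A" "plot (total_space V) n U a"
        "\<forall>u\<in>U. a u \<in> fibre V x" for n U p a
    proof -
      have "plot ?F n U (\<lambda>u. (p u, a u))"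
        using that by (simp add: prodD_def subD_def comp_def image_subset_iff)
      then have "plot ?E n U (inv_into (points ?E) h \<circ> (\<lambda>u. (p u, a u)))"
        using k_sm unfolding dsmooth_def by blast
      then show ?thesis by (simp add: subD_def k_def comp_def)
    qed
    show "plot (total_space V) n U (\<lambda>u. snd (h (a u)))"
      if "plot (total_space V) n U a" "\<forall>u\<in>U. bproj V (a u) \<in> A" for n U a
    proof -
      have "plot ?E n U a" using that by (simp add: subD_def image_subset_iff)
      then have "plot ?F n U (h \<circ> a)" using h_sm unfolding dsmooth_def by blast
      then show ?thesis by (simp add: prodD_def subD_def comp_def)
    qed
  qed
  then show ?thesis by blast
qed

lemma trivializationD:
  assumes "trivialization V A x k l"
  shows "\<And>y w. y \<in> A \<Longrightarrow> w \<in> fibre V x \<Longrightarrow> k y w \<in> fibre V y" "\<And>y w. y \<in> A \<Longrightarrow> w \<in> fibre V x \<Longrightarrow> l (k y w) = w"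
    "\<And>y v. y \<in> A \<Longrightarrow> v \<in> fibre V y \<Longrightarrow> l v \<in> fibre V x" "\<And>y v. y \<in> A \<Longrightarrow> v \<in> fibre V y \<Longrightarrow> k y (l v) = v"
    "\<And>y v w. y \<in> A \<Longrightarrow> v \<in> fibre V y \<Longrightarrow> w \<in> fibre V y \<Longrightarrow> l (fadd V v w) = fadd V (l v) (l w)"
    "\<And>y v r. y \<in> A \<Longrightarrow> v \<in> fibre V y \<Longrightarrow> l (fscale V r v) = fscale V r (l v)"
    "\<And>n U p a. plot (base_space V) n U p \<Longrightarrow> (\<And>u. u \<in> U \<Longrightarrow> p u \<in> A) \<Longrightarrow> plot (total_space V) n U a \<Longrightarrow>
      (\<And>u. u \<in> U \<Longrightarrow> a u \<in> fibre V x) \<Longrightarrow> plot (total_space V) n U (\<lambda>u. k (p u) (a u))"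
    "\<And>n U a. plot (total_space V) n U a \<Longrightarrow> (\<And>u. u \<in> U \<Longrightarrow> bproj V (a u) \<in> A) \<Longrightarrow> plot (total_space V) n U (\<lambda>u. l (a u))"
  using assms unfolding trivialization_def by simp_all

text \<open>
  The linear diffeomorphisms between the fibres act on smooth functionals by composition, so
  the smooth dual of a fibre does not change along \<open>A\<close>.
\<close>

lemma trivialization_smooth_dual:
  assumes V: "vector_pseudo_bundle V" and AX: "A \<subseteq> points (base_space V)" and x: "x \<in> points (base_space V)"
    and triv: "trivialization V A x k l"
  shows "y \<in> A \<Longrightarrow> \<psi> \<in> smooth_dual V x \<Longrightarrow> (\<lambda>v. if v \<in> fibre V y then \<psi> (l v) else 0) \<in> smooth_dual V y"
    and "y \<in> A \<Longrightarrow> \<phi> \<in> smooth_dual V y \<Longrightarrow> (\<lambda>w. if w \<in> fibre V x then \<phi> (k y w) else 0) \<in> smooth_dual V x"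
proof -
  note D = vector_pseudo_bundle_plots(1,2)[OF V]
  note T = trivializationD[OF triv]
  have k_add: "k y (fadd V v w) = fadd V (k y v) (k y w)" if "y \<in> A" "v \<in> fibre V x" "w \<in> fibre V x" for y v w
  proof -
    have y: "y \<in> points (base_space V)" using that AX by blast
    have "l (fadd V (k y v) (k y w)) = fadd V v w" using T(1,2,5)[OF that(1)] that(2,3) by simp
    then show ?thesis using T(4)[OF that(1) fibre_closed(2)[OF V y T(1)[OF that(1,2)] T(1)[OF that(1,3)]]] by simp
  qed
  have k_scale: "k y (fscale V r v) = fscale V r (k y v)" if "y \<in> A" "v \<in> fibre V x" for y v r
  proof -
    have y: "y \<in> points (base_space V)" using that AX by blast
    have "l (fscale V r (k y v)) = fscale V r v" using T(1,2,6)[OF that(1)] that(2) by simp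
    then show ?thesis using T(4)[OF that(1) fibre_closed(3)[OF V y T(1)[OF that], of r]] by simp
  qed
  show "(\<lambda>v. if v \<in> fibre V y then \<psi> (l v) else 0) \<in> smooth_dual V y"
    if y: "y \<in> A" and \<psi>: "\<psi> \<in> smooth_dual V x"
  proof (rule smooth_dualI[OF D(1)])
    have yX: "y \<in> points (base_space V)" using y AX by blast
    show "(if fadd V v w \<in> fibre V y then \<psi> (l (fadd V v w)) else 0) =
        (if v \<in> fibre V y then \<psi> (l v) else 0) + (if w \<in> fibre V y then \<psi> (l w) else 0)"
      if "v \<in> fibre V y" "w \<in> fibre V y" for v w
      using that fibre_closed[OF V yX] T(3,5)[OF y] smooth_dualD(1)[OF \<psi>] by simp
    show "(if fscale V r v \<in> fibre V y then \<psi> (l (fscale V r v)) else 0) = r * (if v \<in> fibre V y then \<psi> (l v) else 0)"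
      if "v \<in> fibre V y" for v r
      using that fibre_closed[OF V yX] T(3,6)[OF y] smooth_dualD(2)[OF \<psi>] by simp
    fix m W a assume a: "plot (total_space V) m W a" "\<And>w. w \<in> W \<Longrightarrow> a w \<in> fibre V y"
    have "plot (total_space V) m W (\<lambda>w. l (a w))" using a(2) y by (intro T(8)[OF a(1)]) (simp add: fibre_def)
    then have "smooth_fun m W (\<lambda>w. \<psi> (l (a w)))" by (rule smooth_dualD(4)[OF \<psi>]) (rule T(3)[OF y a(2)])
    then show "smooth_fun m W (\<lambda>w. if a w \<in> fibre V y then \<psi> (l (a w)) else 0)"
      by (rule smooth_fun_cong[OF plot_open[OF D(1) a(1)], rotated]) (simp add: a(2))
  qed simp
  show "(\<lambda>w. if w \<in> fibre V x then \<phi> (k y w) else 0) \<in> smooth_dual V x"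
    if y: "y \<in> A" and \<phi>: "\<phi> \<in> smooth_dual V y"
  proof (rule smooth_dualI[OF D(1)])
    have yX: "y \<in> points (base_space V)" using y AX by blast
    show "(if fadd V v w \<in> fibre V x then \<phi> (k y (fadd V v w)) else 0) =
        (if v \<in> fibre V x then \<phi> (k y v) else 0) + (if w \<in> fibre V x then \<phi> (k y w) else 0)"
      if "v \<in> fibre V x" "w \<in> fibre V x" for v w
      using that fibre_closed[OF V x] T(1)[OF y] k_add[OF y] smooth_dualD(1)[OF \<phi>] by simp
    show "(if fscale V r v \<in> fibre V x then \<phi> (k y (fscale V r v)) else 0) = r * (if v \<in> fibre V x then \<phi> (k y v) else 0)"
      if "v \<in> fibre V x" for v r
      using that fibre_closed[OF V x] T(1)[OF y] k_scale[OF y] smooth_dualD(2)[OF \<phi>] by simp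
    fix m W a assume a: "plot (total_space V) m W a" "\<And>w. w \<in> W \<Longrightarrow> a w \<in> fibre V x"
    have "plot (total_space V) m W (\<lambda>w. k y (a w))"
      by (rule T(7)[OF plot_const[OF D(2) plot_open[OF D(1) a(1)] yX] y a])
    then have "smooth_fun m W (\<lambda>w. \<phi> (k y (a w)))" by (rule smooth_dualD(4)[OF \<phi>]) (rule T(1)[OF y a(2)])
    then show "smooth_fun m W (\<lambda>w. if a w \<in> fibre V x then \<phi> (k y (a w)) else 0)"
      by (rule smooth_fun_cong[OF plot_open[OF D(1) a(1)], rotated]) (simp add: a(2))
  qed simp
qed

text \<open>
  A separating independent family at the single point \<open>p u0\<close> is spread over the
  trivialized neighbourhood as constant sections.  Both properties speak only of smooth
  functionals, which the trivialization transports, so they persist at every \<open>u\<close> and no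
  further shrinking of the neighbourhood is necessary.
\<close>

lemma local_separating_sections:
  assumes V: "finite_dim_pseudo_bundle V" and triv: "locally_trivial V"
    and p: "plot (base_space V) n U p" and u0: "u0 \<in> U"
  obtains W and m :: nat and c where "u0 \<in> W" "W \<subseteq> U" "plot (base_space V) n W p"
    and "\<And>i. i < m \<Longrightarrow> plot (total_space V) n W (c i)" "\<And>i u. i < m \<Longrightarrow> u \<in> W \<Longrightarrow> c i u \<in> fibre V (p u)"
    and "\<And>u \<phi>. u \<in> W \<Longrightarrow> \<phi> \<in> smooth_dual V (p u) \<Longrightarrow> (\<And>i. i < m \<Longrightarrow> \<phi> (c i u) = 0) \<Longrightarrow> \<phi> = (\<lambda>v. 0)"
    and "\<And>u k. u \<in> W \<Longrightarrow> k < m \<Longrightarrow> \<exists>\<phi>\<in>smooth_dual V (p u). (\<forall>i<k. \<phi> (c i u) = 0) \<and> \<phi> (c k u) \<noteq> 0"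
proof -
  have V': "vector_pseudo_bundle V" using V by (simp add: finite_dim_pseudo_bundle_def)
  note D = vector_pseudo_bundle_plots(1,2)[OF V']
  define x where "x = p u0"
  have x: "x \<in> points (base_space V)" unfolding x_def by (rule plot_points[OF D(2) p u0])
  obtain A h where xA: "x \<in> A" and A: "D_open (base_space V) A"
    and h: "bundle_iso (restrict_bundle V A) (product_bundle V A x) h"
    using triv x unfolding locally_trivial_def by blast
  have AX: "A \<subseteq> points (base_space V)" using A by (simp add: D_open_def)
  obtain k l where kl: "trivialization V A x k l" using bundle_iso_product_trivialization[OF V' AX h] by blast
  note triv_kl = trivializationD[OF kl] and transport = trivialization_smooth_dual[OF V' AX x kl]
  obtain m :: nat and b where b: "\<And>i. i < m \<Longrightarrow> b i \<in> fibre V x"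
    and sep: "\<And>\<phi>. \<phi> \<in> smooth_dual V x \<Longrightarrow> (\<And>i. i < m \<Longrightarrow> \<phi> (b i) = 0) \<Longrightarrow> \<phi> = (\<lambda>v. 0)"
    and ind: "\<And>k. k < m \<Longrightarrow> \<exists>\<phi>\<in>smooth_dual V x. (\<forall>i<k. \<phi> (b i) = 0) \<and> \<phi> (b k) \<noteq> 0"
    by (rule separating_independent_family[OF V x]) blast
  define W where "W = {u \<in> U. p u \<in> A}"
  have W: "openin (Euclidean_space n) W" using A p by (simp add: W_def D_open_def)
  have pW: "plot (base_space V) n W p" by (rule plot_subset[OF D(2) p W]) (auto simp: W_def)
  have pA: "p u \<in> A" if "u \<in> W" for u using that by (simp add: W_def)
  show thesis
  proof (rule that[of W m "\<lambda>i u. k (p u) (b i)"])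
    show "u0 \<in> W" using u0 xA by (simp add: W_def x_def)
    show "W \<subseteq> U" by (auto simp: W_def)
    show "plot (base_space V) n W p" by fact
    show "plot (total_space V) n W (\<lambda>u. k (p u) (b i))" if "i < m" for i
    proof (rule triv_kl(7)[OF pW pA])
      have "b i \<in> points (total_space V)" using b[OF that] by (simp add: fibre_def)
      then show "plot (total_space V) n W (\<lambda>u. b i)" by (rule plot_const[OF D(1) W])
    qed (use b[OF that] in simp_all)
    show "k (p u) (b i) \<in> fibre V (p u)" if "i < m" "u \<in> W" for i u
      by (rule triv_kl(1)[OF pA[OF that(2)] b[OF that(1)]])
    show "\<phi> = (\<lambda>v. 0)" if u: "u \<in> W" and \<phi>: "\<phi> \<in> smooth_dual V (p u)"
      and z: "\<And>i. i < m \<Longrightarrow> \<phi> (k (p u) (b i)) = 0" for u \<phi>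
    proof -
      have "(\<lambda>w. if w \<in> fibre V x then \<phi> (k (p u) w) else 0) = (\<lambda>v. 0)"
        by (rule sep[OF transport(2)[OF pA[OF u] \<phi>]]) (simp add: z)
      then have "\<phi> (k (p u) w) = 0" if "w \<in> fibre V x" for w using that by (metis (mono_tags))
      then have "\<phi> v = 0" if "v \<in> fibre V (p u)" for v
        using triv_kl(3,4)[OF pA[OF u] that] by metis
      then show ?thesis using smooth_dualD(3)[OF \<phi>] by blast
    qed
    show "\<exists>\<phi>\<in>smooth_dual V (p u). (\<forall>i<j. \<phi> (k (p u) (b i)) = 0) \<and> \<phi> (k (p u) (b j)) \<noteq> 0"
      if u: "u \<in> W" and j: "j < m" for u j
    proof -
      obtain \<psi> where \<psi>: "\<psi> \<in> smooth_dual V x" "\<forall>i<j. \<psi> (b i) = 0" "\<psi> (b j) \<noteq> 0" using ind[OF j] by blast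
      show ?thesis
        by (rule bexI[OF _ transport(1)[OF pA[OF u] \<psi>(1)]]) (use \<psi>(2,3) j b triv_kl(1,2)[OF pA[OF u]] in auto)
    qed
  qed
qed

section \<open>Gram-Schmidt orthogonalization of plots\<close>

definition orthogonal_plots ::
  "('v, 'x) pbundle \<Rightarrow> ('x \<Rightarrow> 'v \<Rightarrow> 'v \<Rightarrow> real) \<Rightarrow> nat \<Rightarrow> (nat \<Rightarrow> real) set \<Rightarrow> ((nat \<Rightarrow> real) \<Rightarrow> 'x) \<Rightarrow>
    nat \<Rightarrow> (nat \<Rightarrow> (nat \<Rightarrow> real) \<Rightarrow> 'v) \<Rightarrow> bool" where
  "orthogonal_plots V g n W p m e \<longleftrightarrow>
     (\<forall>j<m. plot (total_space V) n W (e j)) \<and> (\<forall>j<m. \<forall>u\<in>W. e j u \<in> fibre V (p u)) \<and>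
     (\<forall>i<m. \<forall>j<m. \<forall>u\<in>W. i \<noteq> j \<longrightarrow> g (p u) (e i u) (e j u) = 0) \<and>
     (\<forall>j<m. \<forall>u\<in>W. g (p u) (e j u) (e j u) \<noteq> 0)"

lemma orthogonal_plotsD:
  assumes "orthogonal_plots V g n W p m e"
  shows "\<And>j. j < m \<Longrightarrow> plot (total_space V) n W (e j)" "\<And>j u. j < m \<Longrightarrow> u \<in> W \<Longrightarrow> e j u \<in> fibre V (p u)"
    and "\<And>i j u. i < m \<Longrightarrow> j < m \<Longrightarrow> i \<noteq> j \<Longrightarrow> u \<in> W \<Longrightarrow> g (p u) (e i u) (e j u) = 0"
    and "\<And>j u. j < m \<Longrightarrow> u \<in> W \<Longrightarrow> g (p u) (e j u) (e j u) \<noteq> 0"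
  using assms unfolding orthogonal_plots_def by simp_all

text \<open>
  The orthogonal projections are subtracted one at a time, so that only the fibrewise addition
  of two plots is used.  The last clause says that \<open>w\<close> differs from \<open>c\<close> by a combination
  of the \<open>e j\<close>, in the only form in which this is needed.
\<close>

lemma plot_remove_projections:
  assumes g: "pseudo_metric V g" and p: "plot (base_space V) n W p"
    and orthogonal: "orthogonal_plots V g n W p m e"
    and c: "plot (total_space V) n W c" "\<And>u. u \<in> W \<Longrightarrow> c u \<in> fibre V (p u)"
  shows "\<exists>w. plot (total_space V) n W w \<and> (\<forall>u\<in>W. w u \<in> fibre V (p u)) \<and>
      (\<forall>j<m. \<forall>u\<in>W. g (p u) (w u) (e j u) = 0) \<and>
      (\<forall>u\<in>W. \<forall>\<phi>\<in>smooth_dual V (p u). (\<forall>j<m. \<phi> (e j u) = 0) \<longrightarrow> \<phi> (w u) = \<phi> (c u))"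
proof -
  note V = pseudo_metricD(1)[OF g]
  note D = vector_pseudo_bundle_plots(1,2)[OF V]
  note W = plot_open[OF D(2) p]
  note e = orthogonal_plotsD(1,2)[OF orthogonal] and orth = orthogonal_plotsD(3)[OF orthogonal]
    and norm = orthogonal_plotsD(4)[OF orthogonal]
  have "\<exists>w. plot (total_space V) n W w \<and> (\<forall>u\<in>W. w u \<in> fibre V (p u)) \<and>
      (\<forall>j<k. \<forall>u\<in>W. g (p u) (w u) (e j u) = 0) \<and>
      (\<forall>u\<in>W. \<forall>\<phi>\<in>smooth_dual V (p u). (\<forall>j<k. \<phi> (e j u) = 0) \<longrightarrow> \<phi> (w u) = \<phi> (c u))" if "k \<le> m" for k
    using that
  proof (induction k)
    case 0 then show ?case using c by auto
  next
    case (Suc k)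
    then obtain w where w: "plot (total_space V) n W w" "\<And>u. u \<in> W \<Longrightarrow> w u \<in> fibre V (p u)"
      "\<And>j u. j < k \<Longrightarrow> u \<in> W \<Longrightarrow> g (p u) (w u) (e j u) = 0"
      "\<And>u \<phi>. u \<in> W \<Longrightarrow> \<phi> \<in> smooth_dual V (p u) \<Longrightarrow> \<forall>j<k. \<phi> (e j u) = 0 \<Longrightarrow> \<phi> (w u) = \<phi> (c u)"
      by auto
    have k: "k < m" using Suc.prems by simp
    \<comment> \<open>the coefficient of the projection to \<open>e k u\<close>, smooth because the square is nonzero\<close>
    define r where "r u = (- 1 * g (p u) (w u) (e k u)) * inverse (g (p u) (e k u) (e k u))" for u
    have bp: "bproj V (w u) = p u" "bproj V (e k u) = p u" if "u \<in> W" for u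
      using w(2)[OF that] e(2)[OF k that] by (simp_all add: fibre_def)
    have r: "smooth_fun n W r"
      unfolding r_def
      by (intro smooth_fun_mult smooth_fun_inverse smooth_fun_const W norm[OF k]
          smooth_section_evaluation[OF V pseudo_metricD(2)[OF g]] w(1) e(1)[OF k] bp)
    define w' where "w' u = fadd V (w u) (fscale V (r u) (e k u))" for u
    have sc: "plot (total_space V) n W (\<lambda>u. fscale V (r u) (e k u))"
      by (rule vector_pseudo_bundle_plots(5)[OF V r e(1)[OF k]])
    have x: "p u \<in> points (base_space V)" if "u \<in> W" for u by (rule plot_points[OF D(2) p that])
    have scf: "fscale V (r u) (e k u) \<in> fibre V (p u)" if "u \<in> W" for u
      by (rule fibre_closed(3)[OF V x[OF that] e(2)[OF k that]])
    have "plot (total_space V) n W w'"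
      unfolding w'_def
      by (rule vector_pseudo_bundle_plots(4)[OF V w(1) sc]) (use w(2) scf in \<open>simp add: fibre_def\<close>)
    moreover have "w' u \<in> fibre V (p u)" if "u \<in> W" for u
      unfolding w'_def by (rule fibre_closed(2)[OF V x[OF that] w(2)[OF that] scf[OF that]])
    moreover have "g (p u) (w' u) (e j u) = 0" if j: "j < Suc k" and u: "u \<in> W" for j u
    proof -
      have "g (p u) (w' u) (e j u) = g (p u) (w u) (e j u) + r u * g (p u) (e k u) (e j u)"
        using pseudo_metric_linear(2,3)[OF g x[OF u]] w(2)[OF u] e(2)[OF k u] scf[OF u] by (simp add: w'_def)
      also have "\<dots> = 0"
      proof (cases "j = k")
        case True then show ?thesis using norm[OF k u] by (simp add: r_def)
      next
        case False
        then show ?thesis using j k w(3)[of j u] orth[of k j u] u by simp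
      qed
      finally show ?thesis .
    qed
    moreover have "\<phi> (w' u) = \<phi> (c u)" if u: "u \<in> W" and \<phi>: "\<phi> \<in> smooth_dual V (p u)" "\<forall>j<Suc k. \<phi> (e j u) = 0" for u \<phi>
    proof -
      have "\<phi> (w' u) = \<phi> (w u) + r u * \<phi> (e k u)"
        using smooth_dualD(1,2)[OF \<phi>(1)] w(2)[OF u] e(2)[OF k u] scf[OF u] by (simp add: w'_def)
      then show ?thesis using \<phi> w(4)[OF u \<phi>(1)] by simp
    qed
    ultimately show ?case by (intro exI[of _ w']) blast
  qed
  from this[OF order_refl] show ?thesis .
qed

text \<open>
  The new vector \<open>w\<close> has nonzero square: some smooth functional kills the earlier \<open>c i\<close>,
  hence the earlier \<open>e i\<close>, but not \<open>c m\<close>, hence not \<open>w\<close>.  This functional is \<open>g(a, \<cdot>)\<close>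
  for some \<open>a\<close>, and a null vector \<open>w\<close> would be orthogonal to \<open>a\<close>.
\<close>

lemma plots_orthogonalize:
  assumes g: "pseudo_metric V g" and p: "plot (base_space V) n W p"
    and c: "\<And>j. j < (m::nat) \<Longrightarrow> plot (total_space V) n W (c j)" "\<And>j u. j < m \<Longrightarrow> u \<in> W \<Longrightarrow> c j u \<in> fibre V (p u)"
    and ind: "\<And>u k. u \<in> W \<Longrightarrow> k < m \<Longrightarrow> \<exists>\<phi>\<in>smooth_dual V (p u). (\<forall>i<k. \<phi> (c i u) = 0) \<and> \<phi> (c k u) \<noteq> 0"
  shows "\<exists>e. orthogonal_plots V g n W p m e \<and>
    (\<forall>u\<in>W. \<forall>\<phi>\<in>smooth_dual V (p u). (\<forall>j<m. \<phi> (e j u) = 0) \<longleftrightarrow> (\<forall>j<m. \<phi> (c j u) = 0))"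
  using c ind
proof (induction m)
  case 0 then show ?case by (simp add: orthogonal_plots_def)
next
  case (Suc m)
  have "\<exists>e. orthogonal_plots V g n W p m e \<and>
    (\<forall>u\<in>W. \<forall>\<phi>\<in>smooth_dual V (p u). (\<forall>j<m. \<phi> (e j u) = 0) \<longleftrightarrow> (\<forall>j<m. \<phi> (c j u) = 0))"
    by (rule Suc.IH) (simp_all add: Suc.prems)
  then obtain e where oe: "orthogonal_plots V g n W p m e"
    and iff: "\<And>u \<phi>. u \<in> W \<Longrightarrow> \<phi> \<in> smooth_dual V (p u) \<Longrightarrow> (\<forall>j<m. \<phi> (e j u) = 0) \<longleftrightarrow> (\<forall>j<m. \<phi> (c j u) = 0)"
    by blast
  note e = orthogonal_plotsD[OF oe]
  obtain w where w: "plot (total_space V) n W w" "\<And>u. u \<in> W \<Longrightarrow> w u \<in> fibre V (p u)"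
    "\<And>j u. j < m \<Longrightarrow> u \<in> W \<Longrightarrow> g (p u) (w u) (e j u) = 0"
    "\<And>u \<phi>. u \<in> W \<Longrightarrow> \<phi> \<in> smooth_dual V (p u) \<Longrightarrow> \<forall>j<m. \<phi> (e j u) = 0 \<Longrightarrow> \<phi> (w u) = \<phi> (c m u)"
    using plot_remove_projections[where c = "c m", OF g p oe Suc.prems(1,2)[OF lessI]] by blast
  have x: "p u \<in> points (base_space V)" if "u \<in> W" for u
    by (rule plot_points[OF vector_pseudo_bundle_plots(2)[OF pseudo_metricD(1)[OF g]] p that])
  have sym: "g (p u) (e j u) (w u) = 0" if "j < m" "u \<in> W" for j u
    using w(3)[OF that] pseudo_metricD(4)[OF g x[OF that(2)] w(2)[OF that(2)] e(2)[OF that]] by simp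
  have norm: "g (p u) (w u) (w u) \<noteq> 0" if u: "u \<in> W" for u
  proof
    assume null: "g (p u) (w u) (w u) = 0"
    obtain \<phi> where \<phi>: "\<phi> \<in> smooth_dual V (p u)" "\<forall>i<m. \<phi> (c i u) = 0" "\<phi> (c m u) \<noteq> 0"
      using Suc.prems(3)[OF u lessI] by blast
    have "\<phi> (w u) \<noteq> 0" using w(4)[OF u \<phi>(1)] iff[OF u \<phi>(1)] \<phi>(2,3) by simp
    moreover obtain a where a: "a \<in> fibre V (p u)" "\<phi> = g (p u) a"
      using pseudo_metric_onto_smooth_dual[OF g x[OF u]] \<phi>(1) by blast
    moreover have "g (p u) a (w u) = 0"
      using pseudo_metric_null[OF g x[OF u] w(2)[OF u] a(1) null] pseudo_metricD(4)[OF g x[OF u] w(2)[OF u] a(1)] by simp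
    ultimately show False by simp
  qed
  define e' where "e' = e(m := w)"
  have e'_simps: "e' m = w" "j < m \<Longrightarrow> e' j = e j" for j by (auto simp: e'_def)
  show ?case
    unfolding orthogonal_plots_def
  proof (intro exI[of _ e'] conjI allI impI ballI)
    show "plot (total_space V) n W (e' j)" if "j < Suc m" for j
      using that e(1) w(1) by (cases "j = m") (simp_all add: e'_simps)
    show "e' j u \<in> fibre V (p u)" if "j < Suc m" "u \<in> W" for j u
      using that e(2) w(2) by (cases "j = m") (simp_all add: e'_simps)
    show "g (p u) (e' i u) (e' j u) = 0" if "i < Suc m" "j < Suc m" "u \<in> W" "i \<noteq> j" for i j u
      using that e(3) w(3) sym by (cases "i = m"; cases "j = m") (simp_all add: e'_simps)
    show "g (p u) (e' j u) (e' j u) \<noteq> 0" if "j < Suc m" "u \<in> W" for j u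
      using that e(4) norm by (cases "j = m") (simp_all add: e'_simps)
    show "(\<forall>j<Suc m. \<phi> (e' j u) = 0) \<longleftrightarrow> (\<forall>j<Suc m. \<phi> (c j u) = 0)"
      if u: "u \<in> W" and \<phi>: "\<phi> \<in> smooth_dual V (p u)" for u \<phi>
      using iff[OF u \<phi>] w(4)[OF u \<phi>] by (auto simp: e'_simps less_Suc_eq all_conj_distrib)
  qed
qed

text \<open>
  The vectors \<open>e i\<close> and \<open>f i\<close> are bases, dual to each other under \<open>g\<close>, of the quotient of
  the fibre by the null space of \<open>g\<close>; the last clause is the basis expansion in the
  smooth dual.
\<close>

definition dual_frame ::
  "('v, 'x) pbundle \<Rightarrow> ('x \<Rightarrow> 'v \<Rightarrow> 'v \<Rightarrow> real) \<Rightarrow> 'x \<Rightarrow> nat \<Rightarrow> (nat \<Rightarrow> 'v) \<Rightarrow> (nat \<Rightarrow> 'v) \<Rightarrow> bool" where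
  "dual_frame V g x m e f \<longleftrightarrow> (\<forall>i<m. e i \<in> fibre V x \<and> f i \<in> fibre V x) \<and>
     (\<forall>i<m. \<forall>j<m. g x (e i) (f j) = (if i = j then 1 else 0)) \<and>
     (\<forall>\<phi>\<in>smooth_dual V x. \<phi> = (\<lambda>v. \<Sum>i<m. \<phi> (e i) * g x (f i) v))"

lemma dual_frameD:
  assumes "dual_frame V g x m e f"
  shows "\<And>i. i < m \<Longrightarrow> e i \<in> fibre V x" "\<And>i. i < m \<Longrightarrow> f i \<in> fibre V x"
    and "\<And>i j. i < m \<Longrightarrow> j < m \<Longrightarrow> g x (e i) (f j) = (if i = j then 1 else 0)"
    and "\<And>\<phi>. \<phi> \<in> smooth_dual V x \<Longrightarrow> \<phi> = (\<lambda>v. \<Sum>i<m. \<phi> (e i) * g x (f i) v)"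
  using assms unfolding dual_frame_def by blast+

text \<open>
  The difference of \<open>\<phi>\<close> and its expansion vanishes on the orthogonalized sections, hence on
  the original ones, and these separate the smooth functionals.
\<close>

lemma local_dual_frame:
  assumes triv: "locally_trivial V" and g: "pseudo_metric V g"
    and p: "plot (base_space V) n U p" and u0: "u0 \<in> U"
  shows "\<exists>W m e f. u0 \<in> W \<and> W \<subseteq> U \<and> plot (base_space V) n W p \<and>
    (\<forall>i<m. plot (total_space V) n W (e i) \<and> plot (total_space V) n W (f i)) \<and>
    (\<forall>u\<in>W. dual_frame V g (p u) m (\<lambda>i. e i u) (\<lambda>i. f i u))"
proof -
  note V = pseudo_metricD(1)[OF g]
  note D = vector_pseudo_bundle_plots(1,2)[OF V]
  have fd: "finite_dim_pseudo_bundle V" using g by (simp add: pseudo_metric_def)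
  obtain W and m :: nat and c where W: "u0 \<in> W" "W \<subseteq> U" "plot (base_space V) n W p"
    and c: "\<And>i. i < m \<Longrightarrow> plot (total_space V) n W (c i)" "\<And>i u. i < m \<Longrightarrow> u \<in> W \<Longrightarrow> c i u \<in> fibre V (p u)"
    and sep: "\<And>u \<phi>. u \<in> W \<Longrightarrow> \<phi> \<in> smooth_dual V (p u) \<Longrightarrow> (\<And>i. i < m \<Longrightarrow> \<phi> (c i u) = 0) \<Longrightarrow> \<phi> = (\<lambda>v. 0)"
    and ind: "\<And>u k. u \<in> W \<Longrightarrow> k < m \<Longrightarrow> \<exists>\<phi>\<in>smooth_dual V (p u). (\<forall>i<k. \<phi> (c i u) = 0) \<and> \<phi> (c k u) \<noteq> 0"
    by (rule local_separating_sections[OF fd triv p u0]) blast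
  have "\<exists>e. orthogonal_plots V g n W p m e \<and>
    (\<forall>u\<in>W. \<forall>\<phi>\<in>smooth_dual V (p u). (\<forall>j<m. \<phi> (e j u) = 0) \<longleftrightarrow> (\<forall>j<m. \<phi> (c j u) = 0))"
    by (rule plots_orthogonalize[OF g W(3) c ind])
  then obtain e where oe: "orthogonal_plots V g n W p m e"
    and iff: "\<And>u \<phi>. u \<in> W \<Longrightarrow> \<phi> \<in> smooth_dual V (p u) \<Longrightarrow> (\<forall>j<m. \<phi> (e j u) = 0) \<longleftrightarrow> (\<forall>j<m. \<phi> (c j u) = 0)"
    by blast
  note e = orthogonal_plotsD[OF oe]
  have x: "p u \<in> points (base_space V)" if "u \<in> W" for u by (rule plot_points[OF D(2) W(3) that])
  have bp: "bproj V (e i u) = p u" if "i < m" "u \<in> W" for i u using e(2)[OF that] by (simp add: fibre_def)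
  define f where "f i u = fscale V (inverse (g (p u) (e i u) (e i u))) (e i u)" for i u
  have f_plot: "plot (total_space V) n W (f i)" if i: "i < m" for i
  proof -
    have "smooth_fun n W (\<lambda>u. inverse (g (p u) (e i u) (e i u)))"
      by (intro smooth_fun_inverse plot_open[OF D(2) W(3)] e(4)[OF i]
          smooth_section_evaluation[OF V pseudo_metricD(2)[OF g]] e(1)[OF i] bp[OF i])
    then have "plot (total_space V) n W (\<lambda>u. fscale V (inverse (g (p u) (e i u) (e i u))) (e i u))"
      by (rule vector_pseudo_bundle_plots(5)[OF V _ e(1)[OF i]])
    then show ?thesis by (simp add: f_def[abs_def])
  qed
  have f_fib: "f i u \<in> fibre V (p u)" if "i < m" "u \<in> W" for i u
    unfolding f_def by (rule fibre_closed(3)[OF V x[OF that(2)] e(2)[OF that]])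
  have dual: "g (p u) (e i u) (f j u) = (if i = j then 1 else 0)" if "i < m" "j < m" "u \<in> W" for i j u
    using pseudo_metric_linear(6)[OF g x[OF that(3)] e(2)[OF that(2,3)]] e(3)[OF that(1,2) _ that(3)] e(4)[OF that(2,3)]
    by (simp add: f_def)
  have expand: "\<phi> = (\<lambda>v. \<Sum>i<m. \<phi> (e i u) * g (p u) (f i u) v)" if u: "u \<in> W" and \<phi>: "\<phi> \<in> smooth_dual V (p u)" for u \<phi>
  proof -
    define \<delta> where "\<delta> = (\<lambda>v. \<phi> v + - 1 * (\<Sum>i<m. \<phi> (e i u) * g (p u) (f i u) v))"
    have \<delta>: "\<delta> \<in> smooth_dual V (p u)"
      unfolding \<delta>_def
      by (intro smooth_dual_subspace(1,2)[OF D(1)] \<phi> smooth_dual_sum[OF D(1)] pseudo_metric_linear(1)[OF g x[OF u]])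
    have "\<delta> (e j u) = 0" if j: "j < m" for j
    proof -
      have "g (p u) (f i u) (e j u) = (if j = i then 1 else 0)" if i: "i < m" for i
        using dual[OF j i u] pseudo_metricD(4)[OF g x[OF u] f_fib[OF i u] e(2)[OF j u]] by simp
      then have "(\<Sum>i<m. \<phi> (e i u) * g (p u) (f i u) (e j u)) = (\<Sum>i<m. if j = i then \<phi> (e i u) else 0)"
        by (intro sum.cong) auto
      then show ?thesis using j by (simp add: \<delta>_def)
    qed
    then have "\<delta> = (\<lambda>v. 0)" using sep[OF u \<delta>] iff[OF u \<delta>] by blast
    then have zero: "\<delta> v = 0" for v by simp
    show ?thesis
    proof
      show "\<phi> v = (\<Sum>i<m. \<phi> (e i u) * g (p u) (f i u) v)" for v
        using zero[of v] by (simp add: \<delta>_def)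
    qed
  qed
  have "dual_frame V g (p u) m (\<lambda>i. e i u) (\<lambda>i. f i u)" if u: "u \<in> W" for u
    unfolding dual_frame_def
  proof (intro conjI allI impI ballI)
    show "e i u \<in> fibre V (p u)" "f i u \<in> fibre V (p u)" if "i < m" for i
      using e(2)[OF that u] f_fib[OF that u] by simp_all
    show "g (p u) (e i u) (f j u) = (if i = j then 1 else 0)" if "i < m" "j < m" for i j
      by (rule dual[OF that u])
    show "\<phi> = (\<lambda>v. \<Sum>i<m. \<phi> (e i u) * g (p u) (f i u) v)" if "\<phi> \<in> smooth_dual V (p u)" for \<phi>
      by (rule expand[OF u that])
  qed
  then show ?thesis
    using W e(1) f_plot by (intro exI[of _ W] exI[of _ m] exI[of _ e] exI[of _ f]) simp
qed

text \<open>
  A point of the base is a constant plot on the one-point space \<open>\<real>\<^sup>0\<close>.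
\<close>

lemma ex_dual_frame:
  assumes triv: "locally_trivial V" and g: "pseudo_metric V g" and x: "x \<in> points (base_space V)"
  shows "\<exists>m e f. dual_frame V g x m e f"
proof -
  let ?U = "topspace (Euclidean_space 0)"
  have u: "(\<lambda>_. 0) \<in> ?U" by (simp add: topspace_Euclidean_space)
  have p: "plot (base_space V) 0 ?U (\<lambda>_. x)"
    by (rule plot_const[OF vector_pseudo_bundle_plots(2)[OF pseudo_metricD(1)[OF g]] openin_topspace x])
  show ?thesis using local_dual_frame[OF triv g p u] by blast
qed

section \<open>The induced form on the dual\<close>

lemma dual_bundle_simps:
  "base_space (dual_bundle V) = base_space V" "bproj (dual_bundle V) = fst"
  "points (total_space (dual_bundle V)) = (SIGMA x:points (base_space V). smooth_dual V x)"
  "plot (total_space (dual_bundle V)) = dual_plot V"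
  "fadd (dual_bundle V) (x, \<phi>) (y, \<psi>) = (x, \<lambda>v. \<phi> v + \<psi> v)"
  "fscale (dual_bundle V) r (x, \<phi>) = (x, \<lambda>v. r * \<phi> v)"
  "fzero (dual_bundle V) x = (x, \<lambda>v. 0)"
  by (simp_all add: dual_bundle_def)

lemma fibre_dual_bundle: "x \<in> points (base_space V) \<Longrightarrow> fibre (dual_bundle V) x = Pair x ` smooth_dual V x"
  by (auto simp: fibre_def dual_bundle_simps)

lemma fibre_dual_bundle_pairing:
  assumes g: "pseudo_metric V g" and x: "x \<in> points (base_space V)"
  shows "fibre (dual_bundle V) x = (\<lambda>v. (x, g x v)) ` fibre V x"
  unfolding fibre_dual_bundle[OF x] pseudo_metric_onto_smooth_dual[OF g x, symmetric] by (simp add: image_image)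

text \<open>
  The pairing is linear and onto, so it maps a finite spanning set of a fibre to one of the
  dual fibre: the preimage of a subspace under the pairing is a subspace.
\<close>

lemma finite_dim_dual_bundle:
  assumes g: "pseudo_metric V g"
  shows "finite_dim_pseudo_bundle (dual_bundle V)"
  unfolding finite_dim_pseudo_bundle_def
proof (intro conjI ballI)
  note V = pseudo_metricD(1)[OF g]
  show V': "vector_pseudo_bundle (dual_bundle V)" by (rule vector_pseudo_bundle_dual[OF V])
  fix x assume "x \<in> points (base_space (dual_bundle V))"
  then have x: "x \<in> points (base_space V)" by (simp add: dual_bundle_simps)
  note lin = pseudo_metric_linear[OF g x]
  obtain B where B: "finite B" "B \<subseteq> fibre V x" "fibre_span V x B = fibre V x"
    using g x unfolding pseudo_metric_def finite_dim_pseudo_bundle_def by blast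
  let ?B = "(\<lambda>v. (x, g x v)) ` B"
  have sub: "?B \<subseteq> fibre (dual_bundle V) x" using lin(1) by (auto simp: fibre_dual_bundle[OF x])
  have "fibre (dual_bundle V) x \<subseteq> S"
    if S: "?B \<subseteq> S" "S \<subseteq> fibre (dual_bundle V) x" "fzero (dual_bundle V) x \<in> S"
      "\<forall>v\<in>S. \<forall>w\<in>S. fadd (dual_bundle V) v w \<in> S" "\<forall>r. \<forall>v\<in>S. fscale (dual_bundle V) r v \<in> S" for S
  proof -
    let ?T = "{v \<in> fibre V x. (x, g x v) \<in> S}"
    have "fadd V v w \<in> ?T" if "v \<in> ?T" "w \<in> ?T" for v w
      using that S(4)[rule_format, of "(x, g x v)" "(x, g x w)"] fibre_closed(2)[OF V x]
      by (simp add: lin(2) dual_bundle_simps)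
    moreover have "fscale V r v \<in> ?T" if "v \<in> ?T" for v r
      using that S(5)[rule_format, of "(x, g x v)" r] fibre_closed(3)[OF V x]
      by (simp add: lin(3) dual_bundle_simps)
    moreover have "fzero V x \<in> ?T" using S(3) fibre_closed(1)[OF V x] by (simp add: lin(4) dual_bundle_simps)
    ultimately have "fibre_span V x B \<subseteq> ?T"
      unfolding fibre_span_def by (intro Inter_lower) (use B(2) S(1) in auto)
    then have "fibre V x \<subseteq> ?T" using B(3) by simp
    then show ?thesis unfolding fibre_dual_bundle_pairing[OF g x] by blast
  qed
  then have "fibre (dual_bundle V) x \<subseteq> fibre_span (dual_bundle V) x ?B"
    unfolding fibre_span_def by blast
  moreover have "fibre_span (dual_bundle V) x ?B \<subseteq> fibre (dual_bundle V) x"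
    unfolding fibre_span_def
    by (rule Inter_lower) (use sub fibre_closed[OF V', of x] x in \<open>simp add: dual_bundle_simps(1)\<close>)
  ultimately have "fibre_span (dual_bundle V) x ?B = fibre (dual_bundle V) x" by (rule equalityI[rotated])
  then show "\<exists>B. finite B \<and> B \<subseteq> fibre (dual_bundle V) x \<and> fibre_span (dual_bundle V) x B = fibre (dual_bundle V) x"
    using B(1) sub by (intro exI[of _ ?B]) simp
qed

text \<open>
  The canonical image of \<open>v\<close> in the bidual, extended by zero to all pairs as
  \<^const>\<open>smooth_dual\<close> demands.
\<close>

definition evaluation_at :: "('v, 'x) pbundle \<Rightarrow> 'v \<Rightarrow> 'x \<times> ('v \<Rightarrow> real) \<Rightarrow> real" where
  "evaluation_at V v = (\<lambda>a. if a \<in> fibre (dual_bundle V) (bproj V v) then snd a v else 0)"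

lemma evaluation_at_smooth_dual:
  assumes V: "vector_pseudo_bundle V" and v: "v \<in> fibre V x"
  shows "evaluation_at V v \<in> smooth_dual (dual_bundle V) x"
proof -
  note D = vector_pseudo_bundle_plots(1,2)[OF V]
  note V' = vector_pseudo_bundle_dual[OF V]
  note D' = vector_pseudo_bundle_plots(1)[OF V']
  have x: "x \<in> points (base_space (dual_bundle V))" using fibre_base[OF V v] by (simp add: dual_bundle_simps)
  have bv: "bproj V v = x" "v \<in> points (total_space V)" using v by (simp_all add: fibre_def)
  show ?thesis
  proof (rule smooth_dualI[OF D'])
    show "evaluation_at V v (fadd (dual_bundle V) a b) = evaluation_at V v a + evaluation_at V v b"
      if "a \<in> fibre (dual_bundle V) x" "b \<in> fibre (dual_bundle V) x" for a b
      using that fibre_closed(2)[OF V' x that] by (cases a; cases b) (simp add: evaluation_at_def bv dual_bundle_simps)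
    show "evaluation_at V v (fscale (dual_bundle V) r a) = r * evaluation_at V v a"
      if "a \<in> fibre (dual_bundle V) x" for a r
      using that fibre_closed(3)[OF V' x that, of r] by (cases a) (simp add: evaluation_at_def bv dual_bundle_simps)
    show "evaluation_at V v a = 0" if "a \<notin> fibre (dual_bundle V) x" for a
      using that by (simp add: evaluation_at_def bv)
    fix m W a assume a: "plot (total_space (dual_bundle V)) m W a" "\<And>w. w \<in> W \<Longrightarrow> a w \<in> fibre (dual_bundle V) x"
    note W = plot_open[OF D' a(1)]
    have "smooth_fun m W (\<lambda>w. snd (a w) v)"
      by (rule dual_plot_compose[OF V a(1)[unfolded dual_bundle_simps] smooth_map_inclusion[OF W subset_refl]
            plot_const[OF D(1) W bv(2)]])
        (use a(2) in \<open>simp add: bv fibre_def dual_bundle_simps\<close>)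
    then show "smooth_fun m W (\<lambda>w. evaluation_at V v (a w))"
      by (rule smooth_fun_cong[OF W, rotated]) (simp add: evaluation_at_def bv a(2))
  qed
qed

text \<open>
  Testing \<open>evaluation_at V (e u)\<close> against a plot \<open>a\<close> of the dual is the same as testing
  \<open>a\<close> against the plot \<open>e\<close> of \<open>V\<close>.
\<close>

lemma evaluation_at_plot:
  assumes V: "vector_pseudo_bundle V" and p: "plot (base_space V) n U p"
    and e: "plot (total_space V) n U e" "\<And>u. u \<in> U \<Longrightarrow> e u \<in> fibre V (p u)"
  shows "dual_plot (dual_bundle V) n U (\<lambda>u. (p u, evaluation_at V (e u)))"
proof -
  note D = vector_pseudo_bundle_plots(1,2)[OF V]
  note V' = vector_pseudo_bundle_dual[OF V]
  note D' = vector_pseudo_bundle_plots(1)[OF V']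
  show ?thesis
    unfolding dual_plot_eq_evaluation_plot[OF D']
  proof (rule evaluation_plotI[OF plot_open[OF D(2) p]]; (simp only: fst_conv snd_conv)?)
    show "evaluation_at V (e u) \<in> smooth_dual (dual_bundle V) (p u)" if "u \<in> U" for u
      by (rule evaluation_at_smooth_dual[OF V e(2)[OF that]])
    show "plot (base_space (dual_bundle V)) n U p" using p by (simp add: dual_bundle_simps)
    fix m W f a
    assume W: "openin (Euclidean_space m) W" and f: "smooth_map m W n U f" and a: "plot (total_space (dual_bundle V)) m W a"
      and pa: "\<And>w. w \<in> W \<Longrightarrow> bproj (dual_bundle V) (a w) = p (f w)"
    have fw: "f w \<in> U" if "w \<in> W" for w using f that by (auto simp: smooth_map_def)
    have bp: "bproj V (e (f w)) = p (f w)" if "w \<in> W" for w using e(2)[OF fw[OF that]] by (simp add: fibre_def)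
    have "smooth_fun m W (\<lambda>w. snd (a w) (e (f w)))"
      by (rule dual_plot_compose[OF V a[unfolded dual_bundle_simps] smooth_map_inclusion[OF W subset_refl]
            plot_compose[OF D(1) e(1) W f]])
        (use pa bp in \<open>simp add: dual_bundle_simps\<close>)
    moreover have "a w \<in> fibre (dual_bundle V) (p (f w))" if "w \<in> W" for w
      using plot_points[OF D' a that] pa[OF that] by (simp add: fibre_def)
    ultimately show "smooth_fun m W (\<lambda>w. evaluation_at V (e (f w)) (a w))"
      by (intro smooth_fun_cong[OF W _ \<open>smooth_fun m W (\<lambda>w. snd (a w) (e (f w)))\<close>])
        (simp add: evaluation_at_def bp)
  qed
qed

text \<open>
  The value \<open>g\<^sup>*(\<phi>, \<psi>)\<close> is \<open>\<psi>(v)\<close> for any \<open>v\<close> with \<open>\<phi> = g(v, \<cdot>)\<close>.  Off the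
  fibre it is zero, as for all elements of the tensor square, and over points outside the base
  it is undefined, which makes the form extensional.
\<close>

definition dual_form :: "('v, 'x) pbundle \<Rightarrow> ('x \<Rightarrow> 'v \<Rightarrow> 'v \<Rightarrow> real) \<Rightarrow>
    'x \<Rightarrow> 'x \<times> ('v \<Rightarrow> real) \<Rightarrow> 'x \<times> ('v \<Rightarrow> real) \<Rightarrow> real" where
  "dual_form V g = (\<lambda>x\<in>points (base_space V). \<lambda>a b.
     if a \<in> fibre (dual_bundle V) x \<and> b \<in> fibre (dual_bundle V) x
     then snd b (SOME v. v \<in> fibre V x \<and> g x v = snd a) else 0)"

text \<open>
  The choice of \<open>v\<close> is immaterial: if \<open>g(v', \<cdot>) = g(v, \<cdot>)\<close> then
  \<open>g(w, v') = g(v', w) = g(v, w)\<close>.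
\<close>

lemma dual_form_pairing:
  assumes g: "pseudo_metric V g" and x: "x \<in> points (base_space V)"
    and v: "v \<in> fibre V x" and w: "w \<in> fibre V x"
  shows "dual_form V g x (x, g x v) (x, g x w) = g x v w"
proof -
  define v' where "v' = (SOME v'. v' \<in> fibre V x \<and> g x v' = g x v)"
  have v': "v' \<in> fibre V x" "g x v' = g x v"
    using someI[of "\<lambda>v'. v' \<in> fibre V x \<and> g x v' = g x v" v] v by (auto simp: v'_def)
  have "(x, g x v) \<in> fibre (dual_bundle V) x" for v
    using pseudo_metric_linear(1)[OF g x] by (simp add: fibre_dual_bundle[OF x])
  then have "dual_form V g x (x, g x v) (x, g x w) = g x w v'"
    using x by (simp add: dual_form_def v'_def)
  then show ?thesis using pseudo_metricD(4)[OF g x w v'(1)] v'(2) by simp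
qed

text \<open>
  Expand \<open>\<psi>\<close> in the frame and evaluate at \<open>v\<close>, where \<open>\<phi> = g(v, \<cdot>)\<close>:
  \<open>\<psi>(v) = \<Sum>\<^sub>i \<psi>(e\<^sub>i) g(f\<^sub>i, v) = \<Sum>\<^sub>i \<phi>(f\<^sub>i) \<psi>(e\<^sub>i)\<close>.
\<close>

lemma dual_form_frame:
  assumes g: "pseudo_metric V g" and x: "x \<in> points (base_space V)"
    and frame: "dual_frame V g x m e f"
  shows "dual_form V g x = (\<lambda>a b. \<Sum>i<m. evaluation_at V (f i) a * evaluation_at V (e i) b)"
proof (intro ext)
  fix a b
  note ef = dual_frameD(1,2)[OF frame] and expand = dual_frameD(4)[OF frame]
  have bp: "bproj V (e i) = x" "bproj V (f i) = x" if "i < m" for i using ef[OF that] by (simp_all add: fibre_def)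
  show "dual_form V g x a b = (\<Sum>i<m. evaluation_at V (f i) a * evaluation_at V (e i) b)"
  proof (cases "a \<in> fibre (dual_bundle V) x \<and> b \<in> fibre (dual_bundle V) x")
    case False
    then show ?thesis using x by (auto simp: dual_form_def evaluation_at_def bp intro!: sum.neutral[symmetric])
  next
    case True
    then obtain \<phi> \<psi> where ab: "a = (x, \<phi>)" "b = (x, \<psi>)" "\<phi> \<in> smooth_dual V x" "\<psi> \<in> smooth_dual V x"
      by (auto simp: fibre_dual_bundle[OF x])
    obtain v w where v: "v \<in> fibre V x" "\<phi> = g x v" and w: "w \<in> fibre V x" "\<psi> = g x w"
      using ab(3,4) pseudo_metric_onto_smooth_dual[OF g x] by blast
    have "dual_form V g x a b = g x v w" using dual_form_pairing[OF g x v(1) w(1)] ab v w by simp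
    also have "\<dots> = \<psi> v" using pseudo_metricD(4)[OF g x v(1) w(1)] w(2) by simp
    also have "\<dots> = (\<Sum>i<m. \<psi> (e i) * g x (f i) v)" using expand[OF ab(4)] by (rule fun_cong)
    also have "\<dots> = (\<Sum>i<m. \<phi> (f i) * \<psi> (e i))"
      using pseudo_metricD(4)[OF g x v(1) ef(2)] v(2) by (intro sum.cong) simp_all
    also have "\<dots> = (\<Sum>i<m. evaluation_at V (f i) a * evaluation_at V (e i) b)"
      using True by (intro sum.cong) (simp_all add: evaluation_at_def bp ab)
    finally show ?thesis .
  qed
qed

lemma smooth_dual_dual_sum:
  assumes V: "vector_pseudo_bundle V" and x: "x \<in> points (base_space V)"
    and \<Phi>: "\<Phi> \<in> smooth_dual (dual_bundle V) x" and \<phi>: "\<And>i. i < (m::nat) \<Longrightarrow> \<phi> i \<in> smooth_dual V x"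
  shows "\<Phi> (x, \<lambda>v. \<Sum>i<m. r i * \<phi> i v) = (\<Sum>i<m. r i * \<Phi> (x, \<phi> i))"
  using \<phi>
proof (induction m)
  note V' = vector_pseudo_bundle_dual[OF V]
  note D = vector_pseudo_bundle_plots(1)[OF V]
  {
    case 0
    show ?case using smooth_dual_zero[OF V' _ \<Phi>] x by (simp add: dual_bundle_simps)
  next
    case (Suc m)
    have 1: "(x, \<lambda>v. \<Sum>i<m. r i * \<phi> i v) \<in> fibre (dual_bundle V) x"
      using smooth_dual_sum[OF D, of m \<phi> x r] Suc.prems by (simp add: fibre_dual_bundle[OF x])
    have 2: "(x, \<phi> m) \<in> fibre (dual_bundle V) x" "(x, \<lambda>v. r m * \<phi> m v) \<in> fibre (dual_bundle V) x"
      using smooth_dual_subspace(2)[OF D] Suc.prems by (auto simp: fibre_dual_bundle[OF x])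
    have "\<Phi> (x, \<lambda>v. \<Sum>i<Suc m. r i * \<phi> i v) = \<Phi> (fadd (dual_bundle V) (x, \<lambda>v. \<Sum>i<m. r i * \<phi> i v) (fscale (dual_bundle V) (r m) (x, \<phi> m)))"
      by (simp add: dual_bundle_simps)
    also have "\<dots> = \<Phi> (x, \<lambda>v. \<Sum>i<m. r i * \<phi> i v) + r m * \<Phi> (x, \<phi> m)"
      using smooth_dualD(1)[OF \<Phi> 1 2(2)] smooth_dualD(2)[OF \<Phi> 2(1), of "r m"] by (simp add: dual_bundle_simps)
    finally show ?case using Suc by simp
  }
qed

text \<open>
  A functional \<open>\<Phi>\<close> on the dual fibre is represented by \<open>\<phi> = \<Sum>\<^sub>i \<Phi>(g(f\<^sub>i, \<cdot>)) g(e\<^sub>i, \<cdot>)\<close>,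
  as both sides agree on each \<open>g(f\<^sub>j, \<cdot>)\<close> and these span the dual fibre.
\<close>

lemma dual_form_onto:
  assumes triv: "locally_trivial V" and g: "pseudo_metric V g" and x: "x \<in> points (base_space V)"
  shows "dual_form V g x ` fibre (dual_bundle V) x = smooth_dual (dual_bundle V) x"
proof -
  note V = pseudo_metricD(1)[OF g]
  note D = vector_pseudo_bundle_plots(1)[OF V]
  note V' = vector_pseudo_bundle_dual[OF V]
  note D' = vector_pseudo_bundle_plots(1)[OF V']
  obtain m e f where df: "dual_frame V g x m e f" using ex_dual_frame[OF triv g x] by blast
  note frame = dual_form_frame[OF g x df]
  note ef = dual_frameD(1,2)[OF df] and dual = dual_frameD(3)[OF df] and expand = dual_frameD(4)[OF df]
  have bp: "bproj V (e i) = x" "bproj V (f i) = x" if "i < m" for i using ef[OF that] by (simp_all add: fibre_def)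
  note gd = pseudo_metric_linear(1)[OF g x]
  have "dual_form V g x a \<in> smooth_dual (dual_bundle V) x" for a
    unfolding frame by (intro smooth_dual_sum[OF D'] evaluation_at_smooth_dual[OF V] ef)
  moreover have "\<Phi> \<in> dual_form V g x ` fibre (dual_bundle V) x" if \<Phi>: "\<Phi> \<in> smooth_dual (dual_bundle V) x" for \<Phi>
  proof -
    define \<phi> where "\<phi> = (\<lambda>v. \<Sum>i<m. \<Phi> (x, g x (f i)) * g x (e i) v)"
    have \<phi>: "\<phi> \<in> smooth_dual V x" unfolding \<phi>_def by (intro smooth_dual_sum[OF D] gd)
    then have a: "(x, \<phi>) \<in> fibre (dual_bundle V) x" by (simp add: fibre_dual_bundle[OF x])
    have \<phi>f: "\<phi> (f j) = \<Phi> (x, g x (f j))" if j: "j < m" for j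
    proof -
      have "\<phi> (f j) = (\<Sum>i<m. if i = j then \<Phi> (x, g x (f i)) else 0)"
        unfolding \<phi>_def by (intro sum.cong) (simp_all add: dual j)
      then show ?thesis using j by simp
    qed
    have "\<Phi> b = dual_form V g x (x, \<phi>) b" for b
    proof (cases "b \<in> fibre (dual_bundle V) x")
      case False
      then show ?thesis using smooth_dualD(3)[OF \<Phi>] x by (simp add: dual_form_def)
    next
      case True
      then obtain \<psi> where b: "b = (x, \<psi>)" "\<psi> \<in> smooth_dual V x" by (auto simp: fibre_dual_bundle[OF x])
      have "\<Phi> b = \<Phi> (x, \<lambda>v. \<Sum>i<m. \<psi> (e i) * g x (f i) v)" using expand[OF b(2)] b(1) by simp
      also have "\<dots> = (\<Sum>i<m. \<psi> (e i) * \<Phi> (x, g x (f i)))" by (rule smooth_dual_dual_sum[OF V x \<Phi> gd])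
      also have "\<dots> = (\<Sum>i<m. evaluation_at V (f i) (x, \<phi>) * evaluation_at V (e i) b)"
        using True a by (intro sum.cong) (simp_all add: evaluation_at_def bp b(1) \<phi>f)
      finally show ?thesis unfolding frame .
    qed
    then show ?thesis using a by (intro image_eqI[of _ _ "(x, \<phi>)"]) auto
  qed
  ultimately show ?thesis by blast
qed

text \<open>
  Locally along a plot of the base, \<open>g\<^sup>*\<close> is a finite sum of tensors of bidual plots; the sheaf
  condition glues these descriptions, for each admissible diffeology separately.
\<close>

lemma dual_form_smooth:
  assumes triv: "locally_trivial V" and g: "pseudo_metric V g"
  shows "dsmooth (base_space V) (total_space (dual_tensor_bundle (dual_bundle V))) (\<lambda>x. (x, dual_form V g x))"
  unfolding dsmooth_def
proof (intro conjI allI impI)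
  note V = pseudo_metricD(1)[OF g]
  note D = vector_pseudo_bundle_plots(1,2)[OF V]
  note V' = vector_pseudo_bundle_dual[OF V]
  have "dual_form V g x \<in> dual_tensor_fibre (dual_bundle V) x" if x: "x \<in> points (base_space V)" for x
  proof -
    obtain m e f where ef: "dual_frame V g x m e f" using ex_dual_frame[OF triv g x] by blast
    show ?thesis
      unfolding dual_form_frame[OF g x ef]
      by (intro dual_tensor_fibreI evaluation_at_smooth_dual[OF V] dual_frameD[OF ef])
  qed
  then show "(\<lambda>x. (x, dual_form V g x)) ` points (base_space V) \<subseteq> points (total_space (dual_tensor_bundle (dual_bundle V)))"
    by (auto simp: dual_tensor_bundle_def dual_tensor_with_def dual_bundle_simps)
  fix n U p assume p: "plot (base_space V) n U p"
  have "P n U (\<lambda>u. (p u, dual_form V g (p u)))" if P: "tensor_admissible (dual_bundle V) P" for P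
  proof -
    let ?E = "total_space (dual_tensor_with (dual_bundle V) P)"
    have plotE: "plot ?E = P" by (simp add: dual_tensor_with_def)
    have E: "diffeological_space ?E"
      using P by (intro vector_pseudo_bundle_plots(1)) (simp add: tensor_admissible_def)
    have "plot ?E n U (\<lambda>u. (p u, dual_form V g (p u)))"
    proof (rule plot_local[OF E plot_open[OF D(2) p]])
      fix u assume "u \<in> U"
      from local_dual_frame[OF triv g p this] obtain W m e f where
        W: "u \<in> W" "W \<subseteq> U" "plot (base_space V) n W p"
        and pl: "\<And>i. i < m \<Longrightarrow> plot (total_space V) n W (e i)" "\<And>i. i < m \<Longrightarrow> plot (total_space V) n W (f i)"
        and frame: "\<And>u. u \<in> W \<Longrightarrow> dual_frame V g (p u) m (\<lambda>i. e i u) (\<lambda>i. f i u)"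
        by blast
      note ef = dual_frameD(1,2)[OF frame]
      have "P n W (\<lambda>u. (p u, \<lambda>a b. \<Sum>i<m. evaluation_at V (f i u) a * evaluation_at V (e i u) b))"
        using W(3) by (intro tensor_sum_plot[OF V' P] evaluation_at_plot[OF V W(3)] pl ef) (simp_all add: dual_bundle_simps)
      moreover have "dual_form V g (p w) = (\<lambda>a b. \<Sum>i<m. evaluation_at V (f i w) a * evaluation_at V (e i w) b)" if "w \<in> W" for w
        by (rule dual_form_frame[OF g plot_points[OF D(2) W(3) that] frame[OF that]])
      ultimately show "\<exists>W q. u \<in> W \<and> W \<subseteq> U \<and> plot ?E n W q \<and> (\<forall>w\<in>W. (p w, dual_form V g (p w)) = q w)"
        using W(1,2) unfolding plotE
        by (intro exI[of _ W] exI[of _ "\<lambda>u. (p u, \<lambda>a b. \<Sum>i<m. evaluation_at V (f i u) a * evaluation_at V (e i u) b)"]) simp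
    qed
    then show ?thesis by (simp only: plotE)
  qed
  then have "\<forall>P. tensor_admissible (dual_bundle V) P \<longrightarrow> P n U (\<lambda>u. (p u, dual_form V g (p u)))" by (intro allI impI)
  then show "plot (total_space (dual_tensor_bundle (dual_bundle V))) n U ((\<lambda>x. (x, dual_form V g x)) \<circ> p)"
    by (simp add: dual_tensor_bundle_def dual_tensor_with_def comp_def)
qed

lemma pseudo_metric_dual_form:
  assumes triv: "locally_trivial V" and g: "pseudo_metric V g"
  shows "pseudo_metric (dual_bundle V) (dual_form V g)"
  unfolding pseudo_metric_def
proof (intro conjI ballI)
  show "finite_dim_pseudo_bundle (dual_bundle V)" by (rule finite_dim_dual_bundle[OF g])
  show "dsmooth (base_space (dual_bundle V)) (total_space (dual_tensor_bundle (dual_bundle V))) (\<lambda>x. (x, dual_form V g x))"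
    using dual_form_smooth[OF triv g] by (simp add: dual_bundle_simps)
  fix x assume "x \<in> points (base_space (dual_bundle V))"
  then have x: "x \<in> points (base_space V)" by (simp add: dual_bundle_simps)
  have pair: "\<exists>v\<in>fibre V x. a = (x, g x v)" if "a \<in> fibre (dual_bundle V) x" for a
    using that unfolding fibre_dual_bundle_pairing[OF g x] by blast
  show "dual_form V g x a b = dual_form V g x b a" if "a \<in> fibre (dual_bundle V) x" "b \<in> fibre (dual_bundle V) x" for a b
    using pair[OF that(1)] pair[OF that(2)] dual_form_pairing[OF g x] pseudo_metricD(4)[OF g x] by auto
  show "0 \<le> dual_form V g x a a" if "a \<in> fibre (dual_bundle V) x" for a
    using pair[OF that] dual_form_pairing[OF g x] pseudo_metricD(5)[OF g x] by auto
  show "bilin_rank (dual_bundle V) x (dual_form V g x) = fun_dim (smooth_dual (dual_bundle V) x)"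
    by (simp add: bilin_rank_def dual_form_onto[OF triv g x])
qed

section \<open>Existence and uniqueness\<close>

text \<open>
  Elements of the tensor square vanish off the fibre, and every pair in the fibre has the form
  \<open>(g(v, \<cdot>), g(w, \<cdot>))\<close>, where the value is prescribed.
\<close>

lemma dual_pseudo_metric_unique:
  assumes g: "pseudo_metric V g"
    and gs: "gs \<in> extensional (points (base_space V))" "pseudo_metric (dual_bundle V) gs" "induced_by V g gs"
    and hs: "hs \<in> extensional (points (base_space V))" "pseudo_metric (dual_bundle V) hs" "induced_by V g hs"
  shows "gs = hs"
proof (rule extensionalityI[OF gs(1) hs(1)], intro ext)
  fix x a b assume x: "x \<in> points (base_space V)"
  then have x': "x \<in> points (base_space (dual_bundle V))" by (simp add: dual_bundle_simps)
  note D' = vector_pseudo_bundle_plots(1)[OF pseudo_metricD(1)[OF gs(2)]]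
  have zero: "ks x a b = 0" if "pseudo_metric (dual_bundle V) ks" "a \<notin> fibre (dual_bundle V) x \<or> b \<notin> fibre (dual_bundle V) x" for ks
  proof -
    note slice = dual_tensor_fibre_slice[OF D' pseudo_metricD(3)[OF that(1) x']]
    from that(2) show ?thesis
      using smooth_dualD(3)[OF slice(2), of a b] smooth_dualD(3)[OF slice(1), of b a] by blast
  qed
  have value_at: "ks x (x, g x v) (x, g x w) = g x v w" if "induced_by V g ks" "v \<in> fibre V x" "w \<in> fibre V x" for ks v w
    using that x unfolding induced_by_def pairing_def by (simp add: fibre_def)
  show "gs x a b = hs x a b"
  proof (cases "a \<in> fibre (dual_bundle V) x \<and> b \<in> fibre (dual_bundle V) x")
    case False then show ?thesis using zero[OF gs(2)] zero[OF hs(2)] by auto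
  next
    case True
    then obtain v w where "v \<in> fibre V x" "w \<in> fibre V x" "a = (x, g x v)" "b = (x, g x w)"
      unfolding fibre_dual_bundle_pairing[OF g x] by blast
    then show ?thesis using value_at[OF gs(3)] value_at[OF hs(3)] by simp
  qed
qed

theorem theorem8p3:
  fixes V :: "('v, 'x) pbundle"
    and g :: "'x \<Rightarrow> 'v \<Rightarrow> 'v \<Rightarrow> real"
  assumes "finite_dim_pseudo_bundle V"
    and "locally_trivial V"
    and "pseudo_metric V g"
  shows "\<exists>!gs. gs \<in> extensional (points (base_space V)) \<and>
           pseudo_metric (dual_bundle V) gs \<and> induced_by V g gs"
proof (rule ex1I[of _ "dual_form V g"], intro conjI)
  show "dual_form V g \<in> extensional (points (base_space V))" by (simp add: dual_form_def)
  show "pseudo_metric (dual_bundle V) (dual_form V g)" by (rule pseudo_metric_dual_form[OF assms(2,3)])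
  show "induced_by V g (dual_form V g)"
    unfolding induced_by_def
  proof (intro ballI)
    fix x v w assume "x \<in> points (base_space V)" "v \<in> fibre V x" "w \<in> fibre V x"
    then show "dual_form V g x (pairing V g v) (pairing V g w) = g x v w"
      using dual_form_pairing[OF assms(3), of x v w] by (simp add: pairing_def fibre_def)
  qed
  then show "gs = dual_form V g"
    if "gs \<in> extensional (points (base_space V)) \<and> pseudo_metric (dual_bundle V) gs \<and> induced_by V g gs" for gs
    using that pseudo_metric_dual_form[OF assms(2,3)]
    by (intro dual_pseudo_metric_unique[OF assms(3)]) (simp_all add: dual_form_def)
qed

end
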